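(* Assume $\det R_1\neq 0$ and $\det R_2=0$. Let $A_1:\mathring W^1(0,N+1)\to L_2(0,N+1)$ be a bounded linear operator, and let $A_R:L_2(0,N+1)\to L_2(0,N+1)$ be the unbounded operator with domain $$\mathcal D(A_R)=\{v\in\mathring W^1(0,N+1): R_Qv\in W^2(0,N+1)\},\qquad A_Rv=-(R_Qv)''+A_1v .$$ Then $A_R$ is Fredholm and $\operatorname{ind}A_R=0$.
   Context: $N\ge1$ is a natural number and $b_j$ ($-N\le j\le N$) are real numbers. $W^k(a,b)$ is the $L_2$-based Sobolev space of order $k$; $\mathring W^1(a,b)$ is the subspace of those $u\in W^1(a,b)$ with $u(a)=u(b)=0$. The difference operator $R:L_2(\mathbb R)\to L_2(\mathbb R)$ is $(Rv)(t)=\sum_{j=-N}^N b_j v(t+j)$. Let $I_Q:L_2(0,N+1)\to L_2(\mathbb R)$ be extension by zero, $P_Q:L_2(\mathbb R)\to L_2(0,N+1)$ restriction to $(0,N+1)$, and $R_Q=P_QRI_Q:L_2(0,N+1)\to L_2(0,N+1)$. $R_1$ is the $(N+1)\times(N+1)$ matrix with entries $r_{ik}=b_{k-i}$ ($i,k=1,\dots,N+1$), and $R_2$ is the $N\times N$ matrix obtained from $R_1$ by deleting the last row and the last column. A (possibly unbounded) linear operator $T$ between Banach spaces is Fredholm if it is closed, $\dim\ker T<\infty$, and its range is closed and of finite codimension; $\operatorname{ind}T=\dim\ker T-\operatorname{codim}\operatorname{Im}T$. *)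

theory Defs
  imports
    "HOL-Analysis.Analysis"
    "Jordan_Normal_Form.Determinant"
begin

section \<open>The space of square-integrable functions on the real line\<close>

text \<open>
  The scalar field is a type of class \<open>euclidean_space\<close> and \<open>real_normed_field\<close>;
  \<^typ>\<open>real\<close> and \<^typ>\<open>complex\<close> are instances, so real-valued and complex-valued
  functions are both covered.
\<close>

definition square_integrable :: "(real \<Rightarrow> 'a::euclidean_space) \<Rightarrow> bool" where
  "square_integrable f \<longleftrightarrow>
     f \<in> borel_measurable lborel \<and> integrable lborel (\<lambda>x. (norm (f x))\<^sup>2)"

definition l2_rel :: "(real \<Rightarrow> 'a::euclidean_space) \<Rightarrow> (real \<Rightarrow> 'a) \<Rightarrow> bool" where
  "l2_rel f g \<longleftrightarrow> square_integrable f \<and> square_integrable g \<and> (AE x in lborel. f x = g x)"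

lemma square_integrable_zero: "square_integrable (\<lambda>x. 0)"
  by (simp add: square_integrable_def)

lemma square_integrable_add:
  assumes "square_integrable f" "square_integrable g"
  shows "square_integrable (\<lambda>x. f x + g x)"
proof -
  have [measurable]: "f \<in> borel_measurable lborel" "g \<in> borel_measurable lborel"
    using assms by (auto simp: square_integrable_def)
  have i: "integrable lborel (\<lambda>x. 2 * (norm (f x))\<^sup>2 + 2 * (norm (g x))\<^sup>2)"
    using assms by (auto simp: square_integrable_def)
  have le: "(norm (f x + g x))\<^sup>2 \<le> 2 * (norm (f x))\<^sup>2 + 2 * (norm (g x))\<^sup>2" for x
  proof -
    have "(norm (f x + g x))\<^sup>2 \<le> (norm (f x) + norm (g x))\<^sup>2"
      by (intro power_mono norm_triangle_ineq) auto
    also have "\<dots> \<le> 2 * (norm (f x))\<^sup>2 + 2 * (norm (g x))\<^sup>2"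
      using sum_squares_bound[of "norm (f x)" "norm (g x)"]
      by (simp add: power2_sum)
    finally show ?thesis .
  qed
  have "integrable lborel (\<lambda>x. (norm (f x + g x))\<^sup>2)"
    by (rule Bochner_Integration.integrable_bound[OF i]) (use le in auto)
  then show ?thesis by (simp add: square_integrable_def)
qed

lemma square_integrable_scaleR:
  "square_integrable f \<Longrightarrow> square_integrable (\<lambda>x. c *\<^sub>R f x)"
  by (auto simp: square_integrable_def power_mult_distrib)

lemma square_integrable_mult:
  fixes f :: "real \<Rightarrow> 'a::{euclidean_space,real_normed_field}"
  shows "square_integrable f \<Longrightarrow> square_integrable (\<lambda>x. c * f x)"
  by (auto simp: square_integrable_def power_mult_distrib norm_mult)

lemma square_integrable_inner:
  assumes "square_integrable f" "square_integrable g"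
  shows "integrable lborel (\<lambda>x. inner (f x) (g x))"
proof -
  have [measurable]: "f \<in> borel_measurable lborel" "g \<in> borel_measurable lborel"
    using assms by (auto simp: square_integrable_def)
  have i: "integrable lborel (\<lambda>x. (norm (f x))\<^sup>2 + (norm (g x))\<^sup>2)"
    using assms by (auto simp: square_integrable_def)
  have le: "\<bar>inner (f x) (g x)\<bar> \<le> (norm (f x))\<^sup>2 + (norm (g x))\<^sup>2" for x
  proof -
    have "\<bar>inner (f x) (g x)\<bar> \<le> norm (f x) * norm (g x)"
      by (rule Cauchy_Schwarz_ineq2)
    also have "\<dots> \<le> (norm (f x))\<^sup>2 + (norm (g x))\<^sup>2"
      using sum_squares_bound[of "norm (f x)" "norm (g x)"]
        mult_nonneg_nonneg[OF norm_ge_zero[of "f x"] norm_ge_zero[of "g x"]]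
      by linarith
    finally show ?thesis .
  qed
  show ?thesis
    by (rule Bochner_Integration.integrable_bound[OF i]) (use le in auto)
qed

lemma square_integrable_shift:
  assumes "square_integrable f"
  shows "square_integrable (\<lambda>x. f (x + h))"
proof -
  have [measurable]: "f \<in> borel_measurable borel"
    using assms by (auto simp: square_integrable_def)
  have "integrable lborel (\<lambda>x. (norm (f (h + 1 * x)))\<^sup>2)"
    using assms lborel_integrable_real_affine[of "\<lambda>x. (norm (f x))\<^sup>2" 1 h]
    by (auto simp: square_integrable_def)
  then show ?thesis by (simp add: square_integrable_def add.commute)
qed

lemma square_integrable_cut:
  assumes "square_integrable f"
  shows "square_integrable (\<lambda>x. indicator {a<..<b} x *\<^sub>R f x)"
proof -
  have [measurable]: "f \<in> borel_measurable lborel"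
    using assms by (auto simp: square_integrable_def)
  have i: "integrable lborel (\<lambda>x. (norm (f x))\<^sup>2)"
    using assms by (auto simp: square_integrable_def)
  have "integrable lborel (\<lambda>x. (norm (indicator {a<..<b} x *\<^sub>R f x))\<^sup>2)"
    by (rule Bochner_Integration.integrable_bound[OF i]) (auto simp: indicator_def)
  then show ?thesis by (simp add: square_integrable_def)
qed

lemma part_equivp_l2_rel: "part_equivp (l2_rel :: (real \<Rightarrow> 'a::euclidean_space) \<Rightarrow> _)"
proof (rule part_equivpI)
  show "\<exists>f::real \<Rightarrow> 'a. l2_rel f f"
    by (rule exI[of _ "\<lambda>x. 0"]) (simp add: l2_rel_def square_integrable_zero)
  show "symp (l2_rel :: (real \<Rightarrow> 'a) \<Rightarrow> _)"
    by (auto simp: symp_def l2_rel_def elim: AE_mp)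
  show "transp (l2_rel :: (real \<Rightarrow> 'a) \<Rightarrow> _)"
  proof (rule transpI)
    fix f g h :: "real \<Rightarrow> 'a"
    assume a: "l2_rel f g" "l2_rel g h"
    then have "AE x in lborel. f x = g x" "AE x in lborel. g x = h x"
      by (auto simp: l2_rel_def)
    then have "AE x in lborel. f x = h x" by eventually_elim simp
    with a show "l2_rel f h" by (simp add: l2_rel_def)
  qed
qed

text \<open>\<open>'a l2\<close> is \<open>L\<^sub>2(\<real>)\<close> with values in \<open>'a\<close>.\<close>

quotient_type (overloaded) 'a l2 = "real \<Rightarrow> 'a::euclidean_space" / partial: l2_rel
  by (rule part_equivp_l2_rel)

instantiation l2 :: (euclidean_space) real_vector
begin

lift_definition zero_l2 :: "'a l2" is "\<lambda>x. 0"
  by (simp add: l2_rel_def square_integrable_zero)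

lift_definition plus_l2 :: "'a l2 \<Rightarrow> 'a l2 \<Rightarrow> 'a l2" is "\<lambda>f g x. f x + g x"
  by (auto simp: l2_rel_def intro: square_integrable_add elim: AE_mp)

lift_definition scaleR_l2 :: "real \<Rightarrow> 'a l2 \<Rightarrow> 'a l2" is "\<lambda>c f x. c *\<^sub>R f x"
  by (auto simp: l2_rel_def intro: square_integrable_scaleR elim: AE_mp)

lift_definition uminus_l2 :: "'a l2 \<Rightarrow> 'a l2" is "\<lambda>f x. - f x"
  using square_integrable_scaleR[of _ "-1"] by (auto simp: l2_rel_def elim: AE_mp)

definition minus_l2 :: "'a l2 \<Rightarrow> 'a l2 \<Rightarrow> 'a l2" where
  "minus_l2 u v = u + - v"

instance
proof
  fix u v w :: "'a l2" and r s :: real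
  note [simp] = l2_rel_def square_integrable_zero
  note [intro] = square_integrable_add square_integrable_scaleR
  show "u + v + w = u + (v + w)"
    by transfer (auto simp: add.assoc)
  show "u + v = v + u"
    by transfer (auto simp: add.commute)
  show "0 + u = u"
    by transfer auto
  show "- u + u = 0"
    by transfer auto
  show "u - v = u + - v"
    by (simp add: minus_l2_def)
  show "r *\<^sub>R (u + v) = r *\<^sub>R u + r *\<^sub>R v"
    by transfer (auto simp: scaleR_add_right)
  show "(r + s) *\<^sub>R u = r *\<^sub>R u + s *\<^sub>R u"
    by transfer (auto simp: scaleR_add_left)
  show "r *\<^sub>R s *\<^sub>R u = (r * s) *\<^sub>R u"
    by transfer auto
  show "1 *\<^sub>R u = u"
    by transfer auto
qed

end

instantiation l2 :: (euclidean_space) real_inner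
begin

text \<open>
  This is the real inner product; for complex values it is the real part of the Hermitian one.
  The norm it induces is the usual \<open>L\<^sub>2\<close> norm.
\<close>

lift_definition inner_l2 :: "'a l2 \<Rightarrow> 'a l2 \<Rightarrow> real" is
  "\<lambda>f g. LINT x|lborel. inner (f x) (g x)"
proof -
  fix f f' g g' :: "real \<Rightarrow> 'a"
  assume a: "l2_rel f f'" "l2_rel g g'"
  then have [measurable]: "f \<in> borel_measurable lborel" "f' \<in> borel_measurable lborel"
    "g \<in> borel_measurable lborel" "g' \<in> borel_measurable lborel"
    by (auto simp: square_integrable_def l2_rel_def)
  have "AE x in lborel. f x = f' x" "AE x in lborel. g x = g' x"
    using a by (auto simp: l2_rel_def)
  then have "AE x in lborel. inner (f x) (g x) = inner (f' x) (g' x)"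
    by eventually_elim simp
  then show "(LINT x|lborel. inner (f x) (g x)) = (LINT x|lborel. inner (f' x) (g' x))"
    by (intro integral_cong_AE) auto
qed

definition norm_l2 :: "'a l2 \<Rightarrow> real" where
  "norm_l2 u = sqrt (inner u u)"

definition sgn_l2 :: "'a l2 \<Rightarrow> 'a l2" where
  "sgn_l2 u = u /\<^sub>R norm u"

definition dist_l2 :: "'a l2 \<Rightarrow> 'a l2 \<Rightarrow> real" where
  "dist_l2 u v = norm (u - v)"

definition uniformity_l2 :: "('a l2 \<times> 'a l2) filter" where
  "uniformity_l2 = (INF e\<in>{0 <..}. principal {(u, v). dist u v < e})"

definition open_l2 :: "'a l2 set \<Rightarrow> bool" where
  "open_l2 U \<longleftrightarrow> (\<forall>u\<in>U. eventually (\<lambda>(u', v). u' = u \<longrightarrow> v \<in> U) uniformity)"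

instance
proof
  fix u v w :: "'a l2" and r s :: real
  note [simp] = l2_rel_def square_integrable_zero
  note [intro] = square_integrable_add square_integrable_scaleR
  show "inner u v = inner v u"
    by transfer (simp add: inner_commute)
  show "inner (u + v) w = inner u w + inner v w"
    by transfer (simp add: inner_add_left square_integrable_inner)
  show "inner (r *\<^sub>R u) v = r * inner u v"
    by transfer simp
  show "0 \<le> inner u u"
    by transfer (simp add: integral_nonneg_AE)
  show "inner u u = 0 \<longleftrightarrow> u = 0"
  proof transfer
    fix f :: "real \<Rightarrow> 'a"
    assume "l2_rel f f"
    then have f: "square_integrable f" by simp
    have "(LINT x|lborel. inner (f x) (f x)) = 0 \<longleftrightarrow> (AE x in lborel. inner (f x) (f x) = 0)"
      by (rule integral_nonneg_eq_0_iff_AE) (use square_integrable_inner[OF f f] in auto)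
    then show "(LINT x|lborel. inner (f x) (f x)) = 0 \<longleftrightarrow> l2_rel f (\<lambda>x. 0)"
      using f by simp
  qed
qed (simp_all add: norm_l2_def sgn_l2_def dist_l2_def uniformity_l2_def open_l2_def)

end

lift_definition scale_l2 ::
  "'a::{euclidean_space,real_normed_field} \<Rightarrow> 'a l2 \<Rightarrow> 'a l2" is "\<lambda>c f x. c * f x"
  by (auto simp: l2_rel_def intro: square_integrable_mult elim: AE_mp)

lemma vector_space_scale_l2:
  "vector_space (scale_l2 :: 'a::{euclidean_space,real_normed_field} \<Rightarrow> _)"
proof
  fix c d :: 'a and u v :: "'a l2"
  note [simp] = l2_rel_def
  note [intro] = square_integrable_add square_integrable_mult
  show "scale_l2 c (u + v) = scale_l2 c u + scale_l2 c v"
    by transfer (auto simp: distrib_left)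
  show "scale_l2 (c + d) u = scale_l2 c u + scale_l2 d u"
    by transfer (auto simp: distrib_right)
  show "scale_l2 c (scale_l2 d u) = scale_l2 (c * d) u"
    by transfer (auto simp: mult.assoc)
  show "scale_l2 1 u = u"
    by transfer auto
qed

text \<open>\<open>L\<^sub>2(a,b)\<close> is identified, by extension by zero, with a subspace of \<open>L\<^sub>2(\<real>)\<close>.\<close>

definition L2_on :: "real \<Rightarrow> real \<Rightarrow> 'a::euclidean_space l2 set" where
  "L2_on a b = {u. AE x in lborel. x \<notin> {a<..<b} \<longrightarrow> rep_l2 u x = 0}"

section \<open>Sobolev spaces on an interval\<close>

definition test_function :: "real \<Rightarrow> real \<Rightarrow> (real \<Rightarrow> real) \<Rightarrow> bool" where
  "test_function a b \<phi> \<longleftrightarrow>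
     (\<forall>k x. (deriv ^^ k) \<phi> differentiable (at x)) \<and>
     (\<exists>c d. a < c \<and> c \<le> d \<and> d < b \<and> (\<forall>x. x \<notin> {c..d} \<longrightarrow> \<phi> x = 0))"

definition has_weak_deriv ::
  "real \<Rightarrow> real \<Rightarrow> nat \<Rightarrow> 'a::euclidean_space l2 \<Rightarrow> 'a l2 \<Rightarrow> bool" where
  "has_weak_deriv a b k u g \<longleftrightarrow>
     (\<forall>\<phi>. test_function a b \<phi> \<longrightarrow>
        (LINT x:{a<..<b}|lborel. (deriv ^^ k) \<phi> x *\<^sub>R rep_l2 u x) =
        (-1) ^ k *\<^sub>R (LINT x:{a<..<b}|lborel. \<phi> x *\<^sub>R rep_l2 g x))"

definition weak_deriv :: "real \<Rightarrow> real \<Rightarrow> nat \<Rightarrow> 'a::euclidean_space l2 \<Rightarrow> 'a l2" where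
  "weak_deriv a b k u = (THE g. g \<in> L2_on a b \<and> has_weak_deriv a b k u g)"

definition Sobolev :: "nat \<Rightarrow> real \<Rightarrow> real \<Rightarrow> 'a::euclidean_space l2 set" where
  "Sobolev k a b =
     {u \<in> L2_on a b. \<forall>j\<le>k. \<exists>g\<in>L2_on a b. has_weak_deriv a b j u g}"

definition Sobolev_norm :: "nat \<Rightarrow> real \<Rightarrow> real \<Rightarrow> 'a::euclidean_space l2 \<Rightarrow> real" where
  "Sobolev_norm k a b u = sqrt (\<Sum>j\<le>k. (norm (weak_deriv a b j u))\<^sup>2)"

text \<open>Boundary values are those of the continuous representative on \<open>[a,b]\<close>.\<close>

definition Sobolev1_0 :: "real \<Rightarrow> real \<Rightarrow> 'a::euclidean_space l2 set" where
  "Sobolev1_0 a b =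
     {u \<in> Sobolev 1 a b. \<exists>f. continuous_on {a..b} f \<and>
        (AE x in lborel. x \<in> {a<..<b} \<longrightarrow> rep_l2 u x = f x) \<and> f a = 0 \<and> f b = 0}"

section \<open>Fredholm operators\<close>

text \<open>
  The scalar multiplications \<open>s\<close>, \<open>t\<close> are explicit because the scalar field need not be
  \<open>\<real>\<close>; \<open>X\<close> and \<open>Y\<close> are subspaces of the ambient types, and \<open>T\<close> matters only on \<open>D\<close>.
\<close>

definition linear_operator_on ::
  "('f::field \<Rightarrow> 'v::ab_group_add \<Rightarrow> 'v) \<Rightarrow> ('f \<Rightarrow> 'w::ab_group_add \<Rightarrow> 'w) \<Rightarrow>
   'v set \<Rightarrow> 'w set \<Rightarrow> ('v \<Rightarrow> 'w) \<Rightarrow> bool" where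
  "linear_operator_on s t D Y T \<longleftrightarrow>
     module.subspace s D \<and> T ` D \<subseteq> Y \<and>
     (\<forall>u\<in>D. \<forall>v\<in>D. T (u + v) = T u + T v) \<and> (\<forall>c. \<forall>u\<in>D. T (s c u) = t c (T u))"

definition kernel_on :: "'v set \<Rightarrow> ('v \<Rightarrow> 'w::zero) \<Rightarrow> 'v set" where
  "kernel_on D T = {u \<in> D. T u = 0}"

definition finite_dimensional :: "('f::field \<Rightarrow> 'v::ab_group_add \<Rightarrow> 'v) \<Rightarrow> 'v set \<Rightarrow> bool" where
  "finite_dimensional s V \<longleftrightarrow> (\<exists>B. finite B \<and> V \<subseteq> module.span s B)"

text \<open>
  The cosets of \<open>B \<subseteq> Y\<close> generate the quotient \<open>Y/V\<close> iff \<open>V \<union> B\<close> generates \<open>Y\<close>, and the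
  dimension of \<open>Y/V\<close> is the least size of a generating set.
\<close>

definition generates_mod ::
  "('f::field \<Rightarrow> 'w::ab_group_add \<Rightarrow> 'w) \<Rightarrow> 'w set \<Rightarrow> 'w set \<Rightarrow> 'w set \<Rightarrow> bool" where
  "generates_mod s Y V B \<longleftrightarrow> finite B \<and> B \<subseteq> Y \<and> Y \<subseteq> module.span s (V \<union> B)"

definition finite_codim :: "('f::field \<Rightarrow> 'w::ab_group_add \<Rightarrow> 'w) \<Rightarrow> 'w set \<Rightarrow> 'w set \<Rightarrow> bool" where
  "finite_codim s Y V \<longleftrightarrow> (\<exists>B. generates_mod s Y V B)"

definition codim :: "('f::field \<Rightarrow> 'w::ab_group_add \<Rightarrow> 'w) \<Rightarrow> 'w set \<Rightarrow> 'w set \<Rightarrow> nat" where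
  "codim s Y V = (LEAST n. \<exists>B. generates_mod s Y V B \<and> card B = n)"

definition fredholm ::
  "('f::field \<Rightarrow> 'v::real_normed_vector \<Rightarrow> 'v) \<Rightarrow> ('f \<Rightarrow> 'w::real_normed_vector \<Rightarrow> 'w) \<Rightarrow>
   'v set \<Rightarrow> 'w set \<Rightarrow> 'v set \<Rightarrow> ('v \<Rightarrow> 'w) \<Rightarrow> bool" where
  "fredholm s t X Y D T \<longleftrightarrow>
     D \<subseteq> X \<and> linear_operator_on s t D Y T \<and>
     closedin (top_of_set (X \<times> Y)) ((\<lambda>u. (u, T u)) ` D) \<and>
     finite_dimensional s (kernel_on D T) \<and>
     closedin (top_of_set Y) (T ` D) \<and>
     finite_codim t Y (T ` D)"

definition fredholm_index ::
  "('f::field \<Rightarrow> 'v::ab_group_add \<Rightarrow> 'v) \<Rightarrow> ('f \<Rightarrow> 'w::ab_group_add \<Rightarrow> 'w) \<Rightarrow>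
   'w set \<Rightarrow> 'v set \<Rightarrow> ('v \<Rightarrow> 'w) \<Rightarrow> int" where
  "fredholm_index s t Y D T =
     int (vector_space.dim s (kernel_on D T)) - int (codim t Y (T ` D))"

section \<open>The differential-difference operator\<close>

lift_definition shift_l2 :: "real \<Rightarrow> 'a::euclidean_space l2 \<Rightarrow> 'a l2" is "\<lambda>h f x. f (x + h)"
proof -
  fix h :: real and f g :: "real \<Rightarrow> 'a"
  assume a: "l2_rel f g"
  then have [measurable]: "f \<in> borel_measurable borel" "g \<in> borel_measurable borel"
    by (auto simp: square_integrable_def l2_rel_def)
  have "AE x in lborel. f (h + 1 * x) = g (h + 1 * x)"
    by (rule AE_borel_affine) (use a in \<open>auto simp: l2_rel_def\<close>)
  then show "l2_rel (\<lambda>x. f (x + h)) (\<lambda>x. g (x + h))"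
    using a by (simp add: l2_rel_def square_integrable_shift add.commute)
qed

text \<open>Restriction to \<open>(a,b)\<close>, as a map \<open>L\<^sub>2(\<real>) \<rightarrow> L\<^sub>2(a,b)\<close> under the above identification.\<close>

lift_definition restrict_l2 :: "real \<Rightarrow> real \<Rightarrow> 'a::euclidean_space l2 \<Rightarrow> 'a l2" is
  "\<lambda>a b f x. indicator {a<..<b} x *\<^sub>R f x"
  by (auto simp: l2_rel_def intro: square_integrable_cut elim: AE_mp)

definition diff_op :: "nat \<Rightarrow> (int \<Rightarrow> real) \<Rightarrow> 'a::euclidean_space l2 \<Rightarrow> 'a l2" where
  "diff_op N b v = (\<Sum>j\<in>{- int N..int N}. b j *\<^sub>R shift_l2 (of_int j) v)"

text \<open>The extension \<open>I\<^sub>Q\<close> is the inclusion of \<open>L2_on 0 (N + 1)\<close>, hence invisible here.\<close>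

definition diff_op_Q :: "nat \<Rightarrow> (int \<Rightarrow> real) \<Rightarrow> 'a::euclidean_space l2 \<Rightarrow> 'a l2" where
  "diff_op_Q N b v = restrict_l2 0 (real N + 1) (diff_op N b v)"

text \<open>Indices start at 0; the entries depend only on the difference of the indices.\<close>

definition R1_mat :: "nat \<Rightarrow> (int \<Rightarrow> real) \<Rightarrow> real Matrix.mat" where
  "R1_mat N b = Matrix.mat (N + 1) (N + 1) (\<lambda>(i, k). b (int k - int i))"

definition R2_mat :: "nat \<Rightarrow> (int \<Rightarrow> real) \<Rightarrow> real Matrix.mat" where
  "R2_mat N b = mat_delete (R1_mat N b) N N"

definition bounded_operator_W1_0 ::
  "nat \<Rightarrow> ('a::{euclidean_space,real_normed_field} l2 \<Rightarrow> 'a l2) \<Rightarrow> bool" where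
  "bounded_operator_W1_0 N A \<longleftrightarrow>
     linear_operator_on scale_l2 scale_l2 (Sobolev1_0 0 (real N + 1)) (L2_on 0 (real N + 1)) A \<and>
     (\<exists>C. \<forall>u\<in>Sobolev1_0 0 (real N + 1). norm (A u) \<le> C * Sobolev_norm 1 0 (real N + 1) u)"

definition A_R_dom :: "nat \<Rightarrow> (int \<Rightarrow> real) \<Rightarrow> 'a::euclidean_space l2 set" where
  "A_R_dom N b =
     {v \<in> Sobolev1_0 0 (real N + 1). diff_op_Q N b v \<in> Sobolev 2 0 (real N + 1)}"

definition A_R ::
  "nat \<Rightarrow> (int \<Rightarrow> real) \<Rightarrow> ('a::euclidean_space l2 \<Rightarrow> 'a l2) \<Rightarrow> 'a l2 \<Rightarrow> 'a l2" where
  "A_R N b A1 v = - weak_deriv 0 (real N + 1) 2 (diff_op_Q N b v) + A1 v"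

end

theory Submission
  imports Defs
begin

text \<open>
  Let \<open>L = N + 1\<close> and \<open>J f\<close> be the primitive of \<open>f\<close> vanishing at 0. The functions in \<open>W\<^sup>1\<close> are
  \<open>d + J g\<close> with \<open>d\<close> a scalar, and those with zero boundary values are \<open>J g\<close> with \<open>g\<close> of mean zero; for
  the latter, \<open>(R\<^sub>Q J g)' = R\<^sub>Q g\<close>. Since \<open>det R\<^sub>1 \<noteq> 0\<close>, \<open>R\<^sub>Q\<close> is invertible on \<open>L\<^sub>2\<close>, so the domain of \<open>A\<^sub>R\<close>
  consists of the functions \<open>v = J R\<^sub>Q\<^sup>-\<^sup>1 (d + J f)\<close> subject to the single scalar constraint that
  \<open>R\<^sub>Q\<^sup>-\<^sup>1 (d + J f)\<close> has mean zero, and \<open>A\<^sub>R v = A\<^sub>1 v - f\<close>. One free scalar against one scalar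
  constraint: the domain is the image of an injective operator \<open>S\<close> on \<open>L\<^sub>2\<close>, and \<open>A\<^sub>R \<circ> S\<close> is
  \<open>- id\<close> plus an operator of small norm plus one of finite rank, because \<open>J\<close> is a norm limit of
  operators of finite rank. Such an operator has index 0.
\<close>

section \<open>Perturbations of the identity by operators of small norm and finite rank\<close>

text \<open>\<open>R\<^sub>Q\<close> sends a function with zero boundary values to one whose
  boundary values need not vanish, but the resulting constant is lost on differentiation. Hence the
  condition \<open>R\<^sub>Q v \<in> W\<^sup>2\<close> concerns only the derivative of
  \<open>v\<close>, and that derivative is the natural unknown. \<open>A\<^sub>1\<close> is bounded
  on \<open>W\<^sup>1\<close> and not on \<open>L\<^sub>2\<close>; composed with \<open>J\<close> it
  becomes bounded on \<open>L\<^sub>2\<close>. The second \<open>J\<close>, the one acting on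
  \<open>f\<close>, is then still available for the finite-rank approximation. Balancing one free
  scalar against one constraint requires that the constraint be non-trivial. The mean of
  \<open>R\<^sub>Q\<^sup>-\<^sup>1 1\<close> can be zero, and in that case the functional taking
  \<open>f\<close> to the mean of \<open>R\<^sub>Q\<^sup>-\<^sup>1 J f\<close> must not vanish
  identically. It is non-zero at \<open>R\<^sub>Q p\<close>, where \<open>p\<close> is the
  derivative of a tent between two consecutive integers. Scalar multiplication is an explicit
  parameter throughout, because dimension and codimension are counted over the scalar field, which
  may be the complex numbers.\<close>

definition bounded_linear_over ::
  "('f::field \<Rightarrow> 'v::real_normed_vector \<Rightarrow> 'v) \<Rightarrow> ('f \<Rightarrow> 'w::real_normed_vector \<Rightarrow> 'w) \<Rightarrow> ('v \<Rightarrow> 'w) \<Rightarrow> bool" where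
  "bounded_linear_over s t T \<longleftrightarrow>
     Vector_Spaces.linear s t T \<and> (\<exists>K. \<forall>u. norm (T u) \<le> K * norm u)"

lemma bounded_linear_overI:
  "Vector_Spaces.linear s t T \<Longrightarrow> (\<And>u. norm (T u) \<le> K * norm u) \<Longrightarrow> bounded_linear_over s t T"
  by (auto simp: bounded_linear_over_def)

lemma bounded_linear_over_bound:
  assumes "bounded_linear_over s t T"
  obtains K where "K \<ge> 0" "\<And>u. norm (T u) \<le> K * norm u"
proof -
  obtain K where K: "\<And>u. norm (T u) \<le> K * norm u" using assms by (auto simp: bounded_linear_over_def)
  have "norm (T u) \<le> \<bar>K\<bar> * norm u" for u
    by (rule order_trans[OF K]) (simp add: mult_right_mono)
  then show thesis by (intro that[of "\<bar>K\<bar>"]) auto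
qed

lemma bounded_linear_over_compose:
  assumes "bounded_linear_over s t T" "bounded_linear_over t r U"
  shows "bounded_linear_over s r (\<lambda>u. U (T u))"
proof -
  interpret T: Vector_Spaces.linear s t T using assms by (simp add: bounded_linear_over_def)
  interpret U: Vector_Spaces.linear t r U using assms by (simp add: bounded_linear_over_def)
  obtain K where K: "K \<ge> 0" "\<And>u. norm (T u) \<le> K * norm u" using bounded_linear_over_bound[OF assms(1)] by blast
  obtain K' where K': "K' \<ge> 0" "\<And>u. norm (U u) \<le> K' * norm u" using bounded_linear_over_bound[OF assms(2)] by blast
  show ?thesis
  proof (rule bounded_linear_overI)
    show "Vector_Spaces.linear s r (\<lambda>u. U (T u))"
      by unfold_locales (simp_all add: T.add U.add T.scale U.scale)
    fix u
    have "norm (U (T u)) \<le> K' * norm (T u)" by (rule K')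
    also have "\<dots> \<le> K' * (K * norm u)" using K K' by (intro mult_left_mono) auto
    finally show "norm (U (T u)) \<le> (K' * K) * norm u" by simp
  qed
qed

lemma bounded_linear_over_add:
  assumes "bounded_linear_over s t T" "bounded_linear_over s t U"
  shows "bounded_linear_over s t (\<lambda>u. T u + U u)"
proof -
  interpret T: Vector_Spaces.linear s t T using assms by (simp add: bounded_linear_over_def)
  interpret U: Vector_Spaces.linear s t U using assms by (simp add: bounded_linear_over_def)
  obtain K where K: "\<And>u. norm (T u) \<le> K * norm u" using bounded_linear_over_bound[OF assms(1)] by blast
  obtain K' where K': "\<And>u. norm (U u) \<le> K' * norm u" using bounded_linear_over_bound[OF assms(2)] by blast
  show ?thesis
  proof (rule bounded_linear_overI)
    show "Vector_Spaces.linear s t (\<lambda>u. T u + U u)"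
      by unfold_locales (simp_all add: T.add U.add T.scale U.scale T.vs2.scale_right_distrib)
    fix u
    show "norm (T u + U u) \<le> (K + K') * norm u"
      using norm_triangle_ineq[of "T u" "U u"] K[of u] K'[of u] by (simp add: distrib_right)
  qed
qed

lemma bounded_linear_over_uminus:
  assumes "bounded_linear_over s t T"
  shows "bounded_linear_over s t (\<lambda>u. - T u)"
proof -
  interpret T: Vector_Spaces.linear s t T using assms by (simp add: bounded_linear_over_def)
  obtain K where K: "\<And>u. norm (T u) \<le> K * norm u" using bounded_linear_over_bound[OF assms(1)] by blast
  show ?thesis
  proof (rule bounded_linear_overI)
    show "Vector_Spaces.linear s t (\<lambda>u. - T u)"
      by unfold_locales (simp_all add: T.add T.scale)
  qed (use K in simp)
qed

lemma bounded_linear_over_diff: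
  assumes "bounded_linear_over s t T" "bounded_linear_over s t U"
  shows "bounded_linear_over s t (\<lambda>u. T u - U u)"
  using bounded_linear_over_add[OF assms(1) bounded_linear_over_uminus[OF assms(2)]] by simp

lemma bounded_linear_over_sum:
  assumes "vector_space s" "vector_space t" "finite I" "\<And>i. i \<in> I \<Longrightarrow> bounded_linear_over s t (T i)"
  shows "bounded_linear_over s t (\<lambda>u. \<Sum>i\<in>I. T i u)"
  using assms(3,4)
proof (induction I rule: finite_induct)
  case empty
  interpret s: vector_space s by fact
  interpret t: vector_space t by fact
  have "Vector_Spaces.linear s t (\<lambda>u. 0)" by unfold_locales simp_all
  then show ?case by (intro bounded_linear_overI[of s t _ 0]) auto
next
  case (insert i I)
  then show ?case by (simp add: bounded_linear_over_add)
qed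

lemma bounded_linear_over_tendsto:
  assumes "bounded_linear_over s t T" "x \<longlonglongrightarrow> l"
  shows "(\<lambda>n. T (x n)) \<longlonglongrightarrow> T l"
proof (rule LIM_zero_cancel)
  interpret T: Vector_Spaces.linear s t T using assms by (simp add: bounded_linear_over_def)
  obtain K where K: "\<And>u. norm (T u) \<le> K * norm u" using bounded_linear_over_bound[OF assms(1)] by blast
  have "(\<lambda>n. K * norm (x n - l)) \<longlonglongrightarrow> 0"
    by (intro tendsto_mult_right_zero tendsto_norm_zero LIM_zero assms)
  then show "(\<lambda>n. T (x n) - T l) \<longlonglongrightarrow> 0"
    by (rule Lim_null_comparison[rotated]) (simp add: T.diff[symmetric] K)
qed

section \<open>Codimension, independence and closed finite-dimensional subspaces\<close>

text \<open>\<open>codim\<close> is a minimum over generating sets, so the lower bound is the point.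
  The linear projection that fixes \<open>B\<close> and kills \<open>R\<close> maps any set
  generating \<open>Y\<close> modulo \<open>V\<close> to a set whose span contains the independent
  set \<open>B\<close>.\<close>

lemma (in vector_space) codim_eq_card:
  assumes ind: "independent (R \<union> B)" and disj: "R \<inter> B = {}" and fin: "finite B"
    and B: "B \<subseteq> Y" and Y: "span (R \<union> B) = Y" and V: "span R = V"
  shows "codim scale Y V = card B" "finite_codim scale Y V"
proof -
  have "Y \<subseteq> span (V \<union> B)"
    using V Y span_mono[of "R \<union> B" "V \<union> B"] span_superset[of R] by auto
  then have gen: "generates_mod scale Y V B"
    using fin B by (simp add: generates_mod_def)
  then show "finite_codim scale Y V" by (auto simp: finite_codim_def)
  interpret pair: vector_space_pair scale scale by unfold_locales
  obtain p where "Vector_Spaces.linear scale scale p"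
    and pB: "\<And>x. x \<in> R \<union> B \<Longrightarrow> p x = (if x \<in> B then x else 0)"
    using pair.linear_independent_extend[OF ind, of "\<lambda>x. if x \<in> B then x else 0"] by auto
  then interpret p: Vector_Spaces.linear scale scale p by simp
  have "p ` R \<subseteq> {0}" using pB disj by auto
  then have pV: "p ` V \<subseteq> {0}"
    using span_mono[of "p ` R" "{0}"] by (simp add: V[symmetric] p.span_image[symmetric])
  have le: "card B \<le> card B'" if "generates_mod scale Y V B'" for B'
  proof -
    have B': "finite B'" "Y \<subseteq> span (V \<union> B')" using that by (auto simp: generates_mod_def)
    have "B = p ` B" using pB by force
    also have "\<dots> \<subseteq> p ` span (V \<union> B')" using B B' by auto
    also have "\<dots> = span (p ` V \<union> p ` B')" by (simp add: p.span_image[symmetric] image_Un)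
    also have "\<dots> \<subseteq> span (insert 0 (p ` B'))" using pV by (intro span_mono) auto
    also have "\<dots> = span (p ` B')" by (simp add: span_insert_0)
    finally have "card B \<le> card (p ` B')"
      using independent_span_bound[of "p ` B'" B] B' ind independent_mono[of "R \<union> B" B] by auto
    also have "\<dots> \<le> card B'" using B' by (intro card_image_le) auto
    finally show ?thesis .
  qed
  show "codim scale Y V = card B"
    unfolding codim_def
  proof (rule Least_equality)
    show "\<exists>B'. generates_mod scale Y V B' \<and> card B' = card B" using gen by blast
  qed (use le in blast)
qed

lemma (in vector_space) independent_Un_if_trivial_Int:
  assumes "independent A" "independent B" "span A \<inter> span B \<subseteq> {0}"
  shows "independent (A \<union> B)" "A \<inter> B = {}"
proof -
  show disj: "A \<inter> B = {}"
    using assms span_superset[of A] span_superset[of B] dependent_zero[of A] by blast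
  show "independent (A \<union> B)"
    unfolding independent_explicit_module
  proof (intro allI impI)
    fix t u v
    assume t: "finite t" "t \<subseteq> A \<union> B" "(\<Sum>v\<in>t. scale (u v) v) = 0" "v \<in> t"
    have teq: "t = (t \<inter> A) \<union> (t \<inter> B)" using t by auto
    have "(\<Sum>v\<in>t. scale (u v) v) = (\<Sum>v\<in>t \<inter> A. scale (u v) v) + (\<Sum>v\<in>t \<inter> B. scale (u v) v)"
      by (subst teq, subst sum.union_disjoint) (use t disj in auto)
    then have eq: "(\<Sum>v\<in>t \<inter> A. scale (u v) v) = - (\<Sum>v\<in>t \<inter> B. scale (u v) v)"
      using t by (simp add: eq_neg_iff_add_eq_0)
    moreover have A: "(\<Sum>v\<in>t \<inter> A. scale (u v) v) \<in> span A"
      by (intro span_sum span_scale span_base) auto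
    moreover have B: "- (\<Sum>v\<in>t \<inter> B. scale (u v) v) \<in> span B"
      by (intro span_neg span_sum span_scale span_base) auto
    ultimately have "(\<Sum>v\<in>t \<inter> A. scale (u v) v) = 0" "(\<Sum>v\<in>t \<inter> B. scale (u v) v) = 0"
      using assms(3) by auto
    moreover have "finite (t \<inter> A)" "finite (t \<inter> B)" using t by auto
    ultimately show "u v = 0"
      using assms(1,2) teq t(4) unfolding independent_explicit_module by (metis Int_lower2 UnE)
  qed
qed

text \<open>The projection that fixes \<open>A\<close> and kills \<open>B\<close> is the identity on
  one span and zero on the other.\<close>

lemma (in vector_space) span_Int_if_independent:
  assumes "independent (A \<union> B)" "A \<inter> B = {}"
  shows "span A \<inter> span B = {0}"
proof -
  interpret pair: vector_space_pair scale scale by unfold_locales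
  obtain p where "Vector_Spaces.linear scale scale p"
    and p: "\<And>x. x \<in> A \<union> B \<Longrightarrow> p x = (if x \<in> A then x else 0)"
    using pair.linear_independent_extend[OF assms(1), of "\<lambda>x. if x \<in> A then x else 0"] by auto
  then interpret p: Vector_Spaces.linear scale scale p by simp
  have "p x = x" if "x \<in> span A" for x
    using that by (induction rule: span_induct_alt) (auto simp: p p.add p.scale p.zero)
  moreover have "p x = 0" if "x \<in> span B" for x
    using that assms(2) by (induction rule: span_induct_alt) (auto simp: p p.add p.scale p.zero)
  ultimately have "x = 0" if "x \<in> span A \<inter> span B" for x
    using that by (metis IntD1 IntD2)
  then show ?thesis using span_zero by blast
qed

text \<open>A vector \<open>b\<close> outside the closed span of \<open>B\<close> has positive
  distance \<open>d\<close> from it, and this bounds the coefficient of \<open>b\<close>. In a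
  convergent sequence these coefficients are therefore Cauchy, and completeness of the scalar field
  supplies their limit.\<close>

lemma closed_span_finite:
  fixes s :: "'f::{real_normed_field,banach} \<Rightarrow> 'v::real_normed_vector \<Rightarrow> 'v"
  assumes "vector_space s" and norm_s: "\<And>c u. norm (s c u) = norm c * norm u" and "finite B"
  shows "closed (module.span s B)"
proof -
  interpret vector_space s by fact
  show ?thesis
    using \<open>finite B\<close>
  proof (induction B)
    case empty
    show ?case by simp
  next
    case (insert b B)
    show ?case
    proof (cases "b \<in> span B")
      case True
      then show ?thesis using insert by (simp add: span_redundant)
    next
      case False
      define d where "d = infdist b (span B)"
      have d: "d > 0"
        unfolding d_def using insert False span_zero[of B]
        by (intro infdist_pos_not_in_closed) auto
      have lower: "norm c * d \<le> norm (s c b + v)" if v: "v \<in> span B" for c v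
      proof (cases "c = 0")
        case True
        then show ?thesis by simp
      next
        case False
        have "d \<le> dist b (- s (1 / c) v)"
          unfolding d_def by (intro infdist_le span_neg span_scale v)
        also have "\<dots> = norm (b + s (1 / c) v)" by (simp add: dist_norm)
        finally have "norm c * d \<le> norm c * norm (b + s (1 / c) v)"
          by (intro mult_left_mono) auto
        also have "\<dots> = norm (s c b + v)"
          using False by (simp add: norm_s[symmetric] scale_right_distrib)
        finally show ?thesis .
      qed
      show ?thesis
        unfolding closed_sequential_limits
      proof (intro allI impI, elim conjE)
        fix y l assume y: "\<forall>n. y n \<in> span (insert b B)" and l: "y \<longlonglongrightarrow> l"
        obtain c where c: "\<And>n. y n - s (c n) b \<in> span B"
          using y unfolding span_insert by (auto simp: choice_iff)
        have cd: "norm (c m - c n) * d \<le> dist (y m) (y n)" for m n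
        proof -
          have "norm (c m - c n) * d
              \<le> norm (s (c m - c n) b + ((y m - s (c m) b) - (y n - s (c n) b)))"
            by (intro lower span_diff c)
          also have "\<dots> = dist (y m) (y n)"
            by (simp add: dist_norm scale_left_diff_distrib algebra_simps)
          finally show ?thesis .
        qed
        have "Cauchy c"
        proof (rule metric_CauchyI)
          fix e :: real assume "e > 0"
          then have "e * d > 0" using d by simp
          then obtain M where M: "\<And>m n. m \<ge> M \<Longrightarrow> n \<ge> M \<Longrightarrow> dist (y m) (y n) < e * d"
            using LIMSEQ_imp_Cauchy[OF l] unfolding Cauchy_def by blast
          show "\<exists>M. \<forall>m\<ge>M. \<forall>n\<ge>M. dist (c m) (c n) < e"
          proof (intro exI allI impI)
            fix m n assume "m \<ge> M" "n \<ge> M"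
            then have "norm (c m - c n) * d < e * d" using M cd[of m n] by force
            then show "dist (c m) (c n) < e" using d by (simp add: dist_norm)
          qed
        qed
        then obtain c0 where c0: "c \<longlonglongrightarrow> c0" using Cauchy_convergent convergent_def by blast
        have "(\<lambda>n. norm (c n - c0) * norm b) \<longlonglongrightarrow> 0"
          using tendsto_mult_left_zero[OF tendsto_norm_zero[OF c0[THEN LIM_zero]]] by blast
        then have "(\<lambda>n. s (c n - c0) b) \<longlonglongrightarrow> 0"
          by (subst tendsto_norm_zero_iff[symmetric]) (simp add: norm_s)
        then have "(\<lambda>n. s (c n) b - s c0 b) \<longlonglongrightarrow> 0" by (simp add: scale_left_diff_distrib)
        then have "(\<lambda>n. s (c n) b) \<longlonglongrightarrow> s c0 b" by (rule LIM_zero_cancel)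
        then have "(\<lambda>n. y n - s (c n) b) \<longlonglongrightarrow> l - s c0 b" by (intro tendsto_diff l)
        then have "l - s c0 b \<in> span B"
          by (rule closed_sequentially[OF insert.IH c])
        then show "l \<in> span (insert b B)" unfolding span_insert by auto
      qed
    qed
  qed
qed

text \<open>Componentwise scaling makes \<open>closed_span_finite\<close> applicable to a
  finite-dimensional piece of a graph inside the product space.\<close>

lemma vector_space_prod_scale:
  assumes "vector_space s"
  shows "vector_space (\<lambda>c (u, v). (s c u, s c v))"
proof -
  interpret vector_space s by fact
  show ?thesis
    by unfold_locales (auto simp: scale_right_distrib scale_left_distrib)
qed

text \<open>
  With \<open>P = id - E\<close> invertible by a Neumann argument, \<open>A \<circ> S = - P \<circ> (id - P\<^sup>-\<^sup>1 \<circ> F)\<close>, and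
  \<open>P\<^sup>-\<^sup>1 \<circ> F\<close> has finite rank, so that kernel, range and graph are governed by the finite-dimensional
  space \<open>V\<close> spanned by its range.
\<close>

theorem fredholm_index_zero_perturbation:
  fixes s :: "'f::{real_normed_field,banach} \<Rightarrow> 'v::banach \<Rightarrow> 'v"
  assumes vs: "vector_space s" and norm_s: "\<And>c u. norm (s c u) = norm c * norm u"
    and X: "module.subspace s X" "closed X"
    and S: "bounded_linear_over s s S" "inj_on S X" "S ` X \<subseteq> X"
    and E: "Vector_Spaces.linear s s E" "\<And>u. norm (E u) \<le> norm u / 2" "E ` X \<subseteq> X"
    and F: "bounded_linear_over s s F" "range F \<subseteq> module.span s B" "finite B" "B \<subseteq> X"
    and A: "\<And>u. u \<in> X \<Longrightarrow> A (S u) = F u - (u - E u)"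
  shows "fredholm s s X X (S ` X) A \<and> fredholm_index s s X (S ` X) A = 0"
proof -
  interpret vector_space s by fact
  interpret pair: vector_space_pair s s by unfold_locales
  interpret S: Vector_Spaces.linear s s S using S(1) by (simp add: bounded_linear_over_def)
  interpret E: Vector_Spaces.linear s s E by fact
  interpret F: Vector_Spaces.linear s s F using F(1) by (simp add: bounded_linear_over_def)
  define P where "P u = u - E u" for u
  \<comment> \<open>\<open>P u = y\<close> read as a fixed-point equation for a contraction with
    factor 1/2; completeness of the ambient space enters here.\<close>
  have "\<exists>!u. y + E u = u" for y
  proof (rule banach_fix_type)
    show "\<forall>u v. dist (y + E u) (y + E v) \<le> (1 / 2) * dist u v"
      using E(2) by (simp add: dist_norm E.diff[symmetric])
  qed auto
  then have ex1: "\<exists>!u. P u = y" for y unfolding P_def by (metis diff_eq_eq)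
  define Q where "Q y = (THE u. P u = y)" for y
  have PQ: "P (Q y) = y" for y unfolding Q_def by (rule theI'[OF ex1])
  have QP: "Q (P u) = u" for u using ex1 PQ by metis
  have linP: "Vector_Spaces.linear s s P"
    by unfold_locales (simp_all add: P_def E.add E.scale scale_right_diff_distrib)
  interpret P: Vector_Spaces.linear s s P by (rule linP)
  have linQ: "Vector_Spaces.linear s s Q"
    by unfold_locales (metis PQ QP P.add, metis PQ QP P.scale)
  interpret Q: Vector_Spaces.linear s s Q by (rule linQ)
  \<comment> \<open>The fixed point is only known to lie in the ambient space. The iterates started
    at \<open>y\<close> stay in \<open>X\<close> and their error halves at each step, so closedness
    of \<open>X\<close> catches the limit.\<close>
  have PX: "P u \<in> X \<longleftrightarrow> u \<in> X" for u
  proof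
    assume "P u \<in> X"
    define y where "y = P u"
    have "(\<lambda>n. ((\<lambda>v. y + E v) ^^ n) y) \<longlonglongrightarrow> u"
    proof (rule LIM_zero_cancel, rule Lim_null_comparison)
      show "\<forall>\<^sub>F n in sequentially. norm (((\<lambda>v. y + E v) ^^ n) y - u) \<le> norm (y - u) * (1 / 2) ^ n"
      proof (rule always_eventually, rule allI)
        fix n show "norm (((\<lambda>v. y + E v) ^^ n) y - u) \<le> norm (y - u) * (1 / 2) ^ n"
        proof (induction n)
          case (Suc n)
          have "((\<lambda>v. y + E v) ^^ Suc n) y - u = E (((\<lambda>v. y + E v) ^^ n) y - u)"
            by (simp add: y_def P_def E.diff)
          then show ?case using E(2)[of "((\<lambda>v. y + E v) ^^ n) y - u"] Suc by simp
        qed simp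
      qed
      show "(\<lambda>n. norm (y - u) * (1 / 2) ^ n) \<longlonglongrightarrow> 0"
        by (intro tendsto_mult_right_zero LIMSEQ_power_zero) auto
    qed
    moreover have "((\<lambda>v. y + E v) ^^ n) y \<in> X" for n
      using \<open>P u \<in> X\<close> E(3) by (induction n) (auto simp: y_def intro!: subspace_add[OF X(1)])
    ultimately show "u \<in> X" by (rule closed_sequentially[OF X(2), rotated])
  next
    assume "u \<in> X"
    then show "P u \<in> X" using E(3) by (auto simp: P_def intro!: subspace_diff[OF X(1)])
  qed
  have QX: "Q u \<in> X \<longleftrightarrow> u \<in> X" for u using PX[of "Q u"] PQ by simp
  have Qb: "norm (Q y) \<le> 2 * norm y" for y
  proof -
    have "norm (Q y) \<le> norm (P (Q y)) + norm (E (Q y))"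
      unfolding P_def by (metis diff_add_cancel norm_triangle_ineq)
    then show ?thesis using E(2)[of "Q y"] by (simp add: PQ)
  qed
  have bQ: "bounded_linear_over s s Q" by (rule bounded_linear_overI[OF linQ Qb])
  define F' where "F' u = Q (F u)" for u
  have bF': "bounded_linear_over s s F'"
    unfolding F'_def by (rule bounded_linear_over_compose[OF F(1) bQ])
  interpret F': Vector_Spaces.linear s s F' using bF' by (simp add: bounded_linear_over_def)
  define B1 where "B1 = Q ` B"
  define V where "V = span B1"
  have finB1: "finite B1" using F(3) by (simp add: B1_def)
  have VX: "V \<subseteq> X" unfolding V_def B1_def using F(4) QX
    by (intro span_minimal X(1)) auto
  have F'V: "F' u \<in> V" for u
    using F(2) by (auto simp: F'_def V_def B1_def Q.span_image)
  have sV: "subspace V" by (simp add: V_def)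
  define T where "T u = u - F' u" for u
  have linT: "Vector_Spaces.linear s s T"
    by unfold_locales (simp_all add: T_def F'.add F'.scale scale_right_diff_distrib)
  interpret T: Vector_Spaces.linear s s T by (rule linT)
  have TX: "T u \<in> X \<longleftrightarrow> u \<in> X" for u
  proof -
    have "F' u \<in> X" using F'V VX by auto
    then show ?thesis
      using subspace_add[OF X(1), of "T u" "F' u"] subspace_diff[OF X(1), of u "F' u"]
      by (auto simp: T_def)
  qed
  have TV: "T ` V \<subseteq> V" using F'V sV by (auto simp: T_def intro: subspace_diff)
  have AT: "A (S u) = P (- T u)" if "u \<in> X" for u
  proof -
    have "P (T u) = P u - F u" by (simp add: T_def P.diff F'_def PQ)
    then show ?thesis using A[OF that] by (simp add: P.neg) (simp add: P_def)
  qed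
  \<comment> \<open>\<open>T\<close> commutes with \<open>F'\<close>, and
    \<open>y = T (y + z)\<close> as soon as \<open>F' y = T z\<close>. Membership in the range thus
    becomes a condition inside the finite-dimensional \<open>V\<close>.\<close>
  have ranT: "y \<in> T ` X \<longleftrightarrow> y \<in> X \<and> F' y \<in> T ` V" for y
  proof safe
    fix u assume u: "u \<in> X"
    show "T u \<in> X" using u TX by simp
    have "F' (T u) = T (F' u)" by (simp add: T_def F'.diff)
    then show "F' (T u) \<in> T ` V" using F'V by blast
  next
    fix z assume z: "y \<in> X" "F' y = T z" "z \<in> V"
    then have "y = T (y + z)" by (simp add: T.add) (simp add: T_def)
    moreover have "y + z \<in> X" using z VX X(1) by (auto intro: subspace_add)
    ultimately show "y \<in> T ` X" by blast
  qed
  have ran: "A ` S ` X = P ` T ` X"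
  proof -
    have "A ` S ` X = (\<lambda>u. P (T u)) ` uminus ` X"
      unfolding image_image by (intro image_cong refl) (simp add: AT T.neg)
    moreover have "uminus ` X = X"
      using subspace_neg[OF X(1)] by (force simp: image_iff)
    ultimately show ?thesis by (simp add: image_image)
  qed
  have "closed (T ` V)"
    unfolding V_def T.span_image[symmetric]
    using finB1 by (intro closed_span_finite vs norm_s) auto
  then have closed_TX: "closed (P ` T ` X)"
  proof -
    assume cl: "closed (T ` V)"
    show ?thesis
      unfolding closed_sequential_limits
    proof (intro allI impI, elim conjE)
      fix y l assume y: "\<forall>n. y n \<in> P ` T ` X" and l: "y \<longlonglongrightarrow> l"
      have "Q (y n) \<in> T ` X" for n using y QP by (metis imageE)
      then have Qy: "Q (y n) \<in> X" "F' (Q (y n)) \<in> T ` V" for n using ranT by blast+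
      have Ql: "(\<lambda>n. Q (y n)) \<longlonglongrightarrow> Q l" by (rule bounded_linear_over_tendsto[OF bQ l])
      have "Q l \<in> X" by (rule closed_sequentially[OF X(2) Qy(1) Ql])
      moreover have "F' (Q l) \<in> T ` V"
        by (rule closed_sequentially[OF cl Qy(2) bounded_linear_over_tendsto[OF bF' Ql]])
      ultimately have "Q l \<in> T ` X" using ranT by blast
      then show "l \<in> P ` T ` X" using PQ by (metis imageI)
    qed
  qed
  \<comment> \<open>A solution of \<open>T u = 0\<close> equals \<open>F' u\<close> and so lies in
    \<open>V\<close>.\<close>
  have ker: "kernel_on (S ` X) A = S ` {u \<in> V. T u = 0}"
  proof -
    have "A (S u) = 0 \<longleftrightarrow> T u = 0" if "u \<in> X" for u
      using AT[OF that] QP[of "- T u"] by (auto simp: Q.zero P.zero)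
    moreover have "u \<in> V" if "T u = 0" for u
      using that F'V[of u] by (simp add: T_def)
    ultimately show ?thesis using VX unfolding kernel_on_def by blast
  qed

  \<comment> \<open>Bases of the kernel and of a complement of the range\<close>
  define Kr where "Kr = {u \<in> V. T u = 0}"
  have sKr: "subspace Kr"
    using sV unfolding Kr_def subspace_def by (auto simp: T.add T.scale T.zero)
  have fdim: "finite D" if "independent D" "D \<subseteq> V" for D
    using independent_span_bound[OF finB1 that(1)] that(2) by (simp add: V_def)
  \<comment> \<open>Rank and nullity on \<open>V\<close>: \<open>D\<close> is a basis of the kernel
    and \<open>C\<close> completes it to a basis of \<open>V\<close>, so \<open>T\<close> is
    injective on the span of \<open>C\<close>. Completing the image of \<open>C\<close> under
    \<open>T\<close> to a basis \<open>W\<close> of \<open>V\<close> adds a set \<open>G\<close>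
    with as many elements as \<open>D\<close>, and \<open>G\<close> will also complement the range
    of \<open>T\<close> on all of \<open>X\<close>.\<close>
  obtain D where D: "D \<subseteq> Kr" "independent D" "Kr \<subseteq> span D"
    using maximal_independent_subset[of Kr] by auto
  have spanD: "span D = Kr" using D sKr span_minimal by blast
  obtain D' where D': "D \<subseteq> D'" "D' \<subseteq> V" "independent D'" "V \<subseteq> span D'"
    using maximal_independent_subset_extend[of D V] D by (auto simp: Kr_def)
  define C where "C = D' - D"
  have indC: "independent C" using D' independent_mono by (auto simp: C_def)
  have CV: "C \<subseteq> V" using D' by (auto simp: C_def)
  have finD': "finite D'" "finite D" "finite C"
    using fdim[OF D'(3,2)] D' by (auto simp: C_def intro: finite_subset)
  have spanD': "span D' = V" using D' sV span_minimal by blast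
  have injT: "inj_on T (span C)"
  proof (rule inj_onI)
    fix x y assume xy: "x \<in> span C" "y \<in> span C" "T x = T y"
    have "x - y \<in> span C" using xy by (intro span_diff)
    moreover have "x - y \<in> span D"
    proof -
      have "x - y \<in> V" using \<open>x - y \<in> span C\<close> CV sV span_minimal by blast
      then show ?thesis using xy by (simp add: spanD Kr_def T.diff)
    qed
    moreover have "span C \<inter> span D = {0}"
      using D'(1,3) span_Int_if_independent[of D C] by (simp add: C_def Un_absorb1 Int_commute)
    ultimately have "x - y = 0" by blast
    then show "x = y" by simp
  qed
  have indTC: "independent (T ` C)"
    using T.independent_injective_image[OF indC injT] .
  have cardTC: "card (T ` C) = card C"
    using inj_on_subset[OF injT span_superset] by (rule card_image)
  have spanTC: "span (T ` C) = T ` V"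
  proof
    show "span (T ` C) \<subseteq> T ` V"
      using CV sV by (intro span_minimal T.subspace_image) auto
    have "T ` V = span (T ` D')" by (simp add: spanD'[symmetric] T.span_image)
    also have "\<dots> \<subseteq> span (insert 0 (T ` C))"
      using D(1) by (intro span_mono) (auto simp: C_def Kr_def)
    also have "\<dots> = span (T ` C)" by (rule span_insert_0)
    finally show "T ` V \<subseteq> span (T ` C)" .
  qed
  obtain W where W: "T ` C \<subseteq> W" "W \<subseteq> V" "independent W" "V \<subseteq> span W"
    using maximal_independent_subset_extend[of "T ` C" V] indTC CV TV by blast
  define G where "G = W - T ` C"
  have finW: "finite W" "finite G"
    using fdim[OF W(3,2)] by (auto simp: G_def)
  have spanW: "span W = V" using W sV span_minimal by blast
  have "card W = card D'"
    using W D' spanW spanD' finW finD' by (metis dim_span_eq_card_independent)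
  then have cardG: "card G = card D"
    using W(1) D'(1) finW finD' cardTC card_mono[OF finW(1) W(1)] card_mono[OF finD'(1) D'(1)]
    by (simp add: G_def C_def card_Diff_subset finite_subset)
  obtain R where R: "R \<subseteq> T ` X" "independent R" "T ` X \<subseteq> span R"
    using maximal_independent_subset[of "T ` X"] by auto
  have sTX: "subspace (T ` X)" using X(1) by (rule T.subspace_image)
  have spanR: "span R = T ` X" using R sTX span_minimal by blast
  \<comment> \<open>An element \<open>y\<close> of the range that lies in \<open>V\<close> already
    comes from \<open>V\<close>, because its preimage is \<open>u = y + F' u\<close>. The
    intersection is therefore decided inside the basis \<open>W\<close>.\<close>
  have "span R \<inter> span G \<subseteq> {0}"
  proof
    fix y assume y: "y \<in> span R \<inter> span G"
    then have yV: "y \<in> V" using W(2) sV span_minimal[of G V] by (auto simp: G_def)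
    obtain u where u: "u \<in> X" "y = T u" using y spanR by auto
    have "u = y + F' u" using u by (simp add: T_def)
    then have "u \<in> V" using yV F'V[of u] sV by (metis subspace_add)
    then have "y \<in> span (T ` C)" using u spanTC by auto
    moreover have "span (T ` C) \<inter> span G = {0}"
      using W(1,3) span_Int_if_independent[of "T ` C" G] by (simp add: G_def Un_absorb1)
    ultimately show "y \<in> {0}" using y by auto
  qed
  then have RG: "independent (R \<union> G)" "R \<inter> G = {}"
    using independent_Un_if_trivial_Int[of R G] R(2) W(3) independent_mono[of W G]
    by (auto simp: G_def)
  have GX: "G \<subseteq> X" using W VX by (auto simp: G_def)
  have spanRG: "span (R \<union> G) = X"
  proof
    show "span (R \<union> G) \<subseteq> X"
      using R GX TX X(1) by (intro span_minimal) auto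
    show "X \<subseteq> span (R \<union> G)"
    proof
      fix u assume u: "u \<in> X"
      have "W \<subseteq> span (R \<union> G)"
      proof -
        have "T ` C \<subseteq> span R" using spanR CV VX by auto
        then show ?thesis
          using span_mono[of R "R \<union> G"] span_superset[of "R \<union> G"] unfolding G_def by blast
      qed
      then have "V \<subseteq> span (R \<union> G)" using spanW span_minimal[of W] by auto
      then have "F' u \<in> span (R \<union> G)" using F'V by auto
      moreover have "T u \<in> span (R \<union> G)" using spanR u span_mono[of R "R \<union> G"] by auto
      ultimately have "T u + F' u \<in> span (R \<union> G)" by (intro span_add)
      then show "u \<in> span (R \<union> G)" by (simp add: T_def)
    qed
  qed
  have injP: "inj P" using QP by (metis injI)
  have cod: "codim s X (P ` T ` X) = card (P ` G)" "finite_codim s X (P ` T ` X)"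
  proof -
    have i: "independent (P ` R \<union> P ` G)"
      using P.independent_injective_image[OF RG(1)] injP
      by (simp add: image_Un inj_on_subset)
    have d: "P ` R \<inter> P ` G = {}"
      using RG(2) injP by (simp add: image_Int[symmetric])
    have f: "finite (P ` G)" using finW by simp
    have g: "P ` G \<subseteq> X" using GX PX by auto
    have "P ` X = X"
      using PX PQ QX by (metis (no_types, lifting) image_eqI subsetI subset_antisym image_subset_iff)
    then have y: "span (P ` R \<union> P ` G) = X"
      by (simp add: image_Un[symmetric] P.span_image spanRG)
    have v: "span (P ` R) = P ` T ` X" by (simp add: P.span_image spanR)
    show "codim s X (P ` T ` X) = card (P ` G)" "finite_codim s X (P ` T ` X)"
      using codim_eq_card[OF i d f g y v] by auto
  qed
  have "inj_on S (span D)" unfolding spanD by (rule inj_on_subset[OF S(2)]) (use VX in \<open>auto simp: Kr_def\<close>)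
  then have "dim (S ` Kr) = card D"
    using S.independent_injective_image[OF D(2)] spanD
      dim_span_eq_card_independent[of "S ` D"]
    by (metis S.span_image card_image inj_on_subset span_superset)
  then have index: "fredholm_index s s X (S ` X) A = 0"
    using cardG cod(1) injP unfolding fredholm_index_def ker ran Kr_def
    by (simp add: card_image inj_on_subset)
  have fin_ker: "finite_dimensional s (kernel_on (S ` X) A)"
    unfolding ker Kr_def[symmetric] finite_dimensional_def spanD[symmetric] S.span_image[symmetric]
    using finD' by blast
  have lin: "linear_operator_on s s (S ` X) X A"
    unfolding linear_operator_on_def
  proof (intro conjI ballI allI)
    show "subspace (S ` X)" using X(1) by (rule S.subspace_image)
    show "A ` S ` X \<subseteq> X" using ran PX TX by auto
  next
    fix u v assume "u \<in> S ` X" "v \<in> S ` X"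
    then obtain u' v' where [simp]: "u = S u'" "v = S v'" "u' \<in> X" "v' \<in> X" by blast
    have "A (S (u' + v')) = A (S u') + A (S v')"
      using subspace_add[OF X(1), of u' v'] by (simp add: AT T.add P.neg P.add P.diff)
    then show "A (u + v) = A u + A v" by (simp add: S.add)
  next
    fix c u assume "u \<in> S ` X"
    then obtain u' where [simp]: "u = S u'" "u' \<in> X" by blast
    have "A (S (s c u')) = s c (A (S u'))"
      using subspace_scale[OF X(1), of u' c] by (simp add: AT T.scale P.neg P.scale)
    then show "A (s c u) = s c (A u)" by (simp add: S.scale)
  qed
  \<comment> \<open>Convergence of \<open>S (f n)\<close> gives no control over \<open>f n\<close>,
    but the second components converge and determine \<open>y n = T (f n)\<close>. Since
    \<open>f n - y n = F' (f n)\<close> lies in \<open>V\<close>, subtracting \<open>S (y n)\<close>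
    leaves pairs in the finite-dimensional, hence closed, set \<open>U\<close>.\<close>
  have closed_graph: "closed ((\<lambda>u. (u, A u)) ` S ` X)"
  proof -
    let ?s2 = "\<lambda>c (u, v). (s c u, s c v)"
    interpret prod: vector_space ?s2 by (rule vector_space_prod_scale[OF vs])
    interpret ST: Vector_Spaces.linear s ?s2 "\<lambda>w. (S w, T w)"
      by unfold_locales (simp_all add: S.add T.add S.scale T.scale)
    define U where "U = (\<lambda>w. (S w, T w)) ` V"
    have "norm (?s2 c u) = norm c * norm u" for c u
      by (cases u) (simp add: norm_Pair norm_s power_mult_distrib real_sqrt_mult distrib_left[symmetric])
    then have closedU: "closed U"
      unfolding U_def V_def ST.span_image[symmetric]
      using finB1 by (intro closed_span_finite prod.vector_space_axioms) auto
    show ?thesis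
      unfolding closed_sequential_limits
    proof (intro allI impI, elim conjE)
      fix z l assume z: "\<forall>n. z n \<in> (\<lambda>u. (u, A u)) ` S ` X" and l: "z \<longlonglongrightarrow> l"
      obtain f where f: "\<And>n. f n \<in> X" "\<And>n. z n = (S (f n), A (S (f n)))"
        using z unfolding image_iff Bex_def by metis
      define y where "y n = - Q (A (S (f n)))" for n
      define y0 where "y0 = - Q (snd l)"
      have yT: "y n = T (f n)" for n using f(1) by (simp add: y_def AT QP)
      have l1: "(\<lambda>n. S (f n)) \<longlonglongrightarrow> fst l" "(\<lambda>n. A (S (f n))) \<longlonglongrightarrow> snd l"
        using tendsto_fst[OF l] tendsto_snd[OF l] by (simp_all add: f(2))
      have y0: "y \<longlonglongrightarrow> y0"
        unfolding y_def y0_def by (intro tendsto_minus bounded_linear_over_tendsto[OF bQ] l1)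
      have "y n \<in> X" for n using f TX by (simp add: yT)
      then have y0X: "y0 \<in> X" by (rule closed_sequentially[OF X(2) _ y0])
      have "(\<lambda>n. (S (f n) - S (y n), F' (y n))) \<longlonglongrightarrow> (fst l - S y0, F' y0)"
        by (intro tendsto_Pair tendsto_diff l1 bounded_linear_over_tendsto[OF S(1)]
            bounded_linear_over_tendsto[OF bF'] y0)
      moreover have "(S (f n) - S (y n), F' (y n)) \<in> U" for n
      proof -
        have "S (f n) - S (y n) = S (F' (f n))" by (simp add: yT S.diff[symmetric]) (simp add: T_def)
        moreover have "F' (y n) = T (F' (f n))" by (simp add: yT T_def F'.diff)
        ultimately show ?thesis using F'V by (auto simp: U_def)
      qed
      ultimately have "(fst l - S y0, F' y0) \<in> U"
        by (rule closed_sequentially[OF closedU, rotated])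
      then obtain w where w: "w \<in> V" "fst l - S y0 = S w" "F' y0 = T w"
        by (auto simp: U_def)
      have wX: "y0 + w \<in> X" using w VX y0X X(1) by (auto intro: subspace_add)
      have "fst l = S (y0 + w)" using w by (simp add: S.add algebra_simps)
      moreover have "T (y0 + w) = y0" using w(3) by (simp add: T.add) (simp add: T_def)
      then have "A (S (y0 + w)) = snd l"
        using wX by (simp add: AT y0_def PQ)
      ultimately show "l \<in> (\<lambda>u. (u, A u)) ` S ` X"
        using wX by (auto simp: image_iff intro!: bexI[of _ "y0 + w"] prod_eqI)
    qed
  qed
  have graph: "closedin (top_of_set (X \<times> X)) ((\<lambda>u. (u, A u)) ` S ` X)"
    using closed_graph lin S(3)
    by (intro closed_subset) (auto simp: linear_operator_on_def)
  have range: "closedin (top_of_set X) (A ` S ` X)"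
    using closed_TX lin unfolding ran[symmetric]
    by (intro closed_subset) (auto simp: linear_operator_on_def)
  have "fredholm s s X X (S ` X) A"
    unfolding fredholm_def using S(3) lin graph fin_ker range cod(2) ran by simp
  then show ?thesis using index by simp
qed

section \<open>Completeness of the space of square-integrable functions\<close>

lemma square_integrable_rep_l2: "square_integrable (rep_l2 u)"
  using Quotient_rel_rep[OF Quotient_l2, of u u] by (simp add: l2_rel_def)

lemma measurable_rep_l2 [measurable]: "rep_l2 u \<in> borel_measurable borel"
  using square_integrable_rep_l2[of u] by (simp add: square_integrable_def)

lemma integrable_norm_rep_l2: "integrable lborel (\<lambda>x. (norm (rep_l2 u x))\<^sup>2)"
  using square_integrable_rep_l2[of u] by (simp add: square_integrable_def)

lemma rep_abs_l2:
  assumes "square_integrable f"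
  shows "AE x in lborel. rep_l2 (abs_l2 f) x = f x"
  using Quotient_rep_abs[OF Quotient_l2, of f] assms by (simp add: l2_rel_def)

lemma abs_rep_l2: "abs_l2 (rep_l2 u) = u"
  by (rule Quotient_abs_rep[OF Quotient_l2])

lemma abs_l2_eqI:
  assumes "square_integrable f" "square_integrable g" "AE x in lborel. f x = g x"
  shows "abs_l2 f = abs_l2 g"
  using Quotient_rel_abs[OF Quotient_l2, of f g] assms by (simp add: l2_rel_def)

lemma l2_eqI:
  assumes "AE x in lborel. rep_l2 u x = rep_l2 v x"
  shows "u = v"
  using abs_l2_eqI[OF _ _ assms] by (simp add: square_integrable_rep_l2 abs_rep_l2)

lemma rep_l2_zero: "AE x in lborel. rep_l2 0 x = 0"
  unfolding zero_l2_def by (rule rep_abs_l2[OF square_integrable_zero])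

lemma rep_l2_add: "AE x in lborel. rep_l2 (u + v) x = rep_l2 u x + rep_l2 v x"
  unfolding plus_l2_def map_fun_def o_def id_def
  by (intro rep_abs_l2 square_integrable_add square_integrable_rep_l2)

lemma rep_l2_scaleR: "AE x in lborel. rep_l2 (c *\<^sub>R u) x = c *\<^sub>R rep_l2 u x"
  unfolding scaleR_l2_def map_fun_def o_def id_def
  by (intro rep_abs_l2 square_integrable_scaleR square_integrable_rep_l2)

lemma rep_l2_uminus: "AE x in lborel. rep_l2 (- u) x = - rep_l2 u x"
  using rep_l2_scaleR[of "-1" u] by simp

lemma rep_l2_diff: "AE x in lborel. rep_l2 (u - v) x = rep_l2 u x - rep_l2 v x"
  using rep_l2_add[of u "- v"] rep_l2_uminus[of v] by eventually_elim simp

lemma rep_l2_scale: "AE x in lborel. rep_l2 (scale_l2 c u) x = c * rep_l2 u x"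
  unfolding scale_l2_def map_fun_def o_def id_def
  by (intro rep_abs_l2 square_integrable_mult square_integrable_rep_l2)

lemma rep_l2_shift: "AE x in lborel. rep_l2 (shift_l2 h u) x = rep_l2 u (x + h)"
  unfolding shift_l2_def map_fun_def o_def id_def
  by (intro rep_abs_l2 square_integrable_shift square_integrable_rep_l2)

lemma rep_l2_restrict:
  "AE x in lborel. rep_l2 (restrict_l2 a b u) x = indicator {a<..<b} x *\<^sub>R rep_l2 u x"
  unfolding restrict_l2_def map_fun_def o_def id_def
  by (intro rep_abs_l2 square_integrable_cut square_integrable_rep_l2)

lemma rep_l2_sum:
  assumes "finite I"
  shows "AE x in lborel. rep_l2 (\<Sum>i\<in>I. u i) x = (\<Sum>i\<in>I. rep_l2 (u i) x)"
  using assms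
proof (induction I)
  case empty
  show ?case using rep_l2_zero by simp
next
  case (insert i I)
  show ?case
    using rep_l2_add[of "u i" "\<Sum>i\<in>I. u i"] insert.IH
    by eventually_elim (use insert in simp)
qed

lemma norm_l2_sq: "(norm u)\<^sup>2 = (LINT x|lborel. (norm (rep_l2 u x))\<^sup>2)"
proof -
  have "(norm u)\<^sup>2 = inner u u" by (simp add: power2_norm_eq_inner)
  then show ?thesis by (simp add: inner_l2.rep_eq power2_norm_eq_inner)
qed

lemma nn_integral_rep_l2: "(\<integral>\<^sup>+x. ennreal ((norm (rep_l2 u x))\<^sup>2) \<partial>lborel) = ennreal ((norm u)\<^sup>2)"
  unfolding norm_l2_sq by (intro nn_integral_eq_integral integrable_norm_rep_l2) auto

lemma norm_l2_le_if_pointwise: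
  assumes "AE x in lborel. norm (rep_l2 u x) \<le> c * norm (rep_l2 v x)" "c \<ge> 0"
  shows "norm u \<le> c * norm v"
proof (rule power2_le_imp_le)
  have "(norm u)\<^sup>2 \<le> (LINT x|lborel. c\<^sup>2 * (norm (rep_l2 v x))\<^sup>2)"
    unfolding norm_l2_sq
  proof (rule integral_mono_AE)
    show "AE x in lborel. (norm (rep_l2 u x))\<^sup>2 \<le> c\<^sup>2 * (norm (rep_l2 v x))\<^sup>2"
      using assms(1) by eventually_elim (simp add: power_mult_distrib[symmetric] power_mono)
  qed (auto intro: integrable_norm_rep_l2)
  also have "\<dots> = (c * norm v)\<^sup>2" by (simp add: norm_l2_sq power_mult_distrib)
  finally show "(norm u)\<^sup>2 \<le> (c * norm v)\<^sup>2" .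
qed (use assms in simp)

lemma norm_scale_l2: "norm (scale_l2 c u) = norm c * norm u"
proof -
  have "(norm (scale_l2 c u))\<^sup>2 = (LINT x|lborel. (norm (c * rep_l2 u x))\<^sup>2)"
    unfolding norm_l2_sq
    by (rule integral_cong_AE) (use rep_l2_scale[of c u] in auto)
  also have "\<dots> = (norm c * norm u)\<^sup>2"
    by (simp add: norm_l2_sq power_mult_distrib norm_mult)
  finally show ?thesis by (simp add: power2_eq_iff_nonneg)
qed

section \<open>Convergence of Cauchy sequences\<close>

lemma rapidly_Cauchy_subseq:
  fixes X :: "nat \<Rightarrow> 'a::metric_space"
  assumes "Cauchy X"
  obtains r :: "nat \<Rightarrow> nat" where "strict_mono r"
    "\<And>n. dist (X (r (Suc n))) (X (r n)) \<le> (1 / 2) ^ n"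
proof -
  have "\<exists>M. \<forall>m\<ge>M. \<forall>n\<ge>M. dist (X m) (X n) < (1 / 2) ^ k" for k :: nat
    using assms unfolding Cauchy_def by simp
  then obtain M where M: "\<And>k m n. m \<ge> M k \<Longrightarrow> n \<ge> M k \<Longrightarrow> dist (X m) (X n) < (1 / 2) ^ k"
    by metis
  \<comment> \<open>Adding up the thresholds keeps \<open>r n\<close> above \<open>M n\<close>; the
    summand \<open>n\<close> makes the sequence strictly increasing.\<close>
  define r where "r n = n + (\<Sum>i\<le>n. M i)" for n
  have mono: "strict_mono r" by (simp add: r_def strict_mono_Suc_iff)
  have "M n \<le> r n" for n
    unfolding r_def by (rule trans_le_add2) (simp add: member_le_sum)
  moreover have "r n \<le> r (Suc n)" for n by (simp add: r_def)
  ultimately have "dist (X (r (Suc n))) (X (r n)) \<le> (1 / 2) ^ n" for n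
    by (meson M le_trans less_imp_le)
  with mono show thesis by (rule that)
qed

text \<open>
  The weights \<open>2\<^sup>n\<close> make the integrals of \<open>2\<^sup>n |f\<^sub>n\<^sub>+\<^sub>1 - f\<^sub>n|\<^sup>2\<close> summable along a rapidly convergent
  subsequence, which forces pointwise geometric decay of \<open>|f\<^sub>n\<^sub>+\<^sub>1 - f\<^sub>n|\<close> almost everywhere.
\<close>

lemma l2_AE_convergent:
  fixes Y :: "nat \<Rightarrow> 'a::euclidean_space l2"
  assumes Y: "\<And>n. dist (Y (Suc n)) (Y n) \<le> (1 / 2) ^ n"
  shows "AE x in lborel. convergent (\<lambda>n. rep_l2 (Y n) x)"
proof -
  define d where "d n = Y (Suc n) - Y n" for n
  define g where "g n x = 2 ^ n * (norm (rep_l2 (d n) x))\<^sup>2" for n x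
  have [measurable]: "g n \<in> borel_measurable borel" for n unfolding g_def by measurable
  have "(\<integral>\<^sup>+x. ennreal (g n x) \<partial>lborel) \<le> ennreal ((1 / 2) ^ n)" for n
  proof -
    have "(\<integral>\<^sup>+x. ennreal (g n x) \<partial>lborel) = ennreal (2 ^ n * (norm (d n))\<^sup>2)"
      unfolding g_def by (simp add: ennreal_mult nn_integral_cmult nn_integral_rep_l2)
    also have "(norm (d n))\<^sup>2 \<le> ((1 / 2) ^ n)\<^sup>2"
      using Y[of n] by (intro power_mono) (auto simp: d_def dist_norm)
    then have "2 ^ n * (norm (d n))\<^sup>2 \<le> 2 ^ n * ((1 / 2) ^ n)\<^sup>2" by simp
    also have "\<dots> = (1 / 2) ^ n" by (simp add: power_divide power2_eq_square)
    finally show ?thesis by (simp add: ennreal_leI)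
  qed
  then have "(\<Sum>n. \<integral>\<^sup>+x. ennreal (g n x) \<partial>lborel) \<le> (\<Sum>n. ennreal ((1 / 2) ^ n))"
    by (intro suminf_le) auto
  also have "\<dots> = ennreal (\<Sum>n. (1 / 2) ^ n)"
    by (intro suminf_ennreal2) auto
  also have "\<dots> < \<infinity>" by simp
  finally have "(\<integral>\<^sup>+x. (\<Sum>n. ennreal (g n x)) \<partial>lborel) \<noteq> \<infinity>"
    by (subst nn_integral_suminf) auto
  then have "AE x in lborel. (\<Sum>n. ennreal (g n x)) \<noteq> \<infinity>"
    by (intro nn_integral_PInf_AE) auto
  moreover have "AE x in lborel. \<forall>n. rep_l2 (d n) x = rep_l2 (Y (Suc n)) x - rep_l2 (Y n) x"
    unfolding AE_all_countable d_def by (auto intro: rep_l2_diff)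
  ultimately show ?thesis
  proof eventually_elim
    case (elim x)
    have "summable (\<lambda>n. g n x)"
      using elim(1) by (intro summable_suminf_not_top) (auto simp: g_def)
    then have "Bseq (\<lambda>n. g n x)"
      using summable_LIMSEQ_zero convergentI convergent_imp_Bseq by blast
    then obtain K where K: "K > 0" "\<And>n. norm (g n x) \<le> K" unfolding Bseq_def by blast
    have "norm (rep_l2 (d n) x) \<le> sqrt K * sqrt (1 / 2) ^ n" for n
    proof -
      have "(norm (rep_l2 (d n) x))\<^sup>2 \<le> K * (1 / 2) ^ n"
        proof -
          have "2 ^ n * (norm (rep_l2 (d n) x))\<^sup>2 \<le> K" using K(2)[of n] by (simp add: g_def)
          then show ?thesis by (simp add: power_one_over divide_simps mult.commute)
        qed
      then have "norm (rep_l2 (d n) x) \<le> sqrt (K * (1 / 2) ^ n)"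
        by (rule real_le_rsqrt)
      then show ?thesis by (simp only: real_sqrt_mult real_sqrt_power)
    qed
    moreover have "summable (\<lambda>n. sqrt K * sqrt (1 / 2) ^ n)"
      by (intro summable_mult summable_geometric) (simp add: real_sqrt_divide)
    ultimately have "summable (\<lambda>n. rep_l2 (d n) x)"
      using summable_comparison_test'[of "\<lambda>n. sqrt K * sqrt (1 / 2) ^ n" 0 "\<lambda>n. rep_l2 (d n) x"]
      by blast
    then have "convergent (\<lambda>n. \<Sum>k<n. rep_l2 (d k) x)" by (simp add: summable_iff_convergent)
    then have "convergent (\<lambda>n. rep_l2 (Y 0) x + (\<Sum>k<n. rep_l2 (d k) x))"
      by (intro convergent_add convergent_const)
    moreover have "rep_l2 (Y 0) x + (\<Sum>k<n. rep_l2 (d k) x) = rep_l2 (Y n) x" for n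
      using elim(2) sum_lessThan_telescope[of "\<lambda>k. rep_l2 (Y k) x" n] by simp
    ultimately show ?case by simp
  qed
qed

text \<open>The pointwise limit of a rapidly convergent subsequence is the candidate. Fatou's lemma
  passes the Cauchy estimate on to it, which yields both its square integrability and the
  convergence in norm.\<close>

instance l2 :: (euclidean_space) banach
proof
  fix X :: "nat \<Rightarrow> 'a l2"
  assume X: "Cauchy X"
  obtain r where r: "strict_mono r" "\<And>n. dist (X (r (Suc n))) (X (r n)) \<le> (1 / 2) ^ n"
    using rapidly_Cauchy_subseq[OF X] by blast
  define Y where "Y n = X (r n)" for n
  \<comment> \<open>Where the sequence diverges \<open>lim\<close> has an unspecified value; this
    concerns a null set, and \<open>f\<close> is measurable all the same.\<close>
  define f where "f x = lim (\<lambda>n. rep_l2 (Y n) x)" for x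
  have [measurable]: "f \<in> borel_measurable borel" unfolding f_def by measurable
  have AE: "AE x in lborel. (\<lambda>n. rep_l2 (Y n) x) \<longlonglongrightarrow> f x"
    using l2_AE_convergent[of Y] r(2) unfolding f_def Y_def
    by (auto simp: convergent_LIMSEQ_iff)
  have CY: "Cauchy Y"
    unfolding Y_def using Cauchy_subseq_Cauchy[OF X r(1)] by (simp add: o_def)
  have est: "(\<integral>\<^sup>+x. ennreal ((norm (f x - rep_l2 (Y n) x))\<^sup>2) \<partial>lborel) \<le> ennreal (e\<^sup>2)"
    if e: "\<And>m. m \<ge> M \<Longrightarrow> dist (Y m) (Y n) \<le> e" for n M e
  proof -
    have "(\<integral>\<^sup>+x. ennreal ((norm (f x - rep_l2 (Y n) x))\<^sup>2) \<partial>lborel)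
        = (\<integral>\<^sup>+x. liminf (\<lambda>m. ennreal ((norm (rep_l2 (Y m) x - rep_l2 (Y n) x))\<^sup>2)) \<partial>lborel)"
    proof (rule nn_integral_cong_AE)
      show "AE x in lborel. ennreal ((norm (f x - rep_l2 (Y n) x))\<^sup>2)
          = liminf (\<lambda>m. ennreal ((norm (rep_l2 (Y m) x - rep_l2 (Y n) x))\<^sup>2))"
        using AE
      proof eventually_elim
        case (elim x)
        then have "(\<lambda>m. ennreal ((norm (rep_l2 (Y m) x - rep_l2 (Y n) x))\<^sup>2))
            \<longlonglongrightarrow> ennreal ((norm (f x - rep_l2 (Y n) x))\<^sup>2)"
          by (intro tendsto_intros)
        then show ?case by (intro lim_imp_Liminf[symmetric]) auto
      qed
    qed
    also have "\<dots> \<le> liminf (\<lambda>m. \<integral>\<^sup>+x. ennreal ((norm (rep_l2 (Y m) x - rep_l2 (Y n) x))\<^sup>2) \<partial>lborel)"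
      by (rule nn_integral_liminf) measurable
    also have "\<dots> \<le> liminf (\<lambda>m. ennreal (e\<^sup>2))"
    proof (rule Liminf_mono, rule eventually_sequentiallyI)
      fix m assume "m \<ge> M"
      have "(\<integral>\<^sup>+x. ennreal ((norm (rep_l2 (Y m) x - rep_l2 (Y n) x))\<^sup>2) \<partial>lborel)
          = (\<integral>\<^sup>+x. ennreal ((norm (rep_l2 (Y m - Y n) x))\<^sup>2) \<partial>lborel)"
        using rep_l2_diff[of "Y m" "Y n"] by (intro nn_integral_cong_AE) auto
      also have "\<dots> = ennreal ((norm (Y m - Y n))\<^sup>2)" by (rule nn_integral_rep_l2)
      also have "\<dots> \<le> ennreal (e\<^sup>2)"
        using e[OF \<open>m \<ge> M\<close>] by (intro ennreal_leI power_mono) (auto simp: dist_norm)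
      finally show "(\<integral>\<^sup>+x. ennreal ((norm (rep_l2 (Y m) x - rep_l2 (Y n) x))\<^sup>2) \<partial>lborel) \<le> ennreal (e\<^sup>2)" .
    qed
    finally show ?thesis by (simp add: Liminf_const)
  qed
  have sq_diff: "square_integrable (\<lambda>x. f x - rep_l2 (Y n) x)"
    if e: "\<And>m. m \<ge> M \<Longrightarrow> dist (Y m) (Y n) \<le> e" for n M e
    using est[OF e, of M] unfolding square_integrable_def
    by (auto intro!: integrableI_nonneg) (meson ennreal_less_top le_less_trans)
  have sq: "square_integrable f"
  proof -
    obtain M where M: "\<And>m n. m \<ge> M \<Longrightarrow> n \<ge> M \<Longrightarrow> dist (Y m) (Y n) < 1"
      using metric_CauchyD[OF CY, of 1] by auto
    have "square_integrable (\<lambda>x. f x - rep_l2 (Y M) x)"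
      by (rule sq_diff[of M, OF less_imp_le[OF M]]) auto
    from square_integrable_add[OF this square_integrable_rep_l2[of "Y M"]]
    show ?thesis by simp
  qed
  have "Y \<longlonglongrightarrow> abs_l2 f"
  proof (rule metric_LIMSEQ_I)
    fix e :: real assume "e > 0"
    then obtain M where M: "\<And>m n. m \<ge> M \<Longrightarrow> n \<ge> M \<Longrightarrow> dist (Y m) (Y n) < e / 2"
      using metric_CauchyD[OF CY, of "e / 2"] by auto
    have "dist (Y n) (abs_l2 f) < e" if "n \<ge> M" for n
    proof -
      have "ennreal ((norm (abs_l2 f - Y n))\<^sup>2)
          = (\<integral>\<^sup>+x. ennreal ((norm (rep_l2 (abs_l2 f - Y n) x))\<^sup>2) \<partial>lborel)"
        by (rule nn_integral_rep_l2[symmetric])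
      also have "\<dots> = (\<integral>\<^sup>+x. ennreal ((norm (f x - rep_l2 (Y n) x))\<^sup>2) \<partial>lborel)"
      proof (rule nn_integral_cong_AE)
        show "AE x in lborel. ennreal ((norm (rep_l2 (abs_l2 f - Y n) x))\<^sup>2)
            = ennreal ((norm (f x - rep_l2 (Y n) x))\<^sup>2)"
          using rep_l2_diff[of "abs_l2 f" "Y n"] rep_abs_l2[OF sq] by eventually_elim simp
      qed
      also have "\<dots> \<le> ennreal ((e / 2)\<^sup>2)"
        by (rule est[of M, OF less_imp_le[OF M[OF _ that]]])
      finally have "(norm (abs_l2 f - Y n))\<^sup>2 \<le> (e / 2)\<^sup>2" by (simp add: ennreal_le_iff)
      then have "norm (abs_l2 f - Y n) \<le> e / 2" by (rule power2_le_imp_le) (use \<open>e > 0\<close> in simp)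
      then show ?thesis using \<open>e > 0\<close> by (simp add: dist_norm norm_minus_commute)
    qed
    then show "\<exists>M. \<forall>n\<ge>M. dist (Y n) (abs_l2 f) < e" by blast
  qed
  then have "X \<longlonglongrightarrow> abs_l2 f"
    using Cauchy_converges_subseq[OF X r(1)] unfolding Y_def by (simp add: o_def)
  then show "convergent X" by (rule convergentI)
qed

section \<open>Test functions\<close>

text \<open>Some derivative function is asked for in place of the iterated \<open>deriv\<close>, so
  that closure under sums, products and affine substitutions follows by induction on the
  order.\<close>

primrec times_differentiable :: "nat \<Rightarrow> (real \<Rightarrow> real) \<Rightarrow> bool" where
  "times_differentiable 0 f \<longleftrightarrow> True"
| "times_differentiable (Suc n) f \<longleftrightarrow>
     (\<exists>f'. (\<forall>x. (f has_field_derivative f' x) (at x)) \<and> times_differentiable n f')"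

lemma times_differentiable_SucD: "times_differentiable (Suc n) f \<Longrightarrow> times_differentiable n f"
  by (induction n arbitrary: f) auto

lemma times_differentiable_const: "times_differentiable n (\<lambda>x. c)"
proof (induction n arbitrary: c)
  case (Suc n)
  then show ?case by (auto intro!: exI[of _ "\<lambda>x. 0"])
qed simp

lemma times_differentiable_add:
  "times_differentiable n f \<Longrightarrow> times_differentiable n g \<Longrightarrow> times_differentiable n (\<lambda>x. f x + g x)"
proof (induction n arbitrary: f g)
  case (Suc n)
  then obtain f' g' where "\<forall>x. (f has_field_derivative f' x) (at x)" "times_differentiable n f'"
    "\<forall>x. (g has_field_derivative g' x) (at x)" "times_differentiable n g'" by auto
  with Suc.IH show ?case
    by (auto intro!: exI[of _ "\<lambda>x. f' x + g' x"] derivative_eq_intros)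
qed simp

lemma times_differentiable_mult:
  "times_differentiable n f \<Longrightarrow> times_differentiable n g \<Longrightarrow> times_differentiable n (\<lambda>x. f x * g x)"
proof (induction n arbitrary: f g)
  case (Suc n)
  then obtain f' g' where "\<forall>x. (f has_field_derivative f' x) (at x)" "times_differentiable n f'"
    "\<forall>x. (g has_field_derivative g' x) (at x)" "times_differentiable n g'" by auto
  moreover have "times_differentiable n f" "times_differentiable n g"
    using Suc.prems by (auto intro: times_differentiable_SucD simp del: times_differentiable.simps)
  ultimately show ?case
    by (auto intro!: exI[of _ "\<lambda>x. f' x * g x + f x * g' x"] derivative_eq_intros
        times_differentiable_add Suc.IH)
qed simp

lemma times_differentiable_affine:
  "times_differentiable n f \<Longrightarrow> times_differentiable n (\<lambda>x. f (c * x + d))"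
proof (induction n arbitrary: f)
  case (Suc n)
  then obtain f' where f': "\<forall>x. (f has_field_derivative f' x) (at x)" "times_differentiable n f'" by auto
  have "((\<lambda>x. f (c * x + d)) has_field_derivative f' (c * x + d) * c) (at x)" for x
    by (rule DERIV_chain2[of f]) (use f'(1) in \<open>auto intro!: derivative_eq_intros\<close>)
  moreover have "times_differentiable n (\<lambda>x. f' (c * x + d) * c)"
    using f'(2) by (intro times_differentiable_mult times_differentiable_const Suc.IH)
  ultimately show ?case unfolding times_differentiable.simps
    by (intro exI[of _ "\<lambda>x. f' (c * x + d) * c"]) blast
qed simp

lemma times_differentiable_deriv:
  assumes "\<And>x. (f has_field_derivative f' x) (at x)"
  shows "times_differentiable (Suc n) f \<longleftrightarrow> times_differentiable n f'"
proof -
  have "g = f'" if "\<forall>x. (f has_field_derivative g x) (at x)" for g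
    using assms that DERIV_unique by blast
  then show ?thesis using assms by auto
qed

lemma smooth_iff_times_differentiable:
  "(\<forall>k x. (deriv ^^ k) f differentiable (at x)) \<longleftrightarrow> (\<forall>n. times_differentiable n f)"
proof
  have *: "times_differentiable n f" if "\<forall>k x. (deriv ^^ k) f differentiable (at x)" for n f
    using that
  proof (induction n arbitrary: f)
    case (Suc n)
    have "f differentiable (at x)" for x using Suc.prems[rule_format, of 0 x] by simp
    then have d: "(f has_field_derivative deriv f x) (at x)" for x
      by (simp add: DERIV_deriv_iff_real_differentiable)
    have "times_differentiable n (deriv f)"
    proof (rule Suc.IH, intro allI)
      fix k x show "(deriv ^^ k) (deriv f) differentiable (at x)"
        using Suc.prems[rule_format, of "Suc k" x] by (simp add: funpow_Suc_right del: funpow.simps)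
    qed
    then show ?case using d by auto
  qed simp
  show "\<forall>k x. (deriv ^^ k) f differentiable (at x) \<Longrightarrow> \<forall>n. times_differentiable n f"
    using * by blast
  assume td: "\<forall>n. times_differentiable n f"
  have "\<forall>n. times_differentiable n ((deriv ^^ k) f)" for k
  proof (induction k)
    case (Suc k)
    obtain g where g: "\<forall>x. ((deriv ^^ k) f has_field_derivative g x) (at x)"
      using Suc[rule_format, of 1] by auto
    then have "deriv ((deriv ^^ k) f) = g" by (auto intro: DERIV_imp_deriv)
    then show ?case using times_differentiable_deriv[of "(deriv ^^ k) f" g] g Suc by auto
  qed (use td in simp)
  then have "times_differentiable (Suc 0) ((deriv ^^ k) f)" for k by blast
  then show "\<forall>k x. (deriv ^^ k) f differentiable (at x)"
    by (fastforce simp: real_differentiable_def)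
qed

lemma test_function_iff:
  "test_function a b \<phi> \<longleftrightarrow> (\<forall>n. times_differentiable n \<phi>) \<and>
     (\<exists>c d. a < c \<and> c \<le> d \<and> d < b \<and> (\<forall>x. x \<notin> {c..d} \<longrightarrow> \<phi> x = 0))"
  unfolding test_function_def smooth_iff_times_differentiable ..

lemma test_function_has_deriv:
  assumes "test_function a b \<phi>"
  shows "(\<phi> has_field_derivative deriv \<phi> x) (at x)"
  using assms[unfolded test_function_def]
  by (metis DERIV_deriv_iff_real_differentiable funpow_0)

lemma test_function_deriv:
  assumes "test_function a b \<phi>"
  shows "test_function a b (deriv \<phi>)"
  unfolding test_function_iff
proof
  note d = test_function_has_deriv[OF assms]
  show "\<forall>n. times_differentiable n (deriv \<phi>)"
    using assms times_differentiable_deriv[of \<phi> "deriv \<phi>"] d by (auto simp: test_function_iff)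
  obtain c d where cd: "a < c" "c \<le> d" "d < b" "\<And>x. x \<notin> {c..d} \<Longrightarrow> \<phi> x = 0"
    using assms unfolding test_function_def by auto
  have "deriv \<phi> x = 0" if x: "x \<notin> {c..d}" for x
  proof -
    have "\<forall>\<^sub>F y in nhds x. y \<in> - {c..d}"
      using x by (intro eventually_nhds_in_open) auto
    then have "\<forall>\<^sub>F y in nhds x. \<phi> y = 0" by eventually_elim (use cd(4) in auto)
    then have "deriv \<phi> x = deriv (\<lambda>x. 0) x" by (rule deriv_cong_ev) simp
    then show ?thesis by simp
  qed
  then show "\<exists>c d. a < c \<and> c \<le> d \<and> d < b \<and> (\<forall>x. x \<notin> {c..d} \<longrightarrow> deriv \<phi> x = 0)"
    using cd by blast
qed

lemma test_function_continuous_on: "test_function a b \<phi> \<Longrightarrow> continuous_on S \<phi>"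
  using test_function_has_deriv by (intro continuous_at_imp_continuous_on ballI) (meson DERIV_isCont)

lemma test_function_measurable: "test_function a b \<phi> \<Longrightarrow> \<phi> \<in> borel_measurable borel"
  by (intro borel_measurable_continuous_onI test_function_continuous_on)

lemma test_function_bounded:
  assumes "test_function a b \<phi>"
  obtains K where "\<And>x. \<bar>\<phi> x\<bar> \<le> K"
proof -
  obtain c d where cd: "\<And>x. x \<notin> {c..d} \<Longrightarrow> \<phi> x = 0"
    using assms unfolding test_function_def by auto
  have "compact (\<phi> ` {c..d})"
    by (intro compact_continuous_image test_function_continuous_on[OF assms]) auto
  then obtain K where K: "\<And>x. x \<in> {c..d} \<Longrightarrow> \<bar>\<phi> x\<bar> \<le> K"
    using compact_imp_bounded bounded_iff by (metis imageI real_norm_def)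
  have "\<bar>\<phi> x\<bar> \<le> max K 0" for x
    using K[of x] cd[of x] by (cases "x \<in> {c..d}") auto
  then show thesis by (rule that)
qed

section \<open>Smooth cut-off functions\<close>

text \<open>The polynomial factor in \<open>1 / x\<close> makes this class of flat functions closed
  under differentiation, so a single derivative formula gives smoothness of all orders.\<close>

definition flat_exp :: "real poly \<Rightarrow> real \<Rightarrow> real" where
  "flat_exp p x = (if x > 0 then poly p (1 / x) * exp (- (1 / x)) else 0)"

lemma tendsto_poly_times_exp_minus: "((\<lambda>y. poly p y * exp (- y)) \<longlongrightarrow> (0::real)) at_top"
proof -
  have "((\<lambda>y. \<Sum>i\<le>degree p. coeff p i * (y ^ i / exp y)) \<longlongrightarrow> (\<Sum>i\<le>degree p. coeff p i * 0)) at_top"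
    by (intro tendsto_sum tendsto_mult tendsto_const tendsto_power_div_exp_0)
  then show ?thesis
    by (simp add: poly_altdef sum_distrib_right exp_minus divide_inverse mult.assoc)
qed

text \<open>With \<open>y = 1 / x\<close> one has \<open>dy/dx = - y^2\<close>, so
  \<open>p(y) exp(-y)\<close> has derivative \<open>y^2 (p - p')(y) exp(-y)\<close>. At zero the
  right difference quotient is \<open>y p(y) exp(-y)\<close>, which tends to zero.\<close>

lemma flat_exp_has_deriv:
  "(flat_exp p has_field_derivative flat_exp ([:0, 0, 1:] * (p - pderiv p)) x) (at x)"
proof -
  consider "x < 0" | "x > 0" | "x = 0" by linarith
  then show ?thesis
  proof cases
    case 1
    have "((\<lambda>x. 0) has_field_derivative 0) (at x)" by simp
    moreover have "\<forall>\<^sub>F y in nhds x. y \<in> {..<0}" using 1 by (intro eventually_nhds_in_open) auto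
    then have "\<forall>\<^sub>F y in nhds x. flat_exp p y = 0" by eventually_elim (simp add: flat_exp_def)
    ultimately show ?thesis
      using 1 DERIV_cong_ev[of x x "flat_exp p" "\<lambda>x. 0" _ _] by (simp add: flat_exp_def)
  next
    case 2
    have "((\<lambda>x. poly p (1 / x) * exp (- (1 / x))) has_field_derivative
        flat_exp ([:0, 0, 1:] * (p - pderiv p)) x) (at x)"
      using 2 by (auto intro!: derivative_eq_intros DERIV_chain2[OF poly_DERIV]
          simp: flat_exp_def field_simps power2_eq_square)
    moreover have "\<forall>\<^sub>F y in nhds x. y \<in> {0<..}" using 2 by (intro eventually_nhds_in_open) auto
    then have "\<forall>\<^sub>F y in nhds x. flat_exp p y = poly p (1 / y) * exp (- (1 / y))"
      by eventually_elim (simp add: flat_exp_def)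
    ultimately show ?thesis
      using DERIV_cong_ev[of x x "flat_exp p" "\<lambda>x. poly p (1 / x) * exp (- (1 / x))"] by simp
  next
    case 3
    have "((\<lambda>h. flat_exp p h / h) \<longlongrightarrow> 0) (at_left 0)"
    proof (rule tendsto_eventually)
      show "\<forall>\<^sub>F h in at_left 0. flat_exp p h / h = 0"
        by (auto simp: eventually_at_filter flat_exp_def)
    qed
    moreover have "((\<lambda>h. flat_exp p h / h) \<longlongrightarrow> 0) (at_right 0)"
      unfolding filterlim_at_right_to_top
    proof (rule Lim_transform_eventually)
      show "((\<lambda>y. poly (pCons 0 p) y * exp (- y)) \<longlongrightarrow> 0) at_top"
        by (rule tendsto_poly_times_exp_minus)
      show "\<forall>\<^sub>F y in at_top. poly (pCons 0 p) y * exp (- y) = flat_exp p (inverse y) / inverse y"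
        using eventually_gt_at_top[of 0]
        by eventually_elim (simp add: flat_exp_def field_simps)
    qed
    ultimately have "((\<lambda>h. flat_exp p h / h) \<longlongrightarrow> 0) (at 0)"
      by (simp add: filterlim_split_at)
    then show ?thesis
      using 3 by (simp add: DERIV_def) (simp add: flat_exp_def)
  qed
qed

lemma times_differentiable_flat_exp: "times_differentiable n (flat_exp p)"
  by (induction n arbitrary: p) (use flat_exp_has_deriv in auto)

text \<open>Two flanks, one rising from each end. The factor \<open>n + 2\<close> steepens them. The
  offset \<open>(d - c) / 2\<close> pulls the support in by \<open>(d - c) / (2 (n + 2))\<close> at
  each end, which is at most a quarter of the length, so that it stays in a compact subinterval of
  the open interval.\<close>

definition cutoff :: "real \<Rightarrow> real \<Rightarrow> nat \<Rightarrow> real \<Rightarrow> real" where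
  "cutoff c d n x =
     flat_exp 1 (real (n + 2) * (x - c) - (d - c) / 2) * flat_exp 1 (real (n + 2) * (d - x) - (d - c) / 2)"

lemma test_function_cutoff:
  assumes "a \<le> c" "c < d" "d \<le> b"
  shows "test_function a b (cutoff c d n)"
  unfolding test_function_iff
proof (intro conjI allI)
  fix k
  have "times_differentiable k (\<lambda>x. flat_exp 1 (real (n + 2) * x + (- real (n + 2) * c - (d - c) / 2)) *
      flat_exp 1 (- real (n + 2) * x + (real (n + 2) * d - (d - c) / 2)))"
    by (intro times_differentiable_mult times_differentiable_affine times_differentiable_flat_exp)
  moreover have "cutoff c d n = (\<lambda>x. flat_exp 1 (real (n + 2) * x + (- real (n + 2) * c - (d - c) / 2)) *
      flat_exp 1 (- real (n + 2) * x + (real (n + 2) * d - (d - c) / 2)))"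
    by (auto simp: cutoff_def fun_eq_iff algebra_simps)
  ultimately show "times_differentiable k (cutoff c d n)" by simp
next
  define e where "e = (d - c) / 2 / real (n + 2)"
  have e0: "e > 0" using assms by (simp add: e_def)
  have e: "e \<le> (d - c) / 2 / 2"
    unfolding e_def by (rule divide_left_mono) (use assms in auto)
  have "real (n + 2) * e = (d - c) / 2"
    unfolding e_def by (subst times_divide_eq_right, subst nonzero_mult_div_cancel_left) auto
  then have "cutoff c d n x = 0" if "x \<notin> {c + e..d - e}" for x
  proof -
    assume E: "real (n + 2) * e = (d - c) / 2"
    have "x - c < e \<or> d - x < e" using that by auto
    then have "real (n + 2) * (x - c) < real (n + 2) * e \<or> real (n + 2) * (d - x) < real (n + 2) * e"
      by auto
    then show ?thesis unfolding E by (auto simp: cutoff_def flat_exp_def)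
  qed
  moreover have "a < c + e" "c + e \<le> d - e" "d - e < b" using e0 e assms by auto
  ultimately show "\<exists>c' d'. a < c' \<and> c' \<le> d' \<and> d' < b \<and> (\<forall>x. x \<notin> {c'..d'} \<longrightarrow> cutoff c d n x = 0)"
    by blast
qed

lemma cutoff_bounds: "0 \<le> cutoff c d n x" "cutoff c d n x \<le> 1"
proof -
  have "0 \<le> flat_exp 1 x \<and> flat_exp 1 x \<le> 1" for x by (auto simp: flat_exp_def)
  then show "0 \<le> cutoff c d n x" "cutoff c d n x \<le> 1"
    unfolding cutoff_def by (auto intro: mult_le_one)
qed

lemma cutoff_tendsto:
  assumes "c < d"
  shows "(\<lambda>n. cutoff c d n x) \<longlonglongrightarrow> indicator {c<..<d} x"
proof (cases "x \<in> {c<..<d}")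
  case True
  have *: "(\<lambda>n. flat_exp 1 (real (n + 2) * y - e)) \<longlonglongrightarrow> 1" if "y > 0" for y e :: real
  proof -
    have lim: "filterlim (\<lambda>n. real (n + 2) * y - e) at_top sequentially"
      using that by real_asymp
    then have "(\<lambda>n. exp (- (1 / (real (n + 2) * y - e)))) \<longlonglongrightarrow> exp (- 0)"
      by (intro tendsto_exp tendsto_minus tendsto_divide_0[OF tendsto_const] filterlim_at_top_imp_at_infinity)
    moreover have "\<forall>\<^sub>F n in sequentially. exp (- (1 / (real (n + 2) * y - e))) = flat_exp 1 (real (n + 2) * y - e)"
      using filterlim_at_top_dense[THEN iffD1, OF lim, rule_format, of 0]
      by eventually_elim (simp add: flat_exp_def)
    ultimately show ?thesis by (simp add: Lim_transform_eventually)
  qed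
  have "(\<lambda>n. cutoff c d n x) \<longlonglongrightarrow> 1 * 1"
    unfolding cutoff_def using True by (intro tendsto_mult *) auto
  then show ?thesis using True by simp
next
  case False
  have neg: "real (n + 2) * y \<le> 0" if "y \<le> 0" for y n using that by (simp add: mult_nonneg_nonpos)
  have "x - c \<le> 0 \<or> d - x \<le> 0" using False by auto
  then have "cutoff c d n x = 0" for n
    using neg[of "x - c" n] neg[of "d - x" n] assms by (auto simp: cutoff_def flat_exp_def)
  then show ?thesis using False by simp
qed

text \<open>The fundamental lemma of the calculus of variations. Dominated convergence replaces
  cut-offs by indicators of open intervals; these are stable under intersection and generate the
  Borel sets, so \<open>f\<close>, cut to \<open>{a<..<b}\<close>, integrates to zero over every
  Borel set.\<close>

lemma AE_zero_if_test_integrals_zero: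
  fixes f :: "real \<Rightarrow> 'a::euclidean_space"
  assumes f: "set_integrable lborel {a<..<b} f"
    and test: "\<And>\<phi>. test_function a b \<phi> \<Longrightarrow> (LINT x:{a<..<b}|lborel. \<phi> x *\<^sub>R f x) = 0"
  shows "AE x in lborel. x \<in> {a<..<b} \<longrightarrow> f x = 0"
proof -
  define h where "h x = indicator {a<..<b} x *\<^sub>R f x" for x
  have h: "integrable lborel h" using f by (simp add: set_integrable_def h_def[abs_def])
  have [measurable]: "h \<in> borel_measurable borel" using h by auto
  have interval: "(LINT x:{c<..<d}|lborel. h x) = 0" for c d
  proof (cases "max a c < min b d")
    case True
    let ?c = "max a c" and ?d = "min b d"
    have "(\<lambda>n. LINT x|lborel. cutoff ?c ?d n x *\<^sub>R h x) \<longlonglongrightarrow>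
        (LINT x|lborel. indicator {?c<..<?d} x *\<^sub>R h x)"
    proof (rule integral_dominated_convergence[where w = "\<lambda>x. norm (h x)"])
      have "cutoff ?c ?d n \<in> borel_measurable borel" for n
        by (rule test_function_measurable[OF test_function_cutoff[of a _ _ b]]) (use True in auto)
      then show "(\<lambda>x. cutoff ?c ?d n x *\<^sub>R h x) \<in> borel_measurable lborel" for n by measurable
      show "AE x in lborel. norm (cutoff ?c ?d n x *\<^sub>R h x) \<le> norm (h x)" for n
        using cutoff_bounds[of ?c ?d n] by (auto intro!: mult_left_le_one_le)
      show "AE x in lborel. (\<lambda>n. cutoff ?c ?d n x *\<^sub>R h x) \<longlonglongrightarrow> indicator {?c<..<?d} x *\<^sub>R h x"
        using cutoff_tendsto[OF True] by (auto intro!: tendsto_scaleR)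
    qed (use h in auto)
    moreover have "(LINT x|lborel. cutoff ?c ?d n x *\<^sub>R h x) = 0" for n
      using test[OF test_function_cutoff[of a ?c ?d b n]] True
      by (simp add: h_def set_lebesgue_integral_def mult.commute)
    ultimately have "(LINT x|lborel. indicator {?c<..<?d} x *\<^sub>R h x) = 0"
      by (simp add: LIMSEQ_const_iff)
    moreover have "indicator {?c<..<?d} x *\<^sub>R h x = indicator {c<..<d} x *\<^sub>R h x" for x
      by (auto simp: h_def indicator_def)
    ultimately show ?thesis by (simp add: set_lebesgue_integral_def)
  next
    case False
    then have "(\<lambda>x. indicator {c<..<d} x *\<^sub>R h x) = (\<lambda>x. 0)"
      by (auto simp: h_def indicator_def fun_eq_iff)
    then show ?thesis unfolding set_lebesgue_integral_def by simp
  qed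
  \<comment> \<open>The complement step of the induction needs the integral over the whole
    line.\<close>
  have total: "(LINT x|lborel. h x) = 0"
  proof -
    have "(LINT x|lborel. h x) = (LINT x:{a<..<b}|lborel. h x)"
      unfolding set_lebesgue_integral_def by (rule Bochner_Integration.integral_cong) (auto simp: h_def indicator_def)
    then show ?thesis using interval by simp
  qed
  have hS: "set_integrable lborel A h" if "A \<in> sets borel" for A
    using that h by (auto simp: set_integrable_def intro: integrable_mult_indicator)
  have sets_borel: "sets borel = sigma_sets UNIV (range (\<lambda>(a, b). {a<..<b::real}))"
    unfolding borel_eq_box box_real by simp
  have stable: "Int_stable (range (\<lambda>(a, b). {a<..<b::real}))" "range (\<lambda>(a, b). {a<..<b::real}) \<subseteq> Pow UNIV"
    by (auto simp: Int_stable_def)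
  have "(LINT x:A|lborel. h x) = 0" if "A \<in> sets borel" for A
  proof -
    have "A \<in> sigma_sets UNIV (range (\<lambda>(a, b). {a<..<b::real}))"
      using that by (simp add: sets_borel)
    then show ?thesis
    proof (induction rule: sigma_sets_induct_disjoint[OF stable, consumes 1, case_names basic empty compl union])
      case empty
      show ?case by (simp add: set_lebesgue_integral_def)
    next
      case (basic A)
      then show ?case using interval by auto
    next
      case (compl A)
      have A: "A \<in> sets borel"
        using compl(1) by (simp add: sets_borel)
      have "(LINT x:A \<union> (UNIV - A)|lborel. h x) = (LINT x:A|lborel. h x) + (LINT x:UNIV - A|lborel. h x)"
        using A by (intro set_integral_Un hS) auto
      then show ?case using total compl(2) by (simp add: set_lebesgue_integral_def)
    next
      case (union A)
      have A: "A i \<in> sets borel" for i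
        using union(2) by (auto simp: sets_borel)
      have "(LINT x:(\<Union>i. A i)|lborel. h x) = (\<Sum>i. LINT x:A i|lborel. h x)"
        using A union(1) by (intro lebesgue_integral_countable_add hS) (auto simp: disjoint_family_on_def)
      then show ?case using union(3) by simp
    qed
  qed
  then have "AE x in lborel. h x = 0" by (intro sigma_finite_measure.density_zero[OF sigma_finite_lborel] h) auto
  then show ?thesis by eventually_elim (auto simp: h_def)
qed

section \<open>Primitives of square-integrable functions\<close>

lemma integrable_indicator_Ioo: "integrable lborel (indicator {a<..<b::real} :: real \<Rightarrow> real)"
proof (rule integrable_real_indicator)
  show "emeasure lborel {a<..<b} < \<infinity>"
    by (rule emeasure_bounded_finite) (auto intro: bounded_subset[of "{a..b}"])
qed simp

lemma set_integrable_rep_l2: "set_integrable lborel {a<..<b} (rep_l2 u)"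
  unfolding set_integrable_def
proof (rule Bochner_Integration.integrable_bound)
  show "integrable lborel (\<lambda>x. indicator {a<..<b} x + (norm (rep_l2 u x))\<^sup>2)"
    by (intro Bochner_Integration.integrable_add integrable_norm_rep_l2 integrable_indicator_Ioo)
  have *: "norm v \<le> 1 + (norm v)\<^sup>2" for v :: 'a
    using sum_squares_bound[of "norm v" 1] by (simp add: power2_eq_square) (smt (verit) norm_ge_zero)
  show "AE x in lborel. norm (indicator {a<..<b} x *\<^sub>R rep_l2 u x)
      \<le> norm (indicator {a<..<b} x + (norm (rep_l2 u x))\<^sup>2)"
    using * by (auto simp: indicator_def)
qed measurable

section \<open>Step functions\<close>

definition step_l2 :: "real \<Rightarrow> real \<Rightarrow> 'a::euclidean_space \<Rightarrow> 'a l2" where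
  "step_l2 a b c = abs_l2 (\<lambda>x. indicator {a<..<b} x *\<^sub>R c)"

lemma square_integrable_if_bounded_on_Ioo:
  assumes "(\<lambda>x. indicator {a<..<b} x *\<^sub>R f x) \<in> borel_measurable borel"
    and "\<And>x. x \<in> {a<..<b} \<Longrightarrow> norm (f x) \<le> K"
  shows "square_integrable (\<lambda>x. indicator {a<..<b::real} x *\<^sub>R (f x :: 'a::euclidean_space))"
  unfolding square_integrable_def
proof
  show "integrable lborel (\<lambda>x. (norm (indicator {a<..<b} x *\<^sub>R f x))\<^sup>2)"
  proof (rule Bochner_Integration.integrable_bound)
    show "integrable lborel (\<lambda>x. K\<^sup>2 * indicator {a<..<b} x)"
      by (intro integrable_mult_right integrable_indicator_Ioo)
    show "AE x in lborel. norm ((norm (indicator {a<..<b} x *\<^sub>R f x))\<^sup>2) \<le> norm (K\<^sup>2 * indicator {a<..<b} x)"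
      using assms(2) by (auto simp: indicator_def intro!: power_mono)
  qed (use assms in measurable)
qed (use assms in simp)

lemma rep_step_l2: "AE x in lborel. rep_l2 (step_l2 a b c) x = indicator {a<..<b} x *\<^sub>R c"
  unfolding step_l2_def by (intro rep_abs_l2 square_integrable_if_bounded_on_Ioo[where K = "norm c"]) auto

lemma norm_l2_le_if_bounded_on_Ioo:
  assumes "AE x in lborel. norm (rep_l2 u x) \<le> indicator {a<..<b} x * K" "a \<le> b" "K \<ge> 0"
  shows "norm u \<le> sqrt (b - a) * K"
proof (rule power2_le_imp_le)
  have "(norm u)\<^sup>2 \<le> (LINT x|lborel. K\<^sup>2 * indicator {a<..<b} x)"
    unfolding norm_l2_sq
  proof (rule integral_mono_AE)
    show "AE x in lborel. (norm (rep_l2 u x))\<^sup>2 \<le> K\<^sup>2 * indicator {a<..<b} x"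
      using assms(1) by eventually_elim (auto simp: indicator_def intro!: power_mono)
    show "integrable lborel (\<lambda>x. K\<^sup>2 * indicator {a<..<b} x)"
      by (intro integrable_mult_right integrable_indicator_Ioo)
  qed (rule integrable_norm_rep_l2)
  also have "\<dots> = (sqrt (b - a) * K)\<^sup>2" using assms by (simp add: power_mult_distrib)
  finally show "(norm u)\<^sup>2 \<le> (sqrt (b - a) * K)\<^sup>2" .
qed (use assms in simp)

lemma step_l2_add: "step_l2 a b (c + d) = step_l2 a b c + step_l2 a b d"
proof (rule l2_eqI)
  show "AE x in lborel. rep_l2 (step_l2 a b (c + d)) x = rep_l2 (step_l2 a b c + step_l2 a b d) x"
    using rep_step_l2[of a b "c + d"] rep_step_l2[of a b c] rep_step_l2[of a b d]
      rep_l2_add[of "step_l2 a b c" "step_l2 a b d"]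
    by eventually_elim (simp add: scaleR_add_right)
qed

lemma step_l2_mult: "step_l2 a b (c * d) = scale_l2 c (step_l2 a b d)"
proof (rule l2_eqI)
  show "AE x in lborel. rep_l2 (step_l2 a b (c * d)) x = rep_l2 (scale_l2 c (step_l2 a b d)) x"
    using rep_step_l2[of a b "c * d"] rep_step_l2[of a b d] rep_l2_scale[of c "step_l2 a b d"]
    by eventually_elim simp
qed

lemma norm_step_l2_le: "a \<le> b \<Longrightarrow> norm (step_l2 a b c) \<le> sqrt (b - a) * norm c"
  using rep_step_l2[of a b c] by (intro norm_l2_le_if_bounded_on_Ioo) (auto elim!: AE_mp)

section \<open>Integrals over intervals\<close>

text \<open>For \<open>b \<le> a\<close> the interval is empty and the value is 0, not the negative
  of the reversed integral; \<open>prim u 0\<close> therefore vanishes on the negative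
  half-line.\<close>

definition prim :: "'a::euclidean_space l2 \<Rightarrow> real \<Rightarrow> real \<Rightarrow> 'a" where
  "prim u a b = (LINT t:{a<..<b}|lborel. rep_l2 u t)"

lemma prim_cong_AE:
  assumes "AE x in lborel. x \<in> {a<..<b} \<longrightarrow> rep_l2 u x = f x" "f \<in> borel_measurable borel"
  shows "prim u a b = (LINT t:{a<..<b}|lborel. f t)"
  unfolding prim_def by (rule set_lebesgue_integral_cong_AE) (use assms in auto)

lemma prim_add: "prim (u + v) a b = prim u a b + prim v a b"
proof -
  have "prim (u + v) a b = (LINT t:{a<..<b}|lborel. rep_l2 u t + rep_l2 v t)"
    using rep_l2_add[of u v] by (intro prim_cong_AE) auto
  then show ?thesis by (simp add: prim_def set_integral_add set_integrable_rep_l2)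
qed

lemma prim_scaleR: "prim (c *\<^sub>R u) a b = c *\<^sub>R prim u a b"
proof -
  have "prim (c *\<^sub>R u) a b = (LINT t:{a<..<b}|lborel. c *\<^sub>R rep_l2 u t)"
    using rep_l2_scaleR[of c u] by (intro prim_cong_AE) auto
  then show ?thesis by (simp add: prim_def set_lebesgue_integral_def scaleR_left_commute[of _ c])
qed

lemma prim_scale: "prim (scale_l2 c u) a b = c * prim u a b"
proof -
  have "prim (scale_l2 c u) a b = (LINT t:{a<..<b}|lborel. c * rep_l2 u t)"
    using rep_l2_scale[of c u] by (intro prim_cong_AE) auto
  then show ?thesis by (simp add: prim_def set_lebesgue_integral_def)
qed

lemma prim_sum: "finite I \<Longrightarrow> prim (\<Sum>i\<in>I. u i) a b = (\<Sum>i\<in>I. prim (u i) a b)"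
proof (induction I rule: finite_induct)
  case empty
  show ?case using prim_scaleR[of 0 0 a b] by simp
qed (simp add: prim_add)

lemma prim_split:
  assumes "a \<le> b" "b \<le> c"
  shows "prim u a c = prim u a b + prim u b c"
proof -
  have "prim u a c = (LINT t|lborel. indicator {a<..<b} t *\<^sub>R rep_l2 u t + indicator {b<..<c} t *\<^sub>R rep_l2 u t)"
    unfolding prim_def set_lebesgue_integral_def
  proof (rule integral_cong_AE)
    show "AE t in lborel. indicator {a<..<c} t *\<^sub>R rep_l2 u t
        = indicator {a<..<b} t *\<^sub>R rep_l2 u t + indicator {b<..<c} t *\<^sub>R rep_l2 u t"
      using AE_lborel_singleton[of b] by eventually_elim (use assms in \<open>auto simp: indicator_def\<close>)
  qed auto
  also have "\<dots> = prim u a b + prim u b c"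
    unfolding prim_def set_lebesgue_integral_def
    using set_integrable_rep_l2[of a b u] set_integrable_rep_l2[of b c u]
    by (intro Bochner_Integration.integral_add) (auto simp: set_integrable_def)
  finally show ?thesis .
qed

lemma prim_shift: "prim (shift_l2 h u) a b = prim u (a + h) (b + h)"
proof -
  have "prim (shift_l2 h u) a b = (LINT t:{a<..<b}|lborel. rep_l2 u (t + h))"
    using rep_l2_shift[of h u] by (intro prim_cong_AE) auto
  also have "\<dots> = (LINT t|lborel. indicator {a + h<..<b + h} (h + 1 * t) *\<^sub>R rep_l2 u (h + 1 * t))"
    unfolding set_lebesgue_integral_def
    by (rule Bochner_Integration.integral_cong) (auto simp: indicator_def add.commute)
  also have "\<dots> = prim u (a + h) (b + h)"
    unfolding prim_def set_lebesgue_integral_def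
    using lborel_integral_real_affine[of 1 "\<lambda>t. indicator {a + h<..<b + h} t *\<^sub>R rep_l2 u t" h] by simp
  finally show ?thesis .
qed

text \<open>Cauchy-Schwarz against the step function whose value is the integral itself; one factor
  \<open>norm p\<close> then cancels.\<close>

lemma norm_prim_le:
  assumes "a \<le> b"
  shows "norm (prim u a b) \<le> sqrt (b - a) * norm u"
proof (cases "prim u a b = 0")
  case False
  define p where "p = prim u a b"
  have "inner (step_l2 a b p) u = (LINT x|lborel. inner p (indicator {a<..<b} x *\<^sub>R rep_l2 u x))"
    unfolding inner_l2.rep_eq
  proof (rule integral_cong_AE)
    show "AE x in lborel. inner (rep_l2 (step_l2 a b p) x) (rep_l2 u x) = inner p (indicator {a<..<b} x *\<^sub>R rep_l2 u x)"
      using rep_step_l2[of a b p] by eventually_elim simp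
  qed auto
  also have "\<dots> = inner p p"
    using set_integrable_rep_l2[of a b u]
    by (simp add: p_def prim_def set_lebesgue_integral_def set_integrable_def del: inner_scaleR_right)
  finally have "(norm p)\<^sup>2 \<le> norm (step_l2 a b p) * norm u"
    using norm_cauchy_schwarz[of "step_l2 a b p" u] by (simp add: power2_norm_eq_inner)
  also have "\<dots> \<le> sqrt (b - a) * norm p * norm u"
    by (intro mult_right_mono norm_step_l2_le assms) auto
  finally have "norm p * norm p \<le> norm p * (sqrt (b - a) * norm u)"
    by (simp add: power2_eq_square mult_ac)
  then show ?thesis using False by (simp add: p_def)
qed (use assms in simp)

text \<open>This Hoelder bound with exponent 1/2 gives both the continuity of primitives and the
  rate of their approximation by step functions.\<close>

lemma norm_prim_diff_le:
  assumes "0 \<le> x" "0 \<le> y"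
  shows "norm (prim u 0 x - prim u 0 y) \<le> sqrt \<bar>x - y\<bar> * norm u"
  using assms
proof (induction x y rule: linorder_wlog)
  case (le x y)
  then show ?case using prim_split[of 0 x y u] norm_prim_le[of x y u] by simp
next
  case (sym x y)
  then show ?case by (simp add: norm_minus_commute abs_minus_commute)
qed

lemma continuous_on_prim: "continuous_on {0..L} (prim u 0)"
  unfolding continuous_on_def
proof
  fix x assume "x \<in> {0..L}"
  have "((\<lambda>y. sqrt \<bar>y - x\<bar> * norm u) \<longlongrightarrow> sqrt \<bar>x - x\<bar> * norm u) (at x within {0..L})"
    by (intro tendsto_intros)
  then have "((\<lambda>y. sqrt \<bar>y - x\<bar> * norm u) \<longlongrightarrow> 0) (at x within {0..L})" by simp
  then have "((\<lambda>y. prim u 0 y - prim u 0 x) \<longlongrightarrow> 0) (at x within {0..L})"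
  proof (rule Lim_null_comparison[rotated])
    show "\<forall>\<^sub>F y in at x within {0..L}. norm (prim u 0 y - prim u 0 x) \<le> sqrt \<bar>y - x\<bar> * norm u"
      using \<open>x \<in> {0..L}\<close> by (auto simp: eventually_at_filter intro!: always_eventually norm_prim_diff_le)
  qed
  then show "(prim u 0 \<longlongrightarrow> prim u 0 x) (at x within {0..L})" by (rule LIM_zero_cancel)
qed

section \<open>The Volterra operator and its approximation by finite rank\<close>

definition J_l2 :: "real \<Rightarrow> 'a::euclidean_space l2 \<Rightarrow> 'a l2" where
  "J_l2 L u = abs_l2 (\<lambda>x. indicator {0<..<L} x *\<^sub>R prim u 0 x)"

lemma measurable_prim: "(\<lambda>x. indicator {0<..<L} x *\<^sub>R prim u 0 x) \<in> borel_measurable borel"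
  by (intro borel_measurable_continuous_on_indicator continuous_on_subset[OF continuous_on_prim[of L]]) auto

lemma norm_prim_bound: "x \<in> {0<..<L} \<Longrightarrow> norm (prim u 0 x) \<le> sqrt L * norm u"
  using norm_prim_le[of 0 x u]
  by (rule order_trans) (auto intro!: mult_right_mono)

lemma rep_J_l2: "AE x in lborel. rep_l2 (J_l2 L u) x = indicator {0<..<L} x *\<^sub>R prim u 0 x"
  unfolding J_l2_def
  by (intro rep_abs_l2 square_integrable_if_bounded_on_Ioo[where K = "sqrt L * norm u"]
      measurable_prim norm_prim_bound)

lemma norm_J_l2_le:
  assumes "0 \<le> L"
  shows "norm (J_l2 L u) \<le> L * norm u"
proof -
  have "norm (J_l2 L u) \<le> sqrt (L - 0) * (sqrt L * norm u)"
  proof (rule norm_l2_le_if_bounded_on_Ioo)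
    show "AE x in lborel. norm (rep_l2 (J_l2 L u) x) \<le> indicator {0<..<L} x * (sqrt L * norm u)"
      using rep_J_l2[of L u]
      by eventually_elim (auto simp: indicator_def intro!: norm_prim_bound)
  qed (use assms in auto)
  then show ?thesis using assms by (simp flip: mult.assoc)
qed

lemma J_l2_add: "J_l2 L (u + v) = J_l2 L u + J_l2 L v"
proof (rule l2_eqI)
  show "AE x in lborel. rep_l2 (J_l2 L (u + v)) x = rep_l2 (J_l2 L u + J_l2 L v) x"
    using rep_J_l2[of L "u + v"] rep_J_l2[of L u] rep_J_l2[of L v] rep_l2_add[of "J_l2 L u" "J_l2 L v"]
    by eventually_elim (simp add: prim_add scaleR_add_right)
qed

lemma J_l2_scale: "J_l2 L (scale_l2 c u) = scale_l2 c (J_l2 L u)"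
proof (rule l2_eqI)
  show "AE x in lborel. rep_l2 (J_l2 L (scale_l2 c u)) x = rep_l2 (scale_l2 c (J_l2 L u)) x"
    using rep_J_l2[of L "scale_l2 c u"] rep_J_l2[of L u] rep_l2_scale[of c "J_l2 L u"]
    by eventually_elim (simp add: prim_scale)
qed

lemma J_l2_in_L2_on: "J_l2 L u \<in> L2_on 0 L"
  unfolding L2_on_def using rep_J_l2[of L u] by (auto elim!: AE_mp simp: indicator_def)

lemma step_l2_in_L2_on: "step_l2 a b c \<in> L2_on a b"
  unfolding L2_on_def using rep_step_l2[of a b c] by (auto elim!: AE_mp simp: indicator_def)

lemma L2_on_add: "u \<in> L2_on a b \<Longrightarrow> v \<in> L2_on a b \<Longrightarrow> u + v \<in> L2_on a b"
proof -
  assume "u \<in> L2_on a b" "v \<in> L2_on a b"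
  then have "AE x in lborel. x \<notin> {a<..<b} \<longrightarrow> rep_l2 u x = 0"
    "AE x in lborel. x \<notin> {a<..<b} \<longrightarrow> rep_l2 v x = 0" by (auto simp: L2_on_def)
  then have "AE x in lborel. x \<notin> {a<..<b} \<longrightarrow> rep_l2 (u + v) x = 0"
    using rep_l2_add[of u v] by eventually_elim simp
  then show ?thesis by (simp add: L2_on_def)
qed

lemma L2_on_scale: "u \<in> L2_on a b \<Longrightarrow> scale_l2 c u \<in> L2_on a b"
proof -
  assume "u \<in> L2_on a b"
  then have "AE x in lborel. x \<notin> {a<..<b} \<longrightarrow> rep_l2 u x = 0" by (auto simp: L2_on_def)
  then have "AE x in lborel. x \<notin> {a<..<b} \<longrightarrow> rep_l2 (scale_l2 c u) x = 0"
    using rep_l2_scale[of c u] by eventually_elim simp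
  then show ?thesis by (simp add: L2_on_def)
qed

lemma L2_on_zero: "0 \<in> L2_on a b"
  unfolding L2_on_def using rep_l2_zero by (auto elim!: AE_mp)

lemma L2_on_iff_restrict: "u \<in> L2_on a b \<longleftrightarrow> restrict_l2 a b u = u"
proof
  assume "u \<in> L2_on a b"
  then have "AE x in lborel. x \<notin> {a<..<b} \<longrightarrow> rep_l2 u x = 0" by (auto simp: L2_on_def)
  then have "AE x in lborel. rep_l2 (restrict_l2 a b u) x = rep_l2 u x"
    using rep_l2_restrict[of a b u] by eventually_elim (auto simp: indicator_def)
  then show "restrict_l2 a b u = u" by (rule l2_eqI)
next
  assume "restrict_l2 a b u = u"
  then have "AE x in lborel. rep_l2 u x = indicator {a<..<b} x *\<^sub>R rep_l2 u x"
    using rep_l2_restrict[of a b u] by simp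
  then have "AE x in lborel. x \<notin> {a<..<b} \<longrightarrow> rep_l2 u x = 0"
    by eventually_elim (auto simp: indicator_def)
  then show "u \<in> L2_on a b" by (simp add: L2_on_def)
qed

text \<open>This approximation by operators of finite rank replaces the compactness of \<open>W\<^sup>1 \<rightarrow> L\<^sub>2\<close>.\<close>

lemma J_l2_step_approx:
  assumes "L > 0" "n > 0"
  shows "norm (J_l2 L u - (\<Sum>i<n. step_l2 (real i * (L / n)) (real (Suc i) * (L / n)) (prim u 0 (real i * (L / n)))))
    \<le> L / sqrt n * norm u"
proof -
  define h where "h = L / n"
  have h: "h > 0" using assms by (simp add: h_def)
  have nh: "real n * h = L" using assms by (simp add: h_def)
  let ?s = "\<lambda>i. step_l2 (real i * h) (real (Suc i) * h) (prim u 0 (real i * h))"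
  let ?D = "J_l2 L u - (\<Sum>i<n. ?s i)"
  \<comment> \<open>Within a cell of width \<open>h\<close> the primitive varies by at most
    \<open>sqrt h * norm u\<close>. The length of the whole interval contributes the factor
    \<open>sqrt L\<close>, and \<open>sqrt L * sqrt h = L / sqrt n\<close>.\<close>
  have "norm ?D \<le> sqrt (L - 0) * (sqrt h * norm u)"
  proof (rule norm_l2_le_if_bounded_on_Ioo)
    have "AE x in lborel. \<forall>i. rep_l2 (?s i) x = indicator {real i * h<..<real (Suc i) * h} x *\<^sub>R prim u 0 (real i * h)"
      unfolding AE_all_countable using rep_step_l2 by blast
    \<comment> \<open>The open cells miss the grid points, which form a null set.\<close>
    moreover have "AE x in lborel. \<forall>i. x \<noteq> real i * h"
      unfolding AE_all_countable using AE_lborel_singleton by blast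
    ultimately show "AE x in lborel. norm (rep_l2 ?D x) \<le> indicator {0<..<L} x * (sqrt h * norm u)"
      using rep_J_l2[of L u] rep_l2_diff[of "J_l2 L u" "\<Sum>i<n. ?s i"] rep_l2_sum[OF finite_lessThan, of ?s n]
    proof eventually_elim
      case (elim x)
      have eq: "rep_l2 ?D x = indicator {0<..<L} x *\<^sub>R prim u 0 x
          - (\<Sum>i<n. indicator {real i * h<..<real (Suc i) * h} x *\<^sub>R prim u 0 (real i * h))"
        using elim by simp
      show ?case
      proof (cases "x \<in> {0<..<L}")
        case False
        have "x \<notin> {real i * h<..<real (Suc i) * h}" if "i < n" for i
        proof -
          have "real (Suc i) * h \<le> real n * h" using that h by (intro mult_right_mono) auto
          moreover have "0 \<le> real i * h" using h by simp
          ultimately show ?thesis using False unfolding nh by auto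
        qed
        then have "(\<Sum>i<n. indicator {real i * h<..<real (Suc i) * h} x *\<^sub>R prim u 0 (real i * h)) = 0"
          by (intro sum.neutral) (auto simp del: of_nat_Suc)
        then show ?thesis unfolding eq using False by simp
      next
        case True
        define k where "k = nat \<lfloor>x / h\<rfloor>"
        have "real k = of_int \<lfloor>x / h\<rfloor>" using True h by (simp add: k_def)
        then have "real k \<le> x / h" "x / h < real (Suc k)" unfolding of_nat_Suc by linarith+
        then have k: "real k * h \<le> x" "x < real (Suc k) * h"
          using h by (auto simp: field_simps)
        have k': "real k * h < x" using k(1) elim(2)[rule_format, of k] by linarith
        have "k < n"
        proof (rule ccontr)
          assume "\<not> k < n"
          then have "real n * h \<le> real k * h" using h by (intro mult_right_mono) auto
          then show False using k(1) True nh by simp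
        qed
        have uniq: "i = k" if "x \<in> {real i * h<..<real (Suc i) * h}" for i
        proof -
          have "real i * h < real (Suc k) * h" "real k * h < real (Suc i) * h" using that k k' by auto
          then have "real i < real (Suc k)" "real k < real (Suc i)"
            using h mult_less_cancel_right_pos by blast+
          then show ?thesis by simp
        qed
        have "(\<Sum>i<n. indicator {real i * h<..<real (Suc i) * h} x *\<^sub>R prim u 0 (real i * h))
            = (\<Sum>i<n. if i = k then prim u 0 (real k * h) else 0)"
        proof (intro sum.cong refl)
          fix i
          show "indicator {real i * h<..<real (Suc i) * h} x *\<^sub>R prim u 0 (real i * h)
              = (if i = k then prim u 0 (real k * h) else 0)"
          proof (cases "i = k")
            case True
            then show ?thesis using k k' by (simp del: of_nat_Suc)
          next
            case False
            then have "x \<notin> {real i * h<..<real (Suc i) * h}" using uniq by blast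
            then show ?thesis using False by (simp del: of_nat_Suc)
          qed
        qed
        also have "\<dots> = prim u 0 (real k * h)" using \<open>k < n\<close> by simp
        finally have "norm (rep_l2 ?D x) = norm (prim u 0 x - prim u 0 (real k * h))"
          unfolding eq using True by simp
        also have "\<dots> \<le> sqrt \<bar>x - real k * h\<bar> * norm u"
          using True h by (intro norm_prim_diff_le) auto
        also have "\<dots> \<le> sqrt h * norm u"
          using k by (intro mult_right_mono real_sqrt_le_mono) (auto simp: algebra_simps)
        finally show ?thesis using True by simp
      qed
    qed
  qed (use assms h in auto)
  also have "\<dots> = L / sqrt n * norm u"
    using assms by (simp add: h_def real_sqrt_divide)
  finally show ?thesis unfolding h_def .
qed

section \<open>Sobolev spaces through primitives\<close>

lemma step_l2_zero [simp]: "step_l2 a b 0 = 0"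
  using step_l2_add[of a b 0 0] by simp

lemma prim_same [simp]: "prim u a a = 0"
  by (simp add: prim_def set_lebesgue_integral_def)

lemma not_AE_notin_Ioo:
  assumes "p < (q::real)"
  shows "\<not> (AE x in lborel. x \<notin> {p<..<q})"
proof
  assume "AE x in lborel. x \<notin> {p<..<q}"
  then have "emeasure lborel {p<..<q} = 0"
    by (subst (asm) AE_iff_measurable[of "{p<..<q}"]) auto
  then show False using assms by simp
qed

section \<open>Integration by parts and weak derivatives of primitives\<close>

lemma integral_deriv_test_function:
  assumes "test_function a b \<phi>" "s \<le> t"
  shows "(LINT x:{s<..<t}|lborel. deriv \<phi> x) = \<phi> t - \<phi> s"
proof -
  have "(LINT x:{s<..<t}|lborel. deriv \<phi> x) = (LINT x|lborel. deriv \<phi> x * indicator {s..t} x)"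
    unfolding set_lebesgue_integral_def
  proof (rule integral_cong_AE)
    show "AE x in lborel. indicator {s<..<t} x *\<^sub>R deriv \<phi> x = deriv \<phi> x * indicator {s..t} x"
      using AE_lborel_singleton[of s] AE_lborel_singleton[of t]
      by eventually_elim (auto simp: indicator_def)
  qed (use test_function_measurable[OF test_function_deriv[OF assms(1)]] in auto)
  also have "\<dots> = \<phi> t - \<phi> s"
    using test_function_has_deriv[OF assms(1)] test_function_has_deriv[OF test_function_deriv[OF assms(1)]]
    by (intro integral_FTC_Icc_real assms) (auto intro: DERIV_isCont)
  finally show ?thesis .
qed

lemma test_function_outside: "test_function a b \<phi> \<Longrightarrow> x \<le> a \<or> b \<le> x \<Longrightarrow> \<phi> x = 0"
  unfolding test_function_def by fastforce

lemma set_integrable_test_function: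
  fixes f :: "real \<Rightarrow> 'a::euclidean_space"
  assumes \<phi>: "test_function c d \<phi>" and f: "set_integrable lborel A f"
  shows "set_integrable lborel A (\<lambda>x. \<phi> x *\<^sub>R f x)"
proof -
  have [measurable]: "\<phi> \<in> borel_measurable borel" by (rule test_function_measurable[OF \<phi>])
  obtain K where K: "\<And>x. \<bar>\<phi> x\<bar> \<le> K" using test_function_bounded[OF \<phi>] by blast
  have m: "(\<lambda>x. indicator A x *\<^sub>R f x) \<in> borel_measurable lborel"
    using f by (auto simp: set_integrable_def)
  have "integrable lborel (\<lambda>x. \<phi> x *\<^sub>R (indicator A x *\<^sub>R f x))"
  proof (rule Bochner_Integration.integrable_bound)
    show "integrable lborel (\<lambda>x. K *\<^sub>R (indicator A x *\<^sub>R f x))"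
      using f by (intro integrable_scaleR_right) (auto simp: set_integrable_def)
    show "AE x in lborel. norm (\<phi> x *\<^sub>R (indicator A x *\<^sub>R f x)) \<le> norm (K *\<^sub>R (indicator A x *\<^sub>R f x))"
    proof (rule AE_I2)
      fix x
      have "\<bar>\<phi> x\<bar> \<le> \<bar>K\<bar>" using K[of x] by linarith
      then show "norm (\<phi> x *\<^sub>R (indicator A x *\<^sub>R f x)) \<le> norm (K *\<^sub>R (indicator A x *\<^sub>R f x))"
        unfolding norm_scaleR by (rule mult_right_mono) simp
    qed
  qed (use m in measurable)
  then show ?thesis unfolding set_integrable_def by (simp add: mult.commute)
qed

lemma set_integrable_const_Ioo: "set_integrable lborel {a<..<b::real} (\<lambda>x. c :: 'a::euclidean_space)"
  unfolding set_integrable_def by (intro integrable_scaleR_left integrable_indicator_Ioo)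

lemma integrable_test_function:
  assumes "test_function a b \<phi>"
  shows "integrable lborel \<phi>"
proof -
  have "(\<lambda>x. indicator {a<..<b} x *\<^sub>R (\<phi> x *\<^sub>R 1)) = \<phi>"
  proof
    fix x show "indicator {a<..<b} x *\<^sub>R (\<phi> x *\<^sub>R 1) = \<phi> x"
      using test_function_outside[OF assms, of x] by (cases "x \<in> {a<..<b}") auto
  qed
  then show ?thesis
    using set_integrable_test_function[OF assms set_integrable_const_Ioo[of a b "1::real"]]
    by (simp add: set_integrable_def)
qed

text \<open>Fubini on the triangle \<open>t < x\<close>: for fixed \<open>t\<close> the integral of
  \<open>deriv \<phi>\<close> from \<open>t\<close> to \<open>L\<close> is
  \<open>- \<phi> t\<close>, since \<open>\<phi>\<close> vanishes at \<open>L\<close>.\<close>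

lemma integration_by_parts_prim:
  fixes u :: "'a::euclidean_space l2"
  assumes \<phi>: "test_function 0 L \<phi>"
  shows "(LINT x:{0<..<L}|lborel. deriv \<phi> x *\<^sub>R prim u 0 x) = - (LINT x:{0<..<L}|lborel. \<phi> x *\<^sub>R rep_l2 u x)"
proof -
  note \<phi>' = test_function_deriv[OF \<phi>]
  have [measurable]: "deriv \<phi> \<in> borel_measurable borel" by (rule test_function_measurable[OF \<phi>'])
  obtain K where K: "\<And>x. \<bar>deriv \<phi> x\<bar> \<le> K" using test_function_bounded[OF \<phi>'] by blast
  define g where "g t = indicator {0<..<L} t *\<^sub>R rep_l2 u t" for t
  have g: "integrable lborel g"
    using set_integrable_rep_l2[of 0 L u] by (simp add: set_integrable_def g_def[abs_def])
  have [measurable]: "g \<in> borel_measurable borel" using g by auto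
  define c where "c t x = indicator {0<..<L} x * (if t < x then deriv \<phi> x else 0)" for t x
  have c_meas [measurable]: "case_prod c \<in> borel_measurable (lborel \<Otimes>\<^sub>M lborel)"
    unfolding c_def[abs_def] by measurable
  have cK: "\<bar>c t x\<bar> \<le> indicator {0<..<L} x * K" for t x
    using K[of x] by (auto simp: c_def indicator_def)
  define H where "H t x = c t x *\<^sub>R g t" for t x
  \<comment> \<open>\<open>deriv \<phi>\<close> is bounded, so the double integrand is dominated by
    a constant on the bounded interval in \<open>x\<close> times the integrable \<open>g\<close> in
    \<open>t\<close>.\<close>
  have int: "integrable (lborel \<Otimes>\<^sub>M lborel) (case_prod H)"
  proof (rule Bochner_Integration.integrable_bound)
    show "integrable (lborel \<Otimes>\<^sub>M lborel) (\<lambda>(t, x). (indicator {0<..<L} x * K) *\<^sub>R g t)"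
    proof (rule lborel_pair.Fubini_integrable)
      have "(\<integral>x. norm (case (t, x) of (t, x) \<Rightarrow> (indicator {0<..<L} x * K) *\<^sub>R g t) \<partial>lborel)
          = (\<integral>x. indicator {0<..<L::real} x * \<bar>K\<bar> \<partial>lborel) * norm (g t)" for t
        by (simp add: abs_mult)
      then show "integrable lborel (\<lambda>t. \<integral>x. norm (case (t, x) of (t, x) \<Rightarrow> (indicator {0<..<L} x * K) *\<^sub>R g t) \<partial>lborel)"
        using g by simp
      show "AE t in lborel. integrable lborel (\<lambda>x. case (t, x) of (t, x) \<Rightarrow> (indicator {0<..<L} x * K) *\<^sub>R g t)"
        by (auto intro!: integrable_indicator_Ioo integrable_scaleR_left integrable_mult_left)
    qed measurable
    show "AE p in lborel \<Otimes>\<^sub>M lborel. norm (case_prod H p)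
        \<le> norm (case p of (t, x) \<Rightarrow> (indicator {0<..<L} x * K) *\<^sub>R g t)"
    proof (rule AE_I2)
      fix p :: "real \<times> real"
      have "\<bar>c (fst p) (snd p)\<bar> \<le> \<bar>indicator {0<..<L} (snd p) * K\<bar>"
        using cK[of "fst p" "snd p"] by linarith
      then show "norm (case_prod H p) \<le> norm (case p of (t, x) \<Rightarrow> (indicator {0<..<L} x * K) *\<^sub>R g t)"
        unfolding case_prod_beta H_def norm_scaleR by (rule mult_right_mono) simp
    qed
  qed (unfold H_def[abs_def], measurable)
  have "(\<integral>t. H t x \<partial>lborel) = indicator {0<..<L} x *\<^sub>R (deriv \<phi> x *\<^sub>R prim u 0 x)" for x
  proof (cases "x \<in> {0<..<L}")
    case True
    have "(\<integral>t. H t x \<partial>lborel) = (\<integral>t. deriv \<phi> x *\<^sub>R (indicator {0<..<x} t *\<^sub>R rep_l2 u t) \<partial>lborel)"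
      by (rule Bochner_Integration.integral_cong)
        (use True in \<open>auto simp: H_def c_def g_def indicator_def\<close>)
    also have "\<dots> = deriv \<phi> x *\<^sub>R prim u 0 x"
      unfolding prim_def set_lebesgue_integral_def by (rule integral_scaleR_right)
    finally show ?thesis using True by simp
  qed (simp add: H_def c_def)
  then have "(LINT x:{0<..<L}|lborel. deriv \<phi> x *\<^sub>R prim u 0 x) = (\<integral>x. (\<integral>t. H t x \<partial>lborel) \<partial>lborel)"
    by (simp add: set_lebesgue_integral_def)
  also have "\<dots> = (\<integral>t. (\<integral>x. H t x \<partial>lborel) \<partial>lborel)"
    by (rule lborel_pair.Fubini_integral[OF int])
  also have "\<dots> = (\<integral>t. - (indicator {0<..<L} t *\<^sub>R (\<phi> t *\<^sub>R rep_l2 u t)) \<partial>lborel)"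
  proof (rule Bochner_Integration.integral_cong[OF refl])
    fix t
    show "(\<integral>x. H t x \<partial>lborel) = - (indicator {0<..<L} t *\<^sub>R (\<phi> t *\<^sub>R rep_l2 u t))"
    proof (cases "t \<in> {0<..<L}")
      case True
      have "(\<integral>x. H t x \<partial>lborel) = (\<integral>x. (indicator {t<..<L} x * deriv \<phi> x) *\<^sub>R g t \<partial>lborel)"
        by (rule Bochner_Integration.integral_cong)
          (use True in \<open>auto simp: H_def c_def indicator_def\<close>)
      also have "\<dots> = (LINT x:{t<..<L}|lborel. deriv \<phi> x) *\<^sub>R g t"
        unfolding set_lebesgue_integral_def real_scaleR_def
        by (subst integral_scaleR_left) (use set_integrable_test_function[OF \<phi>', of "{t<..<L}" "\<lambda>x. 1::real"]
            integrable_indicator_Ioo[of t L] in \<open>auto simp: set_integrable_def\<close>)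
      also have "\<dots> = - (\<phi> t *\<^sub>R g t)"
        using True integral_deriv_test_function[OF \<phi>, of t L] test_function_outside[OF \<phi>, of L] by simp
      finally show ?thesis using True by (simp add: g_def)
    qed (simp add: H_def g_def)
  qed
  finally show ?thesis by (simp add: set_lebesgue_integral_def)
qed

lemma set_integrable_J:
  "set_integrable lborel {0<..<L} (\<lambda>x. prim u 0 x)"
proof -
  have "integrable lborel (\<lambda>x. indicator {0<..<L} x *\<^sub>R rep_l2 (J_l2 L u) x)"
    using set_integrable_rep_l2[of 0 L "J_l2 L u"] by (simp add: set_integrable_def)
  moreover have "AE x in lborel. indicator {0<..<L} x *\<^sub>R rep_l2 (J_l2 L u) x = indicator {0<..<L} x *\<^sub>R prim u 0 x"
    using rep_J_l2[of L u] by eventually_elim (auto simp: indicator_def)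
  ultimately show ?thesis
    unfolding set_integrable_def using measurable_prim[of L u]
    by (subst integrable_cong_AE[symmetric]) auto
qed

lemma has_weak_deriv_zero: "has_weak_deriv a b 0 u u"
  by (simp add: has_weak_deriv_def)

lemma AE_step_plus_J:
  "AE x in lborel. rep_l2 (step_l2 0 L d + J_l2 L g) x = indicator {0<..<L} x *\<^sub>R (d + prim g 0 x)"
  using rep_l2_add[of "step_l2 0 L d" "J_l2 L g"] rep_step_l2[of 0 L d] rep_J_l2[of L g]
  by eventually_elim (simp add: scaleR_add_right)

lemma has_weak_deriv_step_plus_J:
  assumes "0 < L"
  shows "has_weak_deriv 0 L 1 (step_l2 0 L d + J_l2 L g) g"
  unfolding has_weak_deriv_def
proof (intro allI impI)
  fix \<phi> assume \<phi>: "test_function 0 L \<phi>"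
  have [measurable]: "deriv \<phi> \<in> borel_measurable borel"
    by (rule test_function_measurable[OF test_function_deriv[OF \<phi>]])
  have m: "(\<lambda>x. indicator {0<..<L} x *\<^sub>R (deriv \<phi> x *\<^sub>R (d + prim g 0 x))) \<in> borel_measurable borel"
  proof -
    have "(\<lambda>x. deriv \<phi> x *\<^sub>R (indicator {0<..<L} x *\<^sub>R d + indicator {0<..<L} x *\<^sub>R prim g 0 x)) \<in> borel_measurable borel"
      using measurable_prim[of L g] by measurable
    then show ?thesis by (simp add: scaleR_add_right mult.commute)
  qed
  have "(LINT x:{0<..<L}|lborel. deriv \<phi> x *\<^sub>R rep_l2 (step_l2 0 L d + J_l2 L g) x)
      = (LINT x:{0<..<L}|lborel. deriv \<phi> x *\<^sub>R d + deriv \<phi> x *\<^sub>R prim g 0 x)"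
    unfolding set_lebesgue_integral_def
  proof (rule integral_cong_AE)
    show "AE x in lborel. indicator {0<..<L} x *\<^sub>R deriv \<phi> x *\<^sub>R rep_l2 (step_l2 0 L d + J_l2 L g) x
        = indicator {0<..<L} x *\<^sub>R (deriv \<phi> x *\<^sub>R d + deriv \<phi> x *\<^sub>R prim g 0 x)"
      using AE_step_plus_J[of L d g] by eventually_elim (auto simp: indicator_def scaleR_add_right)
  qed (use m in \<open>auto simp: scaleR_add_right\<close>)
  also have "\<dots> = (LINT x:{0<..<L}|lborel. deriv \<phi> x *\<^sub>R d) + (LINT x:{0<..<L}|lborel. deriv \<phi> x *\<^sub>R prim g 0 x)"
    by (intro set_integral_add set_integrable_test_function[OF test_function_deriv[OF \<phi>]]
        set_integrable_J set_integrable_const_Ioo)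
  also have "(LINT x:{0<..<L}|lborel. deriv \<phi> x *\<^sub>R d) = (LINT x:{0<..<L}|lborel. deriv \<phi> x) *\<^sub>R d"
    by (intro set_integral_scaleR_left integrable_test_function[OF test_function_deriv[OF \<phi>]]) simp
  also have "(LINT x:{0<..<L}|lborel. deriv \<phi> x) = 0"
    using integral_deriv_test_function[OF \<phi>, of 0 L] test_function_outside[OF \<phi>] assms by simp
  finally show "(LINT x:{0<..<L}|lborel. (deriv ^^ 1) \<phi> x *\<^sub>R rep_l2 (step_l2 0 L d + J_l2 L g) x) =
      (- 1) ^ 1 *\<^sub>R (LINT x:{0<..<L}|lborel. \<phi> x *\<^sub>R rep_l2 g x)"
    using integration_by_parts_prim[OF \<phi>, of g] by simp
qed

text \<open>Test integrals decide the values inside \<open>{a<..<b}\<close>; membership in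
  \<open>L2_on a b\<close> settles those outside.\<close>

lemma weak_deriv_unique:
  assumes "has_weak_deriv a b k u g" "has_weak_deriv a b k u g'" "g \<in> L2_on a b" "g' \<in> L2_on a b"
  shows "g = g'"
proof -
  have "AE x in lborel. x \<in> {a<..<b} \<longrightarrow> rep_l2 g x - rep_l2 g' x = 0"
  proof (rule AE_zero_if_test_integrals_zero)
    show "set_integrable lborel {a<..<b} (\<lambda>x. rep_l2 g x - rep_l2 g' x)"
      by (intro set_integral_diff set_integrable_rep_l2)
    fix \<phi> assume \<phi>: "test_function a b \<phi>"
    have "(-1) ^ k *\<^sub>R (LINT x:{a<..<b}|lborel. \<phi> x *\<^sub>R rep_l2 g x)
        = (-1) ^ k *\<^sub>R (LINT x:{a<..<b}|lborel. \<phi> x *\<^sub>R rep_l2 g' x)"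
      by (rule trans[OF assms(1)[unfolded has_weak_deriv_def, rule_format, OF \<phi>, symmetric]
            assms(2)[unfolded has_weak_deriv_def, rule_format, OF \<phi>]])
    then show "(LINT x:{a<..<b}|lborel. \<phi> x *\<^sub>R (rep_l2 g x - rep_l2 g' x)) = 0"
      by (simp add: scaleR_diff_right set_integral_diff set_integrable_test_function[OF \<phi>] set_integrable_rep_l2)
  qed
  moreover have "AE x in lborel. x \<notin> {a<..<b} \<longrightarrow> rep_l2 g x = 0" "AE x in lborel. x \<notin> {a<..<b} \<longrightarrow> rep_l2 g' x = 0"
    using assms by (auto simp: L2_on_def)
  ultimately have "AE x in lborel. rep_l2 g x = rep_l2 g' x" by eventually_elim auto
  then show ?thesis by (rule l2_eqI)
qed

lemma weak_deriv_eqI: "has_weak_deriv a b k u g \<Longrightarrow> g \<in> L2_on a b \<Longrightarrow> weak_deriv a b k u = g"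
  unfolding weak_deriv_def by (rule the_equality) (auto intro: weak_deriv_unique)

lemma has_weak_deriv_Suc:
  assumes "has_weak_deriv a b 1 u g" "has_weak_deriv a b k g h"
  shows "has_weak_deriv a b (Suc k) u h"
proof -
  have "test_function a b ((deriv ^^ k) \<phi>)" if "test_function a b \<phi>" for \<phi>
    by (induction k) (auto simp: that test_function_deriv)
  then show ?thesis using assms by (simp add: has_weak_deriv_def)
qed

text \<open>\<open>deriv \<phi>\<close> is itself a test function, so testing \<open>g\<close>
  against it amounts to testing \<open>u\<close> against the second derivative of
  \<open>\<phi>\<close>.\<close>

lemma has_weak_deriv_deriv:
  assumes "has_weak_deriv a b 1 u g" "has_weak_deriv a b 2 u h"
  shows "has_weak_deriv a b 1 g h"
  unfolding has_weak_deriv_def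
proof (intro allI impI)
  fix \<phi> assume \<phi>: "test_function a b \<phi>"
  have "(LINT x:{a<..<b}|lborel. deriv (deriv \<phi>) x *\<^sub>R rep_l2 u x) = - (LINT x:{a<..<b}|lborel. deriv \<phi> x *\<^sub>R rep_l2 g x)"
    using assms(1) test_function_deriv[OF \<phi>] by (simp add: has_weak_deriv_def)
  moreover have "(LINT x:{a<..<b}|lborel. deriv (deriv \<phi>) x *\<^sub>R rep_l2 u x) = (LINT x:{a<..<b}|lborel. \<phi> x *\<^sub>R rep_l2 h x)"
    using assms(2) \<phi> by (simp add: has_weak_deriv_def numeral_2_eq_2)
  ultimately show "(LINT x:{a<..<b}|lborel. (deriv ^^ 1) \<phi> x *\<^sub>R rep_l2 g x) = (- 1) ^ 1 *\<^sub>R (LINT x:{a<..<b}|lborel. \<phi> x *\<^sub>R rep_l2 h x)"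
    by simp
qed

section \<open>Functions with vanishing weak derivative\<close>

lemma test_function_diff_cmult:
  assumes "test_function a b \<phi>" "test_function a b \<psi>"
  shows "test_function a b (\<lambda>x. \<phi> x - c * \<psi> x)"
proof -
  obtain c1 d1 c2 d2 where cd: "a < c1" "c1 \<le> d1" "d1 < b" "\<And>x. x \<notin> {c1..d1} \<Longrightarrow> \<phi> x = 0"
    "a < c2" "c2 \<le> d2" "d2 < b" "\<And>x. x \<notin> {c2..d2} \<Longrightarrow> \<psi> x = 0"
    using assms unfolding test_function_def by metis
  have "\<phi> x - c * \<psi> x = 0" if "x \<notin> {min c1 c2..max d1 d2}" for x
  proof -
    have "x \<notin> {c1..d1}" "x \<notin> {c2..d2}" using that by auto
    then show ?thesis using cd(4,8) by simp
  qed
  moreover have "a < min c1 c2" "min c1 c2 \<le> max d1 d2" "max d1 d2 < b" using cd by auto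
  moreover have "times_differentiable n (\<lambda>x. \<phi> x + (- c) * \<psi> x)" for n
    using assms by (intro times_differentiable_add times_differentiable_mult times_differentiable_const)
      (auto simp: test_function_iff)
  then have "\<forall>n. times_differentiable n (\<lambda>x. \<phi> x - c * \<psi> x)" by simp
  ultimately show ?thesis unfolding test_function_iff by blast
qed

text \<open>An antiderivative is constant on either side of the support of \<open>\<rho>\<close>. It
  is 0 on the left by normalization and on the right because \<open>\<rho>\<close> has integral
  zero, so it has compact support again.\<close>

lemma test_function_antiderivative:
  assumes \<rho>: "test_function a b \<rho>" and zero: "(LINT x:{a<..<b}|lborel. \<rho> x) = 0" and "a < b"
  obtains \<phi> where "test_function a b \<phi>" "deriv \<phi> = \<rho>"
proof -
  have "\<exists>F. \<forall>x :: real. - \<infinity> < ereal x \<longrightarrow> ereal x < \<infinity> \<longrightarrow> (F has_vector_derivative \<rho> x) (at x)"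
    by (rule einterval_antiderivative) (auto intro: DERIV_isCont[OF test_function_has_deriv[OF \<rho>]])
  then obtain F where F: "\<And>x. (F has_field_derivative \<rho> x) (at x)"
    by (auto simp: has_real_derivative_iff_has_vector_derivative)
  define \<phi> where "\<phi> x = F x - F a" for x
  have \<phi>': "(\<phi> has_field_derivative \<rho> x) (at x)" for x
    unfolding \<phi>_def using F[of x] by (auto intro!: derivative_eq_intros)
  obtain c d where cd: "a < c" "c \<le> d" "d < b" "\<And>x. x \<notin> {c..d} \<Longrightarrow> \<rho> x = 0"
    using \<rho> unfolding test_function_def by auto
  have const: "\<phi> x = \<phi> y" if "convex S" "x \<in> S" "y \<in> S" "S \<inter> {c..d} = {}" for S x y
  proof -
    have "\<exists>k. \<forall>x\<in>S. \<phi> x = k"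
    proof (rule has_field_derivative_zero_constant[OF that(1)])
      fix x assume "x \<in> S"
      then have "\<rho> x = 0" using that(4) cd(4) by blast
      then show "(\<phi> has_field_derivative 0) (at x within S)"
        using has_field_derivative_at_within[OF \<phi>'[of x]] by simp
    qed
    then show ?thesis using that by metis
  qed
  have \<phi>a: "\<phi> a = 0" by (simp add: \<phi>_def)
  have "\<phi> b - \<phi> a = (LINT x|lborel. \<rho> x * indicator {a..b} x)"
    using \<phi>' test_function_has_deriv[OF \<rho>] assms(3)
    by (intro integral_FTC_Icc_real[symmetric]) (auto intro: DERIV_isCont)
  also have "\<dots> = (LINT x:{a<..<b}|lborel. \<rho> x)"
    unfolding set_lebesgue_integral_def
  proof (rule Bochner_Integration.integral_cong[OF refl])
    fix x show "\<rho> x * indicator {a..b} x = indicator {a<..<b} x *\<^sub>R \<rho> x"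
      using test_function_outside[OF \<rho>, of x] by (auto simp: indicator_def)
  qed
  finally have \<phi>b: "\<phi> b = 0" using zero \<phi>a by simp
  have "\<phi> x = 0" if "x \<notin> {c..d}" for x
  proof (cases "x < c")
    case True
    moreover have "{..<c} \<inter> {c..d} = {}" by auto
    ultimately show ?thesis using const[of "{..<c}" x a] cd(1) \<phi>a by (simp add: convex_real_interval)
  next
    case False
    then have "d < x" using that by auto
    moreover have "{d<..} \<inter> {c..d} = {}" by auto
    ultimately show ?thesis using const[of "{d<..}" x b] cd(3) \<phi>b by (simp add: convex_real_interval)
  qed
  moreover have "times_differentiable n \<phi>" for n
    using times_differentiable_deriv[of \<phi> \<rho>] \<phi>' \<rho>
    by (metis test_function_iff times_differentiable_SucD)
  ultimately have "test_function a b \<phi>" unfolding test_function_iff using cd by blast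
  moreover have "deriv \<phi> = \<rho>" using \<phi>' by (auto intro: DERIV_imp_deriv)
  ultimately show thesis by (rule that)
qed

text \<open>If every test function had integral zero, the fundamental lemma would make the constant
  1 vanish almost everywhere.\<close>

lemma test_function_integral_one:
  assumes "a < b"
  obtains \<eta> where "test_function a b \<eta>" "(LINT x:{a<..<b}|lborel. \<eta> x) = 1"
proof -
  have "\<exists>\<phi>. test_function a b \<phi> \<and> (LINT x:{a<..<b}|lborel. \<phi> x) \<noteq> 0"
  proof (rule ccontr)
    assume "\<not> ?thesis"
    then have "AE x in lborel. x \<in> {a<..<b} \<longrightarrow> (1::real) = 0"
      by (intro AE_zero_if_test_integrals_zero set_integrable_const_Ioo) auto
    then have "AE x in lborel. x \<notin> {a<..<b}" by simp
    then show False using not_AE_notin_Ioo[OF assms] by contradiction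
  qed
  then obtain \<phi> where \<phi>: "test_function a b \<phi>" "(LINT x:{a<..<b}|lborel. \<phi> x) \<noteq> 0" by blast
  \<comment> \<open>The normalized multiple of \<open>\<phi>\<close>, written as a difference to fit
    \<open>test_function_diff_cmult\<close>.\<close>
  let ?\<eta> = "\<lambda>x. \<phi> x - (1 - 1 / (LINT x:{a<..<b}|lborel. \<phi> x)) * \<phi> x"
  have "test_function a b ?\<eta>" by (intro test_function_diff_cmult \<phi>)
  moreover have "?\<eta> = (\<lambda>x. (1 / (LINT x:{a<..<b}|lborel. \<phi> x)) * \<phi> x)"
    by (simp add: algebra_simps)
  ultimately show thesis
    using \<phi> by (intro that[of ?\<eta>]) (auto simp: set_lebesgue_integral_def)
qed

text \<open>Du Bois-Reymond's argument: \<open>h = u - J_l2 L g\<close> is annihilated by all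
  derivatives of test functions, that is, by all test functions with integral zero. Subtracting a
  multiple of \<open>\<eta>\<close> brings any test function to that form, so \<open>h\<close> is
  the constant \<open>d\<close>, its average with weight \<open>\<eta>\<close>.\<close>

lemma weak_deriv_imp_step_plus_J:
  fixes u :: "'a::euclidean_space l2"
  assumes "0 < L" and u: "u \<in> L2_on 0 L" and weak: "has_weak_deriv 0 L 1 u g"
  shows "\<exists>d. u = step_l2 0 L d + J_l2 L g"
proof -
  obtain \<eta> where \<eta>: "test_function 0 L \<eta>" "(LINT x:{0<..<L}|lborel. \<eta> x) = 1"
    using test_function_integral_one[OF assms(1)] by blast
  define h where "h = u - J_l2 L g"
  define d where "d = (LINT x:{0<..<L}|lborel. \<eta> x *\<^sub>R rep_l2 h x)"
  have "has_weak_deriv 0 L 1 (J_l2 L g) g"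
    using has_weak_deriv_step_plus_J[OF assms(1), of 0 g] by simp
  then have h0: "(LINT x:{0<..<L}|lborel. deriv \<phi> x *\<^sub>R rep_l2 h x) = 0" if \<phi>: "test_function 0 L \<phi>" for \<phi>
  proof -
    assume J: "has_weak_deriv 0 L 1 (J_l2 L g) g"
    have [measurable]: "deriv \<phi> \<in> borel_measurable borel"
      by (rule test_function_measurable[OF test_function_deriv[OF \<phi>]])
    have "(LINT x:{0<..<L}|lborel. deriv \<phi> x *\<^sub>R rep_l2 h x)
        = (LINT x:{0<..<L}|lborel. deriv \<phi> x *\<^sub>R rep_l2 u x - deriv \<phi> x *\<^sub>R rep_l2 (J_l2 L g) x)"
      unfolding set_lebesgue_integral_def
    proof (rule integral_cong_AE)
      show "AE x in lborel. indicator {0<..<L} x *\<^sub>R deriv \<phi> x *\<^sub>R rep_l2 h x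
        = indicator {0<..<L} x *\<^sub>R (deriv \<phi> x *\<^sub>R rep_l2 u x - deriv \<phi> x *\<^sub>R rep_l2 (J_l2 L g) x)"
        using rep_l2_diff[of u "J_l2 L g"] unfolding h_def by eventually_elim (simp add: scaleR_diff_right)
    qed auto
    also have "\<dots> = (LINT x:{0<..<L}|lborel. deriv \<phi> x *\<^sub>R rep_l2 u x) - (LINT x:{0<..<L}|lborel. deriv \<phi> x *\<^sub>R rep_l2 (J_l2 L g) x)"
      by (intro set_integral_diff set_integrable_test_function[OF test_function_deriv[OF \<phi>]] set_integrable_rep_l2)
    also have "\<dots> = 0" using weak J \<phi> by (simp add: has_weak_deriv_def)
    finally show ?thesis .
  qed
  have "AE x in lborel. x \<in> {0<..<L} \<longrightarrow> rep_l2 h x - d = 0"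
  proof (rule AE_zero_if_test_integrals_zero)
    show "set_integrable lborel {0<..<L} (\<lambda>x. rep_l2 h x - d)"
      by (intro set_integral_diff set_integrable_rep_l2 set_integrable_const_Ioo)
    fix \<psi> assume \<psi>: "test_function 0 L \<psi>"
    define c where "c = (LINT x:{0<..<L}|lborel. \<psi> x)"
    define \<rho> where "\<rho> x = \<psi> x - c * \<eta> x" for x
    have \<rho>: "test_function 0 L \<rho>" unfolding \<rho>_def using \<psi> \<eta> by (intro test_function_diff_cmult)
    have int: "set_integrable lborel {0<..<L} \<psi>" "set_integrable lborel {0<..<L} \<eta>"
      using set_integrable_test_function[OF \<psi> set_integrable_const_Ioo[of 0 L "1::real"]]
        set_integrable_test_function[OF \<eta>(1) set_integrable_const_Ioo[of 0 L "1::real"]] by auto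
    have "(LINT x:{0<..<L}|lborel. \<rho> x) = 0"
      unfolding \<rho>_def using int \<eta>(2) by (simp add: set_integral_diff c_def)
    then obtain \<phi> where "test_function 0 L \<phi>" "deriv \<phi> = \<rho>"
      using test_function_antiderivative[OF \<rho> _ assms(1)] by blast
    then have "0 = (LINT x:{0<..<L}|lborel. \<rho> x *\<^sub>R rep_l2 h x)" using h0 by auto
    also have "\<dots> = (LINT x:{0<..<L}|lborel. \<psi> x *\<^sub>R rep_l2 h x - c *\<^sub>R (\<eta> x *\<^sub>R rep_l2 h x))"
      by (simp add: \<rho>_def algebra_simps)
    also have "\<dots> = (LINT x:{0<..<L}|lborel. \<psi> x *\<^sub>R rep_l2 h x) - c *\<^sub>R d"
      unfolding d_def set_integral_scaleR_right[symmetric]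
      by (intro set_integral_diff set_integrable_scaleR_right set_integrable_test_function[OF \<psi>]
          set_integrable_test_function[OF \<eta>(1)] set_integrable_rep_l2)
    also have "c *\<^sub>R d = (LINT x:{0<..<L}|lborel. \<psi> x *\<^sub>R d)"
      unfolding c_def by (intro set_integral_scaleR_left[symmetric] integrable_test_function[OF \<psi>]) simp
    finally show "(LINT x:{0<..<L}|lborel. \<psi> x *\<^sub>R (rep_l2 h x - d)) = 0"
      by (simp add: scaleR_diff_right set_integral_diff set_integrable_test_function[OF \<psi>]
          set_integrable_rep_l2 set_integrable_const_Ioo)
  qed
  moreover have "AE x in lborel. x \<notin> {0<..<L} \<longrightarrow> rep_l2 u x = 0" using u by (simp add: L2_on_def)
  ultimately have "AE x in lborel. rep_l2 u x = rep_l2 (step_l2 0 L d + J_l2 L g) x"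
    using rep_l2_diff[of u "J_l2 L g"] AE_step_plus_J[of L d g] rep_J_l2[of L g]
    unfolding h_def by eventually_elim (auto simp: indicator_def algebra_simps)
  then show ?thesis using l2_eqI by blast
qed

section \<open>Sobolev spaces as images of the primitive\<close>

lemma step_plus_J_in_L2_on: "step_l2 0 L d + J_l2 L g \<in> L2_on 0 L"
  by (intro L2_on_add step_l2_in_L2_on J_l2_in_L2_on)

lemma Sobolev_1_iff:
  assumes "0 < L"
  shows "u \<in> Sobolev 1 0 L \<longleftrightarrow> (\<exists>d. \<exists>g\<in>L2_on 0 L. u = step_l2 0 L d + J_l2 L g)"
proof
  assume "u \<in> Sobolev 1 0 L"
  then obtain g where "u \<in> L2_on 0 L" "g \<in> L2_on 0 L" "has_weak_deriv 0 L 1 u g"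
    by (auto simp: Sobolev_def)
  then show "\<exists>d. \<exists>g\<in>L2_on 0 L. u = step_l2 0 L d + J_l2 L g"
    using weak_deriv_imp_step_plus_J[OF assms] by blast
next
  assume "\<exists>d. \<exists>g\<in>L2_on 0 L. u = step_l2 0 L d + J_l2 L g"
  then obtain d g where g: "g \<in> L2_on 0 L" and u: "u = step_l2 0 L d + J_l2 L g" by blast
  have "has_weak_deriv 0 L 1 u g" unfolding u by (rule has_weak_deriv_step_plus_J[OF assms])
  then show "u \<in> Sobolev 1 0 L"
    using g step_plus_J_in_L2_on[of L d g] has_weak_deriv_zero[of 0 L u]
    by (auto simp: Sobolev_def le_Suc_eq u)
qed

lemma step_plus_J_in_Sobolev_2_iff:
  assumes "0 < L" "g \<in> L2_on 0 L"
  shows "step_l2 0 L d + J_l2 L g \<in> Sobolev 2 0 L \<longleftrightarrow> g \<in> Sobolev 1 0 L"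
proof
  let ?u = "step_l2 0 L d + J_l2 L g"
  have 1: "has_weak_deriv 0 L 1 ?u g" by (rule has_weak_deriv_step_plus_J[OF assms(1)])
  {
    assume "?u \<in> Sobolev 2 0 L"
    then obtain h where "h \<in> L2_on 0 L" "has_weak_deriv 0 L 2 ?u h"
      by (auto simp: Sobolev_def)
    then have "has_weak_deriv 0 L 1 g h" "h \<in> L2_on 0 L"
      using has_weak_deriv_deriv[OF 1] by auto
    then show "g \<in> Sobolev 1 0 L"
      using assms(2) has_weak_deriv_zero[of 0 L g] by (auto simp: Sobolev_def le_Suc_eq)
  }
  assume "g \<in> Sobolev 1 0 L"
  then obtain h where "h \<in> L2_on 0 L" "has_weak_deriv 0 L 1 g h"
    by (auto simp: Sobolev_def)
  then have "h \<in> L2_on 0 L" "has_weak_deriv 0 L 2 ?u h"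
    using has_weak_deriv_Suc[OF 1] by (auto simp: numeral_2_eq_2)
  then show "?u \<in> Sobolev 2 0 L"
    using 1 assms(2) has_weak_deriv_zero[of 0 L ?u] step_plus_J_in_L2_on[of L d g]
    by (auto simp: Sobolev_def le_Suc_eq numeral_2_eq_2)
qed

lemma weak_deriv_2_step_plus_J:
  assumes "0 < L" "f \<in> L2_on 0 L"
  shows "weak_deriv 0 L 2 (step_l2 0 L d + J_l2 L (step_l2 0 L e + J_l2 L f)) = f"
  using has_weak_deriv_Suc[OF has_weak_deriv_step_plus_J[OF assms(1)] has_weak_deriv_step_plus_J[OF assms(1)]] assms(2)
  by (intro weak_deriv_eqI) (auto simp: numeral_2_eq_2)

text \<open>Turns the bound on \<open>A1\<close>, which is stated in the Sobolev norm, into one by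
  the \<open>L\<^sub>2\<close> norm of the derivative.\<close>

lemma Sobolev_norm_1_J:
  assumes "0 < L" "g \<in> L2_on 0 L"
  shows "Sobolev_norm 1 0 L (J_l2 L g) \<le> (L + 1) * norm g"
proof -
  have "weak_deriv 0 L 0 (J_l2 L g) = J_l2 L g"
    by (intro weak_deriv_eqI has_weak_deriv_zero J_l2_in_L2_on)
  moreover have "weak_deriv 0 L 1 (J_l2 L g) = g"
    using has_weak_deriv_step_plus_J[OF assms(1), of 0 g] assms(2)
    by (intro weak_deriv_eqI) auto
  ultimately have "Sobolev_norm 1 0 L (J_l2 L g) = sqrt ((norm (J_l2 L g))\<^sup>2 + (norm g)\<^sup>2)"
    by (simp add: Sobolev_norm_def)
  also have "\<dots> \<le> norm (J_l2 L g) + norm g" by (rule sqrt_sum_squares_le_sum) auto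
  also have "\<dots> \<le> (L + 1) * norm g" using norm_J_l2_le[of L g] assms by (simp add: algebra_simps)
  finally show ?thesis .
qed

text \<open>The end points are included: every neighbourhood of them still meets the open interval
  in an interval of positive length. This is what identifies boundary values.\<close>

lemma continuous_zero_if_AE_zero:
  fixes k :: "real \<Rightarrow> 'a::real_normed_vector"
  assumes "0 < L" and k: "continuous_on {0..L} k" and AE: "AE x in lborel. x \<in> {0<..<L} \<longrightarrow> k x = 0"
    and x0: "x0 \<in> {0..L}"
  shows "k x0 = 0"
proof (rule ccontr)
  assume nz: "k x0 \<noteq> 0"
  obtain \<delta> where \<delta>: "\<delta> > 0" "\<And>x. x \<in> {0..L} \<Longrightarrow> dist x x0 < \<delta> \<Longrightarrow> dist (k x) (k x0) < norm (k x0)"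
    using k x0 nz unfolding continuous_on_iff by (metis zero_less_norm_iff)
  let ?I = "{max 0 (x0 - \<delta>)<..<min L (x0 + \<delta>)}"
  have "k x \<noteq> 0" if "x \<in> ?I" for x
  proof -
    have "dist x x0 < \<delta>" using that by (auto simp: dist_real_def abs_less_iff)
    then show ?thesis using \<delta>(2)[of x] that by (auto simp: dist_norm)
  qed
  moreover have "?I \<subseteq> {0<..<L}" by auto
  ultimately have "AE x in lborel. x \<notin> ?I"
    using AE by (auto elim!: AE_mp)
  moreover have "max 0 (x0 - \<delta>) < min L (x0 + \<delta>)" using assms(1) x0 \<delta>(1) by auto
  ultimately show False using not_AE_notin_Ioo by blast
qed

text \<open>The continuous representative of \<open>step_l2 0 L d + J_l2 L g\<close> is
  \<open>d + prim g 0\<close>, so the two boundary conditions read \<open>d = 0\<close> and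
  \<open>prim g 0 L = 0\<close>.\<close>

lemma Sobolev1_0_iff:
  assumes "0 < L"
  shows "u \<in> Sobolev1_0 0 L \<longleftrightarrow> (\<exists>g\<in>L2_on 0 L. prim g 0 L = 0 \<and> u = J_l2 L g)"
proof
  assume "u \<in> Sobolev1_0 0 L"
  then obtain f d g where f: "continuous_on {0..L} f" "AE x in lborel. x \<in> {0<..<L} \<longrightarrow> rep_l2 u x = f x"
    "f 0 = 0" "f L = 0" and g: "g \<in> L2_on 0 L" and u: "u = step_l2 0 L d + J_l2 L g"
    unfolding Sobolev1_0_def using Sobolev_1_iff[OF assms] by blast
  have "f x - (d + prim g 0 x) = 0" if "x \<in> {0..L}" for x
  proof (rule continuous_zero_if_AE_zero[OF assms _ _ that])
    show "continuous_on {0..L} (\<lambda>x. f x - (d + prim g 0 x))"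
      using f(1) continuous_on_prim[of L g] by (intro continuous_intros) auto
    show "AE x in lborel. x \<in> {0<..<L} \<longrightarrow> f x - (d + prim g 0 x) = 0"
      using f(2) AE_step_plus_J[of L d g] unfolding u by eventually_elim auto
  qed
  note eq = this
  have "d = 0" using eq[of 0] f(3) assms by simp
  moreover have "prim g 0 L = 0" using eq[of L] f(4) assms \<open>d = 0\<close> by simp
  ultimately show "\<exists>g\<in>L2_on 0 L. prim g 0 L = 0 \<and> u = J_l2 L g"
    using g u by auto
next
  assume "\<exists>g\<in>L2_on 0 L. prim g 0 L = 0 \<and> u = J_l2 L g"
  then obtain g where g: "g \<in> L2_on 0 L" "prim g 0 L = 0" and u: "u = J_l2 L g" by blast
  have "u = step_l2 0 L 0 + J_l2 L g" using u by simp
  then have "u \<in> Sobolev 1 0 L" using Sobolev_1_iff[OF assms] g by blast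
  moreover have "AE x in lborel. x \<in> {0<..<L} \<longrightarrow> rep_l2 u x = prim g 0 x"
    unfolding u using rep_J_l2[of L g] by eventually_elim auto
  ultimately show "u \<in> Sobolev1_0 0 L"
    unfolding Sobolev1_0_def using continuous_on_prim[of L g] g(2)
    by (auto intro!: exI[of _ "prim g 0"] simp: prim_same)
qed

section \<open>The difference operator as a matrix action\<close>

lemma AE_lborel_shift:
  fixes f g :: "real \<Rightarrow> 'a::euclidean_space"
  assumes [measurable]: "f \<in> borel_measurable borel" "g \<in> borel_measurable borel"
    and "AE x in lborel. f x = g x"
  shows "AE x in lborel. f (x + h) = g (x + h)"
proof -
  have "AE x in lborel. f (h + 1 * x) = g (h + 1 * x)"
    by (rule AE_borel_affine) (use assms in auto)
  then show ?thesis by (simp add: add.commute)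
qed

lemma shift_l2_add: "shift_l2 h (u + v) = shift_l2 h u + shift_l2 h v"
proof (rule l2_eqI)
  have "AE x in lborel. rep_l2 (u + v) (x + h) = rep_l2 u (x + h) + rep_l2 v (x + h)"
    using rep_l2_add[of u v] by (intro AE_lborel_shift) auto
  then show "AE x in lborel. rep_l2 (shift_l2 h (u + v)) x = rep_l2 (shift_l2 h u + shift_l2 h v) x"
    using rep_l2_shift[of h "u + v"] rep_l2_shift[of h u] rep_l2_shift[of h v]
      rep_l2_add[of "shift_l2 h u" "shift_l2 h v"] by eventually_elim simp
qed

lemma shift_l2_scale: "shift_l2 h (scale_l2 c u) = scale_l2 c (shift_l2 h u)"
proof (rule l2_eqI)
  have "AE x in lborel. rep_l2 (scale_l2 c u) (x + h) = c * rep_l2 u (x + h)"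
    using rep_l2_scale[of c u] by (intro AE_lborel_shift) auto
  then show "AE x in lborel. rep_l2 (shift_l2 h (scale_l2 c u)) x = rep_l2 (scale_l2 c (shift_l2 h u)) x"
    using rep_l2_shift[of h "scale_l2 c u"] rep_l2_shift[of h u] rep_l2_scale[of c "shift_l2 h u"]
    by eventually_elim simp
qed

lemma norm_shift_l2: "norm (shift_l2 h u) = norm u"
proof -
  have "(norm (shift_l2 h u))\<^sup>2 = (LINT x|lborel. (norm (rep_l2 u (h + 1 * x)))\<^sup>2)"
    unfolding norm_l2_sq
    by (rule integral_cong_AE) (use rep_l2_shift[of h u] in \<open>auto simp: add.commute\<close>)
  also have "\<dots> = (norm u)\<^sup>2"
    unfolding norm_l2_sq using lborel_integral_real_affine[of 1 "\<lambda>x. (norm (rep_l2 u x))\<^sup>2" h] by simp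
  finally show ?thesis by (simp add: power2_eq_iff_nonneg)
qed

lemma restrict_l2_add: "restrict_l2 a b (u + v) = restrict_l2 a b u + restrict_l2 a b v"
proof (rule l2_eqI)
  show "AE x in lborel. rep_l2 (restrict_l2 a b (u + v)) x = rep_l2 (restrict_l2 a b u + restrict_l2 a b v) x"
    using rep_l2_restrict[of a b "u + v"] rep_l2_restrict[of a b u] rep_l2_restrict[of a b v]
      rep_l2_add[of u v] rep_l2_add[of "restrict_l2 a b u" "restrict_l2 a b v"]
    by eventually_elim (simp add: scaleR_add_right)
qed

lemma restrict_l2_scale: "restrict_l2 a b (scale_l2 c u) = scale_l2 c (restrict_l2 a b u)"
proof (rule l2_eqI)
  show "AE x in lborel. rep_l2 (restrict_l2 a b (scale_l2 c u)) x = rep_l2 (scale_l2 c (restrict_l2 a b u)) x"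
    using rep_l2_restrict[of a b "scale_l2 c u"] rep_l2_restrict[of a b u]
      rep_l2_scale[of c u] rep_l2_scale[of c "restrict_l2 a b u"]
    by eventually_elim simp
qed

lemma norm_restrict_l2_le: "norm (restrict_l2 a b u) \<le> norm u"
proof -
  have "AE x in lborel. norm (rep_l2 (restrict_l2 a b u) x) \<le> 1 * norm (rep_l2 u x)"
    using rep_l2_restrict[of a b u] by eventually_elim (auto simp: indicator_def)
  from norm_l2_le_if_pointwise[OF this] show ?thesis by simp
qed

lemma restrict_l2_in_L2_on: "restrict_l2 a b u \<in> L2_on a b"
proof -
  have "AE x in lborel. x \<notin> {a<..<b} \<longrightarrow> rep_l2 (restrict_l2 a b u) x = 0"
    using rep_l2_restrict[of a b u] by eventually_elim (auto simp: indicator_def)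
  then show ?thesis by (simp add: L2_on_def)
qed

lemma scale_l2_scaleR: "scale_l2 c (r *\<^sub>R u) = r *\<^sub>R scale_l2 c u"
proof (rule l2_eqI)
  show "AE x in lborel. rep_l2 (scale_l2 c (r *\<^sub>R u)) x = rep_l2 (r *\<^sub>R scale_l2 c u) x"
    using rep_l2_scale[of c "r *\<^sub>R u"] rep_l2_scale[of c u] rep_l2_scaleR[of r u] rep_l2_scaleR[of r "scale_l2 c u"]
    by eventually_elim simp
qed

text \<open>
  Functions on \<open>(0,K)\<close> are identified with \<open>K\<close>-tuples of functions on \<open>(0,1)\<close>, on which a
  \<open>K \<times> K\<close> matrix \<open>C\<close> acts.
\<close>

definition matrix_l2 :: "nat \<Rightarrow> (nat \<Rightarrow> nat \<Rightarrow> real) \<Rightarrow> 'a::euclidean_space l2 \<Rightarrow> 'a l2" where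
  "matrix_l2 K C v =
     (\<Sum>i<K. \<Sum>k<K. C i k *\<^sub>R restrict_l2 (real i) (real i + 1) (shift_l2 (real k - real i) v))"

text \<open>The same action on representatives. The unit cells are disjoint, so at each point at
  most one index \<open>i\<close> contributes.\<close>

definition matrix_fun :: "nat \<Rightarrow> (nat \<Rightarrow> nat \<Rightarrow> real) \<Rightarrow> (real \<Rightarrow> 'a::real_vector) \<Rightarrow> real \<Rightarrow> 'a" where
  "matrix_fun K C f x =
     (\<Sum>i<K. \<Sum>k<K. C i k *\<^sub>R indicator {real i<..<real i + 1} x *\<^sub>R f (x + (real k - real i)))"

lemma measurable_matrix_fun [measurable]:
  fixes f :: "real \<Rightarrow> 'a::euclidean_space"
  assumes [measurable]: "f \<in> borel_measurable borel"
  shows "matrix_fun K C f \<in> borel_measurable borel"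
  unfolding matrix_fun_def by measurable

lemma rep_matrix_l2: "AE x in lborel. rep_l2 (matrix_l2 K C v) x = matrix_fun K C (rep_l2 v) x"
proof -
  let ?w = "\<lambda>i k. restrict_l2 (real i) (real i + 1) (shift_l2 (real k - real i) v)"
  have "AE x in lborel. \<forall>i k. rep_l2 (C i k *\<^sub>R ?w i k) x
      = C i k *\<^sub>R indicator {real i<..<real i + 1} x *\<^sub>R rep_l2 v (x + (real k - real i))"
    unfolding AE_all_countable
  proof (intro allI)
    fix i k
    show "AE x in lborel. rep_l2 (C i k *\<^sub>R ?w i k) x
      = C i k *\<^sub>R indicator {real i<..<real i + 1} x *\<^sub>R rep_l2 v (x + (real k - real i))"
      using rep_l2_scaleR[of "C i k" "?w i k"] rep_l2_shift[of "real k - real i" v]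
        rep_l2_restrict[of "real i" "real i + 1" "shift_l2 (real k - real i) v"]
      by eventually_elim simp
  qed
  moreover have "AE x in lborel. \<forall>i. rep_l2 (\<Sum>k<K. C i k *\<^sub>R ?w i k) x = (\<Sum>k<K. rep_l2 (C i k *\<^sub>R ?w i k) x)"
    unfolding AE_all_countable by (intro allI rep_l2_sum) simp
  moreover have "AE x in lborel. rep_l2 (matrix_l2 K C v) x = (\<Sum>i<K. rep_l2 (\<Sum>k<K. C i k *\<^sub>R ?w i k) x)"
    unfolding matrix_l2_def by (rule rep_l2_sum) simp
  ultimately show ?thesis
    by eventually_elim (simp add: matrix_fun_def)
qed

lemma matrix_fun_eq:
  assumes "i < K" "real i < x" "x < real i + 1"
  shows "matrix_fun K C f x = (\<Sum>k<K. C i k *\<^sub>R f (x + (real k - real i)))"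
proof -
  have "(\<Sum>k<K. C j k *\<^sub>R indicator {real j<..<real j + 1} x *\<^sub>R f (x + (real k - real j)))
      = (if j = i then \<Sum>k<K. C i k *\<^sub>R f (x + (real k - real i)) else 0)" for j
  proof (cases "j = i")
    case True
    then show ?thesis using assms by simp
  next
    case False
    then have "x \<notin> {real j<..<real j + 1}"
      using assms by (metis add.commute greaterThanLessThan_iff less_Suc_eq not_less_eq of_nat_Suc of_nat_less_iff order.strict_trans)
    then show ?thesis using False by simp
  qed
  then show ?thesis unfolding matrix_fun_def using assms(1) by simp
qed

lemma matrix_fun_outside:
  assumes "x \<notin> {0<..<real K}"
  shows "matrix_fun K C f x = 0"
proof -
  have "x \<notin> {real i<..<real i + 1}" if "i < K" for i
  proof -
    have "real i + 1 \<le> real K" using that by linarith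
    then show ?thesis using assms by auto
  qed
  then show ?thesis unfolding matrix_fun_def by (intro sum.neutral ballI) simp
qed

lemma unit_interval_cases:
  assumes "x \<in> {0<..<real K}" "\<And>i::nat. x \<noteq> real i"
  obtains i where "i < K" "real i < x" "x < real i + 1"
proof
  define i where "i = nat \<lfloor>x\<rfloor>"
  have "real i = of_int \<lfloor>x\<rfloor>" using assms(1) by (simp add: i_def)
  then have "real i \<le> x" "x < real i + 1" by linarith+
  then show "real i < x" "x < real i + 1" using assms(2)[of i] by auto
  then show "i < K" using assms(1) by (metis greaterThanLessThan_iff of_nat_less_iff order.strict_trans)
qed

text \<open>A point of cell \<open>i\<close> shifted by \<open>k - i\<close> lies in cell
  \<open>k\<close>, so successive actions combine as a matrix product.\<close>

lemma matrix_fun_compose: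
  assumes "\<And>i l. i < K \<Longrightarrow> l < K \<Longrightarrow> (\<Sum>k<K. C i k * D k l) = M i l"
    and "\<And>i::nat. x \<noteq> real i"
  shows "matrix_fun K C (matrix_fun K D f) x = matrix_fun K M f x"
proof (cases "x \<in> {0<..<real K}")
  case True
  then obtain i where i: "i < K" "real i < x" "x < real i + 1"
    using unit_interval_cases assms(2) by metis
  have "matrix_fun K C (matrix_fun K D f) x = (\<Sum>k<K. C i k *\<^sub>R matrix_fun K D f (x + (real k - real i)))"
    by (rule matrix_fun_eq[OF i])
  also have "\<dots> = (\<Sum>k<K. C i k *\<^sub>R (\<Sum>l<K. D k l *\<^sub>R f (x + (real l - real i))))"
  proof (intro sum.cong refl arg_cong[where f = "scaleR _"])
    fix k assume "k \<in> {..<K}"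
    then have "matrix_fun K D f (x + (real k - real i)) = (\<Sum>l<K. D k l *\<^sub>R f (x + (real k - real i) + (real l - real k)))"
      using i by (intro matrix_fun_eq) auto
    then show "matrix_fun K D f (x + (real k - real i)) = (\<Sum>l<K. D k l *\<^sub>R f (x + (real l - real i)))"
      by (simp add: algebra_simps)
  qed
  also have "\<dots> = (\<Sum>k<K. \<Sum>l<K. (C i k * D k l) *\<^sub>R f (x + (real l - real i)))"
    by (simp add: scaleR_sum_right)
  also have "\<dots> = (\<Sum>l<K. (\<Sum>k<K. C i k * D k l) *\<^sub>R f (x + (real l - real i)))"
    by (subst sum.swap) (simp add: scaleR_sum_left)
  also have "\<dots> = (\<Sum>l<K. M i l *\<^sub>R f (x + (real l - real i)))"
    using assms(1) i by (intro sum.cong) auto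
  also have "\<dots> = matrix_fun K M f x" by (rule matrix_fun_eq[OF i, symmetric])
  finally show ?thesis .
qed (simp add: matrix_fun_outside)

lemma AE_not_nat: "AE x in lborel. \<forall>i::nat. x \<noteq> real i"
  unfolding AE_all_countable using AE_lborel_singleton by blast

lemma matrix_l2_compose:
  assumes "\<And>i l. i < K \<Longrightarrow> l < K \<Longrightarrow> (\<Sum>k<K. C i k * D k l) = M i l"
  shows "matrix_l2 K C (matrix_l2 K D v) = matrix_l2 K M v"
proof (rule l2_eqI)
  have "AE x in lborel. \<forall>i k::nat. rep_l2 (matrix_l2 K D v) (x + (real k - real i))
      = matrix_fun K D (rep_l2 v) (x + (real k - real i))"
    unfolding AE_all_countable
    by (intro allI AE_lborel_shift rep_matrix_l2) auto
  then show "AE x in lborel. rep_l2 (matrix_l2 K C (matrix_l2 K D v)) x = rep_l2 (matrix_l2 K M v) x"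
    using rep_matrix_l2[of K C "matrix_l2 K D v"] rep_matrix_l2[of K M v] AE_not_nat
  proof eventually_elim
    case (elim x)
    have "matrix_fun K C (rep_l2 (matrix_l2 K D v)) x = matrix_fun K C (matrix_fun K D (rep_l2 v)) x"
      unfolding matrix_fun_def[of K C] using elim(1) by simp
    then show ?case using elim matrix_fun_compose[OF assms, where x = x and f = "rep_l2 v"] by simp
  qed
qed

lemma matrix_l2_id:
  assumes v: "v \<in> L2_on 0 (real K)" and M: "\<And>i l. i < K \<Longrightarrow> l < K \<Longrightarrow> M i l = (if i = l then 1 else 0)"
  shows "matrix_l2 K M v = v"
proof (rule l2_eqI)
  have "AE x in lborel. x \<notin> {0<..<real K} \<longrightarrow> rep_l2 v x = 0" using v by (simp add: L2_on_def)
  then show "AE x in lborel. rep_l2 (matrix_l2 K M v) x = rep_l2 v x"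
    using rep_matrix_l2[of K M v] AE_not_nat
  proof eventually_elim
    case (elim x)
    show ?case
    proof (cases "x \<in> {0<..<real K}")
      case True
      then obtain i where i: "i < K" "real i < x" "x < real i + 1"
        using unit_interval_cases elim(3) by metis
      have "matrix_fun K M (rep_l2 v) x = (\<Sum>k<K. if k = i then rep_l2 v x else 0)"
        unfolding matrix_fun_eq[OF i] using M i(1) by (intro sum.cong) auto
      then show ?thesis using elim(2) i(1) by simp
    next
      case False
      then show ?thesis using elim(1,2) matrix_fun_outside[OF False, of M "rep_l2 v"] by simp
    qed
  qed
qed

lemma matrix_l2_in_L2_on: "matrix_l2 K C v \<in> L2_on 0 (real K)"
proof -
  have "AE x in lborel. x \<notin> {0<..<real K} \<longrightarrow> rep_l2 (matrix_l2 K C v) x = 0"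
    using rep_matrix_l2[of K C v] by eventually_elim (auto simp: matrix_fun_outside)
  then show ?thesis by (simp add: L2_on_def)
qed

lemma norm_matrix_l2_le: "norm (matrix_l2 K C v) \<le> (\<Sum>i<K. \<Sum>k<K. \<bar>C i k\<bar>) * norm v"
proof -
  have "norm (matrix_l2 K C v) \<le> (\<Sum>i<K. \<Sum>k<K. \<bar>C i k\<bar> * norm v)"
    unfolding matrix_l2_def
  proof (intro sum_norm_le)
    fix i k
    show "norm (C i k *\<^sub>R restrict_l2 (real i) (real i + 1) (shift_l2 (real k - real i) v)) \<le> \<bar>C i k\<bar> * norm v"
      using norm_restrict_l2_le[of "real i" "real i + 1" "shift_l2 (real k - real i) v"]
      by (simp add: norm_shift_l2 mult_left_mono)
  qed
  then show ?thesis by (simp add: sum_distrib_right)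
qed

lemma linear_matrix_l2:
  "Vector_Spaces.linear scale_l2 scale_l2 (matrix_l2 K C :: 'a::{euclidean_space,real_normed_field} l2 \<Rightarrow> _)"
proof -
  interpret vector_space "scale_l2 :: 'a \<Rightarrow> _" by (rule vector_space_scale_l2)
  show ?thesis
    by unfold_locales
      (simp_all add: matrix_l2_def shift_l2_add restrict_l2_add scaleR_add_right sum.distrib
        shift_l2_scale restrict_l2_scale scale_l2_scaleR scale_sum_right)
qed

section \<open>The difference operator and its inverse\<close>

lemma rep_diff_op: "AE x in lborel. rep_l2 (diff_op N b v) x = (\<Sum>j\<in>{- int N..int N}. b j *\<^sub>R rep_l2 v (x + of_int j))"
proof -
  have "AE x in lborel. \<forall>j. rep_l2 (b j *\<^sub>R shift_l2 (of_int j) v) x = b j *\<^sub>R rep_l2 v (x + of_int j)"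
    unfolding AE_all_countable
  proof
    fix j
    show "AE x in lborel. rep_l2 (b j *\<^sub>R shift_l2 (of_int j) v) x = b j *\<^sub>R rep_l2 v (x + of_int j)"
      using rep_l2_scaleR[of "b j" "shift_l2 (of_int j) v"] rep_l2_shift[of "of_int j" v]
      by eventually_elim simp
  qed
  moreover have "AE x in lborel. rep_l2 (diff_op N b v) x = (\<Sum>j\<in>{- int N..int N}. rep_l2 (b j *\<^sub>R shift_l2 (of_int j) v) x)"
    unfolding diff_op_def by (rule rep_l2_sum) simp
  ultimately show ?thesis by eventually_elim simp
qed

text \<open>From a point of cell \<open>i\<close>, the shifts by \<open>j\<close> that stay inside
  the interval are those with \<open>- i \<le> j \<le> N - i\<close>, and \<open>k = i + j\<close>
  numbers the cells reached. This is the origin of the Toeplitz entries.\<close>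

lemma diff_op_Q_eq_matrix_l2:
  assumes v: "v \<in> L2_on 0 (real N + 1)"
  shows "diff_op_Q N b v = matrix_l2 (Suc N) (\<lambda>i k. b (int k - int i)) v"
proof (rule l2_eqI)
  have K: "real (Suc N) = real N + 1" by simp
  have "AE x in lborel. rep_l2 v x = indicator {0<..<real N + 1} x *\<^sub>R rep_l2 v x"
    using v unfolding L2_on_def mem_Collect_eq by eventually_elim (auto simp: indicator_def)
  then have "AE x in lborel. \<forall>j::int. rep_l2 v (x + of_int j)
      = indicator {0<..<real N + 1} (x + of_int j) *\<^sub>R rep_l2 v (x + of_int j)"
    unfolding AE_all_countable by (intro allI AE_lborel_shift) auto
  then show "AE x in lborel. rep_l2 (diff_op_Q N b v) x = rep_l2 (matrix_l2 (Suc N) (\<lambda>i k. b (int k - int i)) v) x"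
    using rep_l2_restrict[of 0 "real N + 1" "diff_op N b v"] rep_diff_op[of N b v]
      rep_matrix_l2[of "Suc N" "\<lambda>i k. b (int k - int i)" v] AE_not_nat
    unfolding diff_op_Q_def
  proof eventually_elim
    case (elim x)
    show ?case
    proof (cases "x \<in> {0<..<real N + 1}")
      case True
      then obtain i where i: "i < Suc N" "real i < x" "x < real i + 1"
        using unit_interval_cases[of x "Suc N"] elim(5) K by metis
      have out: "rep_l2 v (x + of_int j) = 0" if "j \<notin> {- int i..int N - int i}" for j
      proof -
        have "j \<le> - int i - 1 \<or> int N - int i + 1 \<le> j" using that by auto
        then have "real_of_int j \<le> - real i - 1 \<or> real N - real i + 1 \<le> real_of_int j" by linarith
        then have "x + real_of_int j \<notin> {0<..<real N + 1}" using i by auto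
        then show ?thesis using elim(1)[rule_format, of j] by simp
      qed
      have "(\<Sum>j\<in>{- int N..int N}. b j *\<^sub>R rep_l2 v (x + of_int j))
          = (\<Sum>j\<in>{- int i..int N - int i}. b j *\<^sub>R rep_l2 v (x + of_int j))"
        using i(1) out by (intro sum.mono_neutral_right) auto
      also have "\<dots> = (\<Sum>k<Suc N. b (int k - int i) *\<^sub>R rep_l2 v (x + of_int (int k - int i)))"
        by (rule sum.reindex_bij_witness[of _ "\<lambda>k. int k - int i" "\<lambda>j. nat (j + int i)"]) auto
      also have "\<dots> = matrix_fun (Suc N) (\<lambda>i k. b (int k - int i)) (rep_l2 v) x"
        unfolding matrix_fun_eq[OF i] by simp
      finally show ?thesis using elim(2-4) True by simp
    next
      case False
      then show ?thesis
        using elim(2,4) matrix_fun_outside[of x "Suc N" "\<lambda>i k. b (int k - int i)" "rep_l2 v", unfolded K] by simp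
    qed
  qed
qed

lemma matrix_l2_inverse_if_det_nonzero:
  assumes "Determinant.det (R1_mat N b) \<noteq> 0"
  obtains C where
    "\<And>v :: 'a::euclidean_space l2. v \<in> L2_on 0 (real N + 1) \<Longrightarrow> matrix_l2 (Suc N) C (diff_op_Q N b v) = v"
    "\<And>v :: 'a l2. v \<in> L2_on 0 (real N + 1) \<Longrightarrow> diff_op_Q N b (matrix_l2 (Suc N) C v) = v"
proof -
  let ?A = "R1_mat N b"
  have A: "?A \<in> carrier_mat (Suc N) (Suc N)" by (simp add: R1_mat_def)
  obtain B where B: "B \<in> carrier_mat (Suc N) (Suc N)" "B * ?A = 1\<^sub>m (Suc N)" "?A * B = 1\<^sub>m (Suc N)"
    using det_non_zero_imp_unit[OF A assms] unfolding Units_def ring_mat_def by auto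
  define C where "C i k = B $$ (i, k)" for i k
  have BA: "(\<Sum>k<Suc N. C i k * b (int l - int k)) = (if i = l then 1 else 0)" if "i < Suc N" "l < Suc N" for i l
  proof -
    have "(B * ?A) $$ (i, l) = (\<Sum>k<Suc N. C i k * b (int l - int k))"
      using that A B(1) by (simp add: scalar_prod_def C_def R1_mat_def atLeast0LessThan del: sum.lessThan_Suc)
    then show ?thesis using B(2,3) that by simp
  qed
  have AB: "(\<Sum>k<Suc N. b (int k - int i) * C k l) = (if i = l then 1 else 0)" if "i < Suc N" "l < Suc N" for i l
  proof -
    have "(?A * B) $$ (i, l) = (\<Sum>k<Suc N. b (int k - int i) * C k l)"
      using that A B(1) by (simp add: scalar_prod_def C_def R1_mat_def atLeast0LessThan del: sum.lessThan_Suc)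
    then show ?thesis using B(2,3) that by simp
  qed
  have K: "real (Suc N) = real N + 1" by simp
  show thesis
  proof (rule that)
    fix v :: "'a l2" assume v: "v \<in> L2_on 0 (real N + 1)"
    show "matrix_l2 (Suc N) C (diff_op_Q N b v) = v"
      unfolding diff_op_Q_eq_matrix_l2[OF v]
      using matrix_l2_compose[of "Suc N" C "\<lambda>i k. b (int k - int i)" "\<lambda>i l. if i = l then 1 else 0" v] BA
        matrix_l2_id[of v "Suc N" "\<lambda>i l. if i = l then 1 else 0", unfolded K] v by simp
    have "matrix_l2 (Suc N) C v \<in> L2_on 0 (real N + 1)"
      using matrix_l2_in_L2_on[of "Suc N" C v] unfolding K .
    then show "diff_op_Q N b (matrix_l2 (Suc N) C v) = v"
      using matrix_l2_compose[of "Suc N" "\<lambda>i k. b (int k - int i)" C "\<lambda>i l. if i = l then 1 else 0" v] AB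
        matrix_l2_id[of v "Suc N" "\<lambda>i l. if i = l then 1 else 0", unfolded K] v
      by (simp add: diff_op_Q_eq_matrix_l2)
  qed
qed

section \<open>The difference operator and primitives\<close>

lemma prim_outside:
  assumes "g \<in> L2_on 0 L" "b \<le> 0 \<or> L \<le> a"
  shows "prim g a b = 0"
proof -
  have "prim g a b = (LINT t:{a<..<b}|lborel. 0)"
  proof (rule prim_cong_AE)
    show "AE x in lborel. x \<in> {a<..<b} \<longrightarrow> rep_l2 g x = 0"
      using assms(1) unfolding L2_on_def mem_Collect_eq
      by eventually_elim (use assms(2) in auto)
  qed simp
  then show ?thesis by (simp add: set_lebesgue_integral_def)
qed

lemma prim_empty: "b \<le> a \<Longrightarrow> prim u a b = 0"
  by (simp add: prim_def set_lebesgue_integral_def)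

text \<open>For negative \<open>j\<close> the term \<open>prim g 0 j\<close> is 0 by the convention
  on empty intervals, and \<open>prim g j y\<close> gains nothing because \<open>g\<close> vanishes
  to the left of 0.\<close>

lemma prim_split_outside:
  assumes g: "g \<in> L2_on 0 L" and "j \<le> y"
  shows "prim g 0 y = prim g 0 j + prim g j y"
proof (cases "0 \<le> j")
  case True
  then show ?thesis using assms(2) by (intro prim_split)
next
  case j: False
  then have "prim g 0 j = 0" by (intro prim_empty) simp
  moreover have "prim g j y = prim g 0 y"
  proof (cases "0 \<le> y")
    case True
    then show ?thesis using prim_split[of j 0 y g] j prim_outside[OF g, of 0 j] by simp
  next
    case False
    then show ?thesis using prim_empty[of y 0 g] prim_outside[OF g, of y j] by simp
  qed
  ultimately show ?thesis by simp
qed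

text \<open>
  The primitive of a function with mean zero, extended by zero, is still a primitive; hence
  \<open>R\<^sub>Q\<close> commutes with taking derivatives on functions with zero boundary values.
\<close>

lemma diff_op_Q_J:
  fixes g :: "'a::euclidean_space l2"
  assumes g: "g \<in> L2_on 0 (real N + 1)" and mean: "prim g 0 (real N + 1) = 0"
  shows "diff_op_Q N b (J_l2 (real N + 1) g) =
    step_l2 0 (real N + 1) (\<Sum>j\<in>{- int N..int N}. b j *\<^sub>R prim g 0 (of_int j)) + J_l2 (real N + 1) (diff_op_Q N b g)"
proof (rule l2_eqI)
  let ?L = "real N + 1"
  \<comment> \<open>The primitive at \<open>x + j\<close> is its value at \<open>j\<close> plus the
    integral from \<open>j\<close> to \<open>x + j\<close>; the constant collects the values at the
    integers \<open>j\<close>.\<close>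
  let ?c = "\<Sum>j\<in>{- int N..int N}. b j *\<^sub>R prim g 0 (of_int j)"
  have ext: "indicator {0<..<?L} y *\<^sub>R prim g 0 y = prim g 0 y" for y
  proof -
    consider "y \<le> 0" | "0 < y" "y < ?L" | "?L \<le> y" by linarith
    then show ?thesis
    proof cases
      case 3
      then show ?thesis using prim_split[of 0 ?L y g] mean prim_outside[OF g, of y ?L] by simp
    qed (simp_all add: prim_empty)
  qed
  have m: "(\<lambda>x. indicator {0<..<?L} x *\<^sub>R prim g 0 x) \<in> borel_measurable borel" by (rule measurable_prim)
  have "AE x in lborel. rep_l2 (J_l2 ?L g) x = prim g 0 x"
    using rep_J_l2[of ?L g] unfolding ext .
  then have "AE x in lborel. \<forall>j::int. rep_l2 (J_l2 ?L g) (x + of_int j) = prim g 0 (x + of_int j)"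
    unfolding AE_all_countable using m[unfolded ext] by (intro allI AE_lborel_shift) auto
  then show "AE x in lborel. rep_l2 (diff_op_Q N b (J_l2 ?L g)) x = rep_l2 (step_l2 0 ?L ?c + J_l2 ?L (diff_op_Q N b g)) x"
    using AE_step_plus_J[of ?L ?c "diff_op_Q N b g"] rep_l2_restrict[of 0 ?L "diff_op N b (J_l2 ?L g)"]
      rep_diff_op[of N b "J_l2 ?L g"]
    unfolding diff_op_Q_def[of N b "J_l2 ?L g"]
  proof eventually_elim
    case (elim x)
    show ?case
    proof (cases "x \<in> {0<..<?L}")
      case True
      have "prim (diff_op_Q N b g) 0 x = prim (diff_op N b g) 0 x"
        unfolding prim_def[of "diff_op N b g"]
      proof (rule prim_cong_AE)
        show "AE t in lborel. t \<in> {0<..<x} \<longrightarrow> rep_l2 (diff_op_Q N b g) t = rep_l2 (diff_op N b g) t"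
          unfolding diff_op_Q_def using rep_l2_restrict[of 0 ?L "diff_op N b g"]
          by eventually_elim (use True in auto)
      qed simp
      also have "\<dots> = (\<Sum>j\<in>{- int N..int N}. b j *\<^sub>R prim g (of_int j) (x + of_int j))"
        unfolding diff_op_def by (simp add: prim_sum prim_scaleR prim_shift)
      finally have "?c + prim (diff_op_Q N b g) 0 x
          = (\<Sum>j\<in>{- int N..int N}. b j *\<^sub>R (prim g 0 (of_int j) + prim g (of_int j) (x + of_int j)))"
        by (simp add: sum.distrib scaleR_add_right)
      also have "\<dots> = (\<Sum>j\<in>{- int N..int N}. b j *\<^sub>R prim g 0 (x + of_int j))"
        using True by (intro sum.cong refl arg_cong[where f = "scaleR _"] prim_split_outside[OF g, symmetric]) auto
      finally show ?thesis using elim True by simp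
    qed (use elim in simp)
  qed
qed

lemma prim_step_l2:
  "prim (step_l2 c d k) a b = max 0 (min b d - max a c) *\<^sub>R k"
proof -
  have "prim (step_l2 c d k) a b = (LINT t:{a<..<b}|lborel. indicator {c<..<d} t *\<^sub>R k)"
    using rep_step_l2[of c d k] by (intro prim_cong_AE) auto
  also have "\<dots> = (LINT t|lborel. indicator {max a c<..<min b d} t *\<^sub>R k)"
    unfolding set_lebesgue_integral_def
    by (rule Bochner_Integration.integral_cong) (auto simp: indicator_def)
  also have "\<dots> = measure lborel {max a c<..<min b d} *\<^sub>R k"
    by (subst integral_scaleR_left) (auto intro: integrable_indicator_Ioo)
  also have "measure lborel {max a c<..<min b d} = max 0 (min b d - max a c)"
    by (cases "max a c \<le> min b d") auto
  finally show ?thesis .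
qed

text \<open>\<open>p\<close> is the derivative of a tent over the unit interval. Its primitive
  vanishes at every integer, which removes the constant in \<open>diff_op_Q_J\<close>, and is
  positive strictly between 0 and 1, which makes its integral non-zero.\<close>

lemma tent_function_exists:
  assumes "1 \<le> L"
  obtains p :: "'a::{euclidean_space,real_normed_field} l2"
  where "p \<in> L2_on 0 L" "\<And>j::int. prim p 0 (of_int j) = 0" "prim p 0 L = 0"
    "prim (J_l2 L p) 0 L \<noteq> 0"
proof
  define p :: "'a l2" where "p = step_l2 0 (1/2) 1 + (-1) *\<^sub>R step_l2 (1/2) 1 1"
  define t :: "real \<Rightarrow> real" where "t x = max 0 (min x (1/2)) - max 0 (min x 1 - 1/2)" for x
  have pt: "prim p 0 x = t x *\<^sub>R 1" for x
    unfolding p_def prim_add prim_scaleR prim_step_l2 t_def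
    by (simp add: scaleR_diff_left)
  have t_meas: "t \<in> borel_measurable borel" unfolding t_def[abs_def] by measurable
  have t0: "t x = 0" if "x \<le> 0 \<or> 1 \<le> x" for x using that by (auto simp: t_def)
  have tpos: "t x > 0" if "0 < x" "x < 1" for x using that by (auto simp: t_def min_def max_def)
  have tnn: "t x \<ge> 0" for x using t0[of x] tpos[of x] by linarith
  have "AE x in lborel. x \<notin> {0<..<L} \<longrightarrow> rep_l2 p x = 0"
    using rep_l2_add[of "step_l2 0 (1/2) (1::'a)" "(-1) *\<^sub>R step_l2 (1/2) 1 1"]
      rep_l2_scaleR[of "-1" "step_l2 (1/2) 1 (1::'a)"]
      rep_step_l2[of 0 "1/2" "1::'a"] rep_step_l2[of "1/2" 1 "1::'a"]
    unfolding p_def by eventually_elim (use assms in \<open>auto simp: indicator_def\<close>)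
  then show "p \<in> L2_on 0 L" by (simp add: L2_on_def)
  show "prim p 0 (of_int j) = 0" for j :: int
  proof -
    have "real_of_int j \<le> 0 \<or> 1 \<le> real_of_int j" by (cases "j \<le> 0") auto
    then show ?thesis by (simp add: pt t0)
  qed
  show "prim p 0 L = 0" using assms by (simp add: pt t0)
  have eq: "prim (J_l2 L p) 0 L = (LINT x:{0<..<L}|lborel. t x *\<^sub>R 1)"
  proof (rule prim_cong_AE)
    show "AE x in lborel. x \<in> {0<..<L} \<longrightarrow> rep_l2 (J_l2 L p) x = t x *\<^sub>R 1"
      using rep_J_l2[of L p] by eventually_elim (simp add: pt)
    show "(\<lambda>x. t x *\<^sub>R (1::'a)) \<in> borel_measurable borel"
      using t_meas by measurable
  qed
  have int: "integrable lborel (\<lambda>x. indicator {0<..<L} x * t x)"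
  proof (rule Bochner_Integration.integrable_bound)
    show "integrable lborel (indicator {0<..<L} :: real \<Rightarrow> real)" by (rule integrable_indicator_Ioo)
    show "AE x in lborel. norm (indicator {0<..<L} x * t x) \<le> norm (indicator {0<..<L} x :: real)"
      by (auto simp: indicator_def t_def min_def max_def)
  qed (use t_meas in measurable)
  have eq: "prim (J_l2 L p) 0 L = (LINT x|lborel. indicator {0<..<L} x * t x) *\<^sub>R 1"
    unfolding eq set_lebesgue_integral_def scaleR_scaleR by (rule integral_scaleR_left) (rule int)
  show "prim (J_l2 L p) 0 L \<noteq> 0"
  proof
    assume "prim (J_l2 L p) 0 L = 0"
    then have "(LINT x|lborel. indicator {0<..<L} x * t x) = 0" by (simp add: eq)
    then have "AE x in lborel. indicator {0<..<L} x * t x = 0"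
      by (subst (asm) integral_nonneg_eq_0_iff_AE[OF int]) (auto simp: tnn)
    then have "AE x in lborel. x \<notin> {0<..<1::real}"
    proof eventually_elim
      case (elim x)
      then show ?case using tpos[of x] assms by (auto simp: indicator_def split: if_splits)
    qed
    then show False using not_AE_notin_Ioo[of 0 1] by simp
  qed
qed

section \<open>The Fredholm property\<close>

lemma vector_space_mult: "vector_space ((*) :: 'f::field \<Rightarrow> _)"
  by unfold_locales (simp_all add: algebra_simps)

context
  fixes s :: "'a::{euclidean_space,real_normed_field} \<Rightarrow> 'a l2 \<Rightarrow> 'a l2"
  defines "s \<equiv> scale_l2"
begin

interpretation vector_space s
  unfolding s_def by (rule vector_space_scale_l2)

lemma bounded_linear_over_scale_l2:
  assumes "bounded_linear_over s (*) \<phi>"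
  shows "bounded_linear_over s s (\<lambda>u. s (\<phi> u) w)"
proof -
  interpret m: vector_space "(*) :: 'a \<Rightarrow> _" by (rule vector_space_mult)
  have "Vector_Spaces.linear (*) s (\<lambda>c. s c w)"
    by unfold_locales (simp_all add: scale_left_distrib)
  then have "bounded_linear_over (*) s (\<lambda>c. s c w)"
    by (rule bounded_linear_overI[where K = "norm w"]) (simp add: s_def norm_scale_l2 mult.commute)
  with assms show ?thesis by (rule bounded_linear_over_compose)
qed

lemma bounded_linear_over_mult:
  assumes "bounded_linear_over s (*) \<phi>"
  shows "bounded_linear_over s (*) (\<lambda>u. (c::'a) * \<phi> u)"
proof -
  interpret m: vector_space "(*) :: 'a \<Rightarrow> _" by (rule vector_space_mult)
  have "Vector_Spaces.linear (*) (*) (\<lambda>d. c * d)"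
    by unfold_locales (simp_all add: algebra_simps)
  then have "bounded_linear_over (*) (*) (\<lambda>d. c * d)"
    by (rule bounded_linear_overI[where K = "norm c"]) (simp add: norm_mult)
  with assms show ?thesis by (rule bounded_linear_over_compose)
qed

lemma bounded_linear_over_id: "bounded_linear_over s s (\<lambda>u. u)"
proof (rule bounded_linear_overI)
  show "Vector_Spaces.linear s s (\<lambda>u. u)" by unfold_locales simp_all
qed (rule eq_refl[OF mult_1[symmetric]])

lemma bounded_linear_over_J_l2:
  assumes "0 \<le> L"
  shows "bounded_linear_over s s (J_l2 L)"
proof (rule bounded_linear_overI)
  show "Vector_Spaces.linear s s (J_l2 L)"
    by unfold_locales (simp_all add: s_def J_l2_add J_l2_scale)
qed (rule norm_J_l2_le[OF assms])

lemma bounded_linear_over_matrix_l2: "bounded_linear_over s s (matrix_l2 K C)"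
  unfolding s_def by (rule bounded_linear_overI[OF linear_matrix_l2 norm_matrix_l2_le])

lemma bounded_linear_over_restrict_l2: "bounded_linear_over s s (restrict_l2 a b)"
proof (rule bounded_linear_overI)
  show "Vector_Spaces.linear s s (restrict_l2 a b)"
    by unfold_locales (simp_all add: s_def restrict_l2_add restrict_l2_scale)
  show "norm (restrict_l2 a b u) \<le> 1 * norm u" for u :: "'a l2"
    using norm_restrict_l2_le[of a b u] by simp
qed

lemma bounded_linear_over_prim:
  assumes "a \<le> b"
  shows "bounded_linear_over s (*) (\<lambda>u. prim u a b)"
proof (rule bounded_linear_overI)
  interpret m: vector_space "(*) :: 'a \<Rightarrow> _" by (rule vector_space_mult)
  show "Vector_Spaces.linear s (*) (\<lambda>u. prim u a b)"
    by unfold_locales (simp_all add: s_def prim_add prim_scale)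
qed (rule norm_prim_le[OF assms])

lemma subspace_L2_on: "subspace (L2_on a b)"
  unfolding subspace_def by (auto simp: s_def L2_on_zero L2_on_add L2_on_scale)

text \<open>\<open>L2_on a b\<close> is the fixed set of the bounded restriction operator.\<close>

lemma closed_L2_on: "closed (L2_on a b :: 'a l2 set)"
  unfolding closed_sequential_limits
proof (intro allI impI, elim conjE)
  fix x and l :: "'a l2" assume x: "\<forall>n. x n \<in> L2_on a b" and l: "x \<longlonglongrightarrow> l"
  have "(\<lambda>n. restrict_l2 a b (x n)) \<longlonglongrightarrow> restrict_l2 a b l"
    by (rule bounded_linear_over_tendsto[OF bounded_linear_over_restrict_l2 l])
  moreover have "restrict_l2 a b (x n) = x n" for n using x L2_on_iff_restrict by blast
  ultimately have "x \<longlonglongrightarrow> restrict_l2 a b l" by simp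
  then have "restrict_l2 a b l = l" using l LIMSEQ_unique by blast
  then show "l \<in> L2_on a b" by (simp add: L2_on_iff_restrict)
qed

end

lemma step_plus_J_inject:
  assumes "0 < L" "f \<in> L2_on 0 L" "g \<in> L2_on 0 L" and eq: "step_l2 0 L d + J_l2 L f = step_l2 0 L e + J_l2 L g"
  shows "d = e" "f = g"
proof -
  have "has_weak_deriv 0 L 1 (step_l2 0 L d + J_l2 L f) f"
    by (rule has_weak_deriv_step_plus_J[OF assms(1)])
  moreover have "has_weak_deriv 0 L 1 (step_l2 0 L d + J_l2 L f) g"
    unfolding eq by (rule has_weak_deriv_step_plus_J[OF assms(1)])
  ultimately show "f = g" using weak_deriv_unique assms by blast
  then have "prim (step_l2 0 L d) 0 L = prim (step_l2 0 L e) 0 L" using eq by simp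
  then show "d = e" using assms(1) by (simp add: prim_step_l2)
qed

theorem theorem3:
  fixes N :: nat and b :: "int \<Rightarrow> real"
    and A1 :: "'a::{euclidean_space,real_normed_field} l2 \<Rightarrow> 'a l2"
  assumes "N \<ge> 1"
    and "Determinant.det (R1_mat N b) \<noteq> 0"
    and "Determinant.det (R2_mat N b) = 0"
    and "bounded_operator_W1_0 N A1"
  shows "fredholm scale_l2 scale_l2 (L2_on 0 (real N + 1)) (L2_on 0 (real N + 1))
           (A_R_dom N b) (A_R N b A1)
         \<and> fredholm_index scale_l2 scale_l2 (L2_on 0 (real N + 1))
             (A_R_dom N b) (A_R N b A1) = 0"
proof -
  define s :: "'a \<Rightarrow> 'a l2 \<Rightarrow> 'a l2" where "s = scale_l2"
  define L where "L = real N + 1"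
  define X :: "'a l2 set" where "X = L2_on 0 L"
  interpret vector_space s unfolding s_def by (rule vector_space_scale_l2)
  have L: "0 < L" "1 \<le> L" by (simp_all add: L_def)
  have X: "subspace X" "closed X"
    using subspace_L2_on closed_L2_on by (auto simp: X_def s_def)
  note X_rules = subspace_0[OF X(1)] subspace_add[OF X(1)] subspace_diff[OF X(1)] subspace_scale[OF X(1)]

  obtain C where RiR0: "\<And>v :: 'a l2. v \<in> L2_on 0 (real N + 1) \<Longrightarrow> matrix_l2 (Suc N) C (diff_op_Q N b v) = v"
    and RRi0: "\<And>v :: 'a l2. v \<in> L2_on 0 (real N + 1) \<Longrightarrow> diff_op_Q N b (matrix_l2 (Suc N) C v) = v"
    using matrix_l2_inverse_if_det_nonzero[OF assms(2)] by metis
  define R :: "'a l2 \<Rightarrow> 'a l2" where "R = diff_op_Q N b"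
  define Ri :: "'a l2 \<Rightarrow> 'a l2" where "Ri = matrix_l2 (Suc N) C"
  define J :: "'a l2 \<Rightarrow> 'a l2" where "J = J_l2 L"
  define I :: "'a l2 \<Rightarrow> 'a" where "I u = prim u 0 L" for u
  define one :: "'a l2" where "one = step_l2 0 L 1"
  have RiR: "Ri (R v) = v" and RRi: "R (Ri v) = v" if "v \<in> X" for v
    using RiR0 RRi0 that by (simp_all add: R_def Ri_def X_def L_def)
  have Ri_X: "Ri v \<in> X" for v
    using matrix_l2_in_L2_on[of "Suc N" C v] by (simp add: Ri_def X_def L_def add.commute)
  have R_X: "R v \<in> X" for v
    by (simp add: R_def X_def L_def diff_op_Q_def restrict_l2_in_L2_on)
  have J_X: "J v \<in> X" for v by (simp add: J_def X_def J_l2_in_L2_on)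
  have one_X: "one \<in> X" by (simp add: one_def X_def step_l2_in_L2_on)
  have step: "step_l2 0 L d = s d one" for d
    using step_l2_mult[of 0 L d 1] by (simp add: s_def one_def)

  have bRi: "bounded_linear_over s s Ri"
    unfolding s_def Ri_def by (rule bounded_linear_over_matrix_l2)
  have bJ: "bounded_linear_over s s J"
    unfolding s_def J_def by (rule bounded_linear_over_J_l2) (use L in simp)
  have bprim: "bounded_linear_over s (*) (\<lambda>u. prim u a c)" if "a \<le> c" for a c
    unfolding s_def by (rule bounded_linear_over_prim[OF that])
  have bI: "bounded_linear_over s (*) I"
    unfolding I_def using L by (intro bprim) simp
  have bscale: "bounded_linear_over s s (\<lambda>u. s (\<phi> u) w)" if "bounded_linear_over s (*) \<phi>" for \<phi> w
    using bounded_linear_over_scale_l2 that unfolding s_def .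
  have bmult: "bounded_linear_over s (*) (\<lambda>u. c * \<phi> u)" if "bounded_linear_over s (*) \<phi>" for \<phi> c
    using bounded_linear_over_mult that unfolding s_def .
  have bid: "bounded_linear_over s s (\<lambda>u. u)"
    unfolding s_def by (rule bounded_linear_over_id)
  interpret Ri: Vector_Spaces.linear s s Ri using bRi by (simp add: bounded_linear_over_def)
  interpret J: Vector_Spaces.linear s s J using bJ by (simp add: bounded_linear_over_def)
  interpret I: Vector_Spaces.linear s "(*)" I using bI by (simp add: bounded_linear_over_def)

  text \<open>
    Elements of the domain are \<open>J g\<close> with \<open>g\<close> of mean zero and \<open>R g = (R (J g))'\<close> in \<open>W\<^sup>1\<close>, that is,
    \<open>R g = d + J f\<close> for a constant \<open>d\<close> and some \<open>f\<close> in \<open>L\<^sub>2\<close>.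
  \<close>
  define G where "G d f = Ri (s d one + J f)" for d f
  have G_X: "G d f \<in> X" for d f by (simp add: G_def Ri_X)
  have RJ: "\<exists>c. R (J g) = step_l2 0 L c + J_l2 L (R g)" if "g \<in> X" "I g = 0" for g
    using diff_op_Q_J[of g N b] that by (auto simp: R_def J_def X_def L_def I_def)
  have dom: "A_R_dom N b = {J (G d f) | d f. f \<in> X \<and> I (G d f) = 0}"
  proof (intro subset_antisym subsetI)
    fix v :: "'a l2" assume "v \<in> A_R_dom N b"
    then have v: "v \<in> Sobolev1_0 0 L" "R v \<in> Sobolev 2 0 L"
      by (auto simp: A_R_dom_def L_def R_def)
    then obtain g where g: "g \<in> X" "I g = 0" "v = J g"
      using Sobolev1_0_iff[OF L(1)] by (auto simp: X_def I_def J_def)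
    then have "R g \<in> Sobolev 1 0 L"
      using RJ[OF g(1,2)] v(2) step_plus_J_in_Sobolev_2_iff[OF L(1), of "R g"] R_X[of g]
      by (auto simp: X_def)
    then obtain d f where f: "f \<in> X" "R g = s d one + J f"
      unfolding Sobolev_1_iff[OF L(1)] step by (auto simp: X_def J_def)
    then have "g = G d f" using RiR[OF g(1)] by (simp add: G_def)
    then show "v \<in> {J (G d f) | d f. f \<in> X \<and> I (G d f) = 0}" using f g by blast
  next
    fix v assume "v \<in> {J (G d f) | d f. f \<in> X \<and> I (G d f) = 0}"
    then obtain d f where f: "f \<in> X" "I (G d f) = 0" "v = J (G d f)" by blast
    have "v \<in> Sobolev1_0 0 L"
      using Sobolev1_0_iff[OF L(1)] f(2,3) G_X[of d f] by (auto simp: X_def I_def J_def)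
    moreover have "R (G d f) = step_l2 0 L d + J_l2 L f"
      unfolding G_def using RRi[of "s d one + J f"] one_X J_X[of f] X_rules by (simp add: step J_def)
    then have "R (G d f) \<in> Sobolev 1 0 L"
      unfolding Sobolev_1_iff[OF L(1)] using f(1) by (auto simp: X_def)
    then have "R v \<in> Sobolev 2 0 L"
      using RJ[OF G_X f(2)] step_plus_J_in_Sobolev_2_iff[OF L(1), of "R (G d f)"] R_X[of "G d f"] f(3)
      by (auto simp: X_def)
    ultimately show "v \<in> A_R_dom N b" by (simp add: A_R_dom_def L_def R_def)
  qed
  have A_R: "A_R N b A1 (J (G d f)) = A1 (J (G d f)) - f" if f: "f \<in> X" "I (G d f) = 0" for d f
  proof -
    have RG: "R (G d f) = step_l2 0 L d + J_l2 L f"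
      unfolding G_def using RRi[of "s d one + J f"] one_X J_X[of f] X_rules by (simp add: step J_def)
    obtain c where "R (J (G d f)) = step_l2 0 L c + J_l2 L (step_l2 0 L d + J_l2 L f)"
      using RJ[OF G_X f(2)] RG by auto
    then have "weak_deriv 0 L 2 (R (J (G d f))) = f"
      using weak_deriv_2_step_plus_J[OF L(1), of f] f(1) by (simp add: X_def)
    then show ?thesis by (simp add: A_R_def R_def L_def)
  qed

  define lam where "lam f = I (Ri (J f))" for f
  define m where "m = I (Ri one)"
  have blam: "bounded_linear_over s (*) lam"
    unfolding lam_def by (intro bounded_linear_over_compose[OF bJ] bounded_linear_over_compose[OF bRi] bI)
  interpret lam: Vector_Spaces.linear s "(*)" lam using blam by (simp add: bounded_linear_over_def)
  have IG: "I (G d f) = d * m + lam f" for d f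
    by (simp add: G_def Ri.add I.add Ri.scale I.scale m_def lam_def)
  \<comment> \<open>If \<open>m\<close> and \<open>lam\<close> both vanished, the constraint would
    be empty and the free scalar would not be compensated. For the tent derivative \<open>p\<close>
    the operators commute, \<open>R (J p) = J (R p)\<close>, hence
    \<open>lam (R p) = I (J p) \<noteq> 0\<close>; scaling makes the value 1.\<close>
  obtain f0 where f0: "f0 \<in> X" "lam f0 = 1"
  proof -
    obtain p :: "'a l2" where p: "p \<in> X" "\<And>j::int. prim p 0 (of_int j) = 0" "I p = 0" "I (J p) \<noteq> 0"
      using tent_function_exists[OF L(2)] unfolding X_def I_def J_def by metis
    have "R (J p) = J (R p)"
      using diff_op_Q_J[of p N b] p(1,3) by (simp add: R_def J_def X_def L_def I_def p(2))
    then have "lam (R p) = I (J p)"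
      using RiR[OF J_X[of p]] by (simp add: lam_def)
    then have "lam (s (1 / I (J p)) (R p)) = 1" using p(4) by (simp add: lam.scale)
    then show thesis using R_X[of p] X_rules by (intro that) auto
  qed

  text \<open>
    The constraint \<open>d m + \<lambda> f = 0\<close> determines \<open>d\<close> if \<open>m \<noteq> 0\<close>; if \<open>m = 0\<close>, the free parameter \<open>d\<close>
    replaces the \<open>f\<^sub>0\<close>-component of \<open>f\<close>. Either way the domain is parametrized by \<open>X\<close>.
  \<close>
  obtain p q where pq:
    "\<And>f. p * lam f * m + lam (f - s (q * lam f) f0) = 0"
    "\<And>f. p * lam f = 0 \<Longrightarrow> f - s (q * lam f) f0 = 0 \<Longrightarrow> f = 0"
    "\<And>d f'. f' \<in> X \<Longrightarrow> d * m + lam f' = 0 \<Longrightarrow> \<exists>f\<in>X. p * lam f = d \<and> f - s (q * lam f) f0 = f'"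
  proof (cases "m = 0")
    case True
    show thesis
    proof (rule that[of 1 1])
      fix d f' assume f': "f' \<in> X" "d * m + lam f' = 0"
      then have "lam (f' + s d f0) = d" using True f0 by (simp add: lam.add lam.scale)
      then show "\<exists>f\<in>X. 1 * lam f = d \<and> f - s (1 * lam f) f0 = f'"
        using f' f0 X_rules by (intro bexI[of _ "f' + s d f0"]) auto
    qed (use True f0 in \<open>auto simp: lam.diff lam.scale\<close>)
  next
    case False
    show thesis
    proof (rule that[of "- 1 / m" 0])
      fix d f' assume f': "f' \<in> X" "d * m + lam f' = 0"
      then have "lam f' = - (d * m)" by (simp add: eq_neg_iff_add_eq_0 add.commute)
      then show "\<exists>f\<in>X. - 1 / m * lam f = d \<and> f - s (0 * lam f) f0 = f'"
        using f' False by (intro bexI[of _ f']) auto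
    qed (use False in auto)
  qed
  define \<Phi> where "\<Phi> f = f - s (q * lam f) f0" for f
  define S where "S f = J (G (p * lam f) (\<Phi> f))" for f
  have b\<Phi>: "bounded_linear_over s s \<Phi>"
    unfolding \<Phi>_def by (intro bounded_linear_over_diff bid bscale bmult blam)
  have \<Phi>_X: "\<Phi> f \<in> X" if "f \<in> X" for f using that f0 X_rules by (simp add: \<Phi>_def)
  have bS: "bounded_linear_over s s S"
    unfolding S_def G_def
    by (intro bounded_linear_over_compose[OF _ bJ] bounded_linear_over_compose[OF _ bRi]
        bounded_linear_over_add bscale bmult blam b\<Phi>)
  interpret S: Vector_Spaces.linear s s S using bS by (simp add: bounded_linear_over_def)
  have I0: "I (G (p * lam f) (\<Phi> f)) = 0" for f
    using pq(1) by (simp add: IG \<Phi>_def)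
  have SX: "S ` X = A_R_dom N b"
  proof (intro subset_antisym subsetI)
    fix v assume "v \<in> S ` X"
    then show "v \<in> A_R_dom N b" unfolding dom S_def using I0 \<Phi>_X by blast
  next
    fix v :: "'a l2" assume "v \<in> A_R_dom N b"
    then obtain d f' where f': "f' \<in> X" "I (G d f') = 0" "v = J (G d f')" unfolding dom by blast
    then obtain f where "f \<in> X" "p * lam f = d" "f - s (q * lam f) f0 = f'"
      using pq(3)[of f' d] by (auto simp: IG)
    then have "v = S f" "f \<in> X" using f' by (simp_all add: S_def \<Phi>_def)
    then show "v \<in> S ` X" by blast
  qed
  have inj_S: "inj_on S X"
  proof (rule inj_onI)
    fix f f' assume f: "f \<in> X" "f' \<in> X" "S f = S f'"
    define u where "u = f - f'"
    have u: "u \<in> X" using f X_rules by (simp add: u_def)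
    \<comment> \<open>Injectivity is peeled off in turn: of \<open>J\<close>, of \<open>Ri\<close>
      on \<open>X\<close>, and of the representation of a function by its constant and its
      derivative. What remains is the second property of \<open>p\<close> and
      \<open>q\<close>.\<close>
    have "J (G (p * lam u) (\<Phi> u)) = 0" using f by (simp add: S_def[symmetric] u_def S.diff)
    then have "step_l2 0 L 0 + J_l2 L (G (p * lam u) (\<Phi> u)) = step_l2 0 L 0 + J_l2 L 0"
      using J.zero by (simp add: J_def)
    then have "G (p * lam u) (\<Phi> u) = 0"
      using step_plus_J_inject(2)[OF L(1)] G_X X_rules(1) unfolding X_def by blast
    then have "R (G (p * lam u) (\<Phi> u)) = R (Ri 0)" by (simp add: Ri.zero)
    then have "s (p * lam u) one + J (\<Phi> u) = 0"
      using RRi[of "s (p * lam u) one + J (\<Phi> u)"] RRi[of 0] one_X J_X X_rules by (simp add: G_def)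
    then have eq: "step_l2 0 L (p * lam u) + J_l2 L (\<Phi> u) = step_l2 0 L 0 + J_l2 L 0"
      using J.zero by (simp add: J_def step)
    have "p * lam u = 0" "\<Phi> u = 0"
      using step_plus_J_inject[OF L(1) _ _ eq] \<Phi>_X[OF u] X_rules(1) by (auto simp: X_def)
    then have "u = 0" using pq(2) by (simp add: \<Phi>_def)
    then show "f = f'" by (simp add: u_def)
  qed

  text \<open>\<open>A1 \<circ> J\<close>, defined on functions of mean zero only, is extended by subtracting the mean.\<close>
  define Pr where "Pr g = restrict_l2 0 L g - s ((1 / of_real L) * I (restrict_l2 0 L g)) one" for g
  define T0 where "T0 g = A1 (J (Pr g))" for g
  have brestrict: "bounded_linear_over s s (restrict_l2 0 L)"
    unfolding s_def by (rule bounded_linear_over_restrict_l2)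
  have bPr: "bounded_linear_over s s Pr"
    unfolding Pr_def
    by (intro bounded_linear_over_diff brestrict bscale bmult bounded_linear_over_compose[OF brestrict bI])
  interpret Pr: Vector_Spaces.linear s s Pr using bPr by (simp add: bounded_linear_over_def)
  have Pr_X: "Pr g \<in> X" for g
    using restrict_l2_in_L2_on[of 0 L g] one_X X_rules by (simp add: Pr_def X_def)
  have I_one: "I one = of_real L"
    using L by (simp add: I_def one_def prim_step_l2 of_real_def)
  have I_Pr: "I (Pr g) = 0" for g
    using L by (simp add: Pr_def I.diff I.scale I_one)
  have Pr_id: "Pr g = g" if "g \<in> X" "I g = 0" for g
  proof -
    have "restrict_l2 0 L g = g" using that(1) by (simp add: X_def L2_on_iff_restrict)
    then show ?thesis by (simp add: Pr_def that(2))
  qed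
  have JPr: "J (Pr g) \<in> Sobolev1_0 0 L" for g
    using Sobolev1_0_iff[OF L(1)] Pr_X[of g] I_Pr[of g] by (auto simp: X_def I_def J_def)
  have A1: "linear_operator_on s s (Sobolev1_0 0 L) X A1"
    and "\<exists>K. \<forall>u\<in>Sobolev1_0 0 L. norm (A1 u) \<le> K * Sobolev_norm 1 0 L u"
    using assms(4) by (simp_all add: bounded_operator_W1_0_def L_def X_def s_def)
  then obtain K1 where K1: "\<And>u. u \<in> Sobolev1_0 0 L \<Longrightarrow> norm (A1 u) \<le> K1 * Sobolev_norm 1 0 L u"
    by blast
  have bT0: "bounded_linear_over s s T0"
  proof -
    obtain K2 where K2: "K2 \<ge> 0" "\<And>u. norm (Pr u) \<le> K2 * norm u"
      using bounded_linear_over_bound[OF bPr] by blast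
    show ?thesis
    proof (rule bounded_linear_overI)
      show "Vector_Spaces.linear s s T0"
        using A1 JPr unfolding linear_operator_on_def
        by unfold_locales (simp_all add: T0_def Pr.add Pr.scale J.add J.scale)
      fix g
      have "norm (T0 g) \<le> K1 * Sobolev_norm 1 0 L (J (Pr g))"
        unfolding T0_def by (rule K1[OF JPr])
      also have "\<dots> \<le> \<bar>K1\<bar> * Sobolev_norm 1 0 L (J (Pr g))"
        by (intro mult_right_mono) (auto simp: Sobolev_norm_def sum_nonneg)
      also have "\<dots> \<le> \<bar>K1\<bar> * ((L + 1) * norm (Pr g))"
        using Sobolev_norm_1_J[OF L(1), of "Pr g"] Pr_X[of g]
        by (intro mult_left_mono) (auto simp: X_def J_def)
      also have "\<dots> \<le> \<bar>K1\<bar> * ((L + 1) * (K2 * norm g))"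
        using L K2 by (intro mult_left_mono) auto
      finally show "norm (T0 g) \<le> (\<bar>K1\<bar> * ((L + 1) * K2)) * norm g" by (simp add: mult.assoc)
    qed
  qed
  \<comment> \<open>For \<open>g = s d one + J f\<close> satisfying the constraint,
    \<open>T g\<close> is \<open>A1\<close> of the domain element. As \<open>f\<close> enters
    \<open>g\<close> only behind \<open>J\<close>, approximating \<open>J\<close> by finite rank
    approximates this term in norm.\<close>
  define T where "T g = T0 (Ri g)" for g
  have bT: "bounded_linear_over s s T"
    unfolding T_def by (rule bounded_linear_over_compose[OF bRi bT0])
  interpret T: Vector_Spaces.linear s s T using bT by (simp add: bounded_linear_over_def)
  have T_X: "T g \<in> X" for g
    using A1 JPr[of "Ri g"] by (auto simp: T_def T0_def linear_operator_on_def)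
  have T_G: "T (s d one + J f) = A1 (J (G d f))" if "I (G d f) = 0" for d f
    using Pr_id[OF G_X that] by (simp add: T_def T0_def G_def)

  \<comment> \<open>Splitting into a small part and a part of finite rank\<close>
  obtain KT where KT: "KT \<ge> 0" "\<And>u. norm (T u) \<le> KT * norm u"
    using bounded_linear_over_bound[OF bT] by blast
  \<comment> \<open>With the approximation error \<open>L / sqrt n\<close> for \<open>J\<close> and
    the bound \<open>KT\<close> for \<open>T\<close>, this size of \<open>n\<close> gives the factor
    1/2 that the perturbation theorem demands of \<open>E\<close>.\<close>
  obtain n :: nat where n: "(2 * KT * L)\<^sup>2 < real n" using reals_Archimedean2 by blast
  then have npos: "n > 0"
    by (metis gr0I not_less of_nat_0 zero_le_power2)
  have KTn: "KT * (L / sqrt n) \<le> 1 / 2"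
  proof -
    have "2 * KT * L \<le> sqrt n" using n by (intro real_le_rsqrt) simp
    then show ?thesis using npos by (simp add: field_simps)
  qed
  define x where "x i = real i * (L / n)" for i
  have x0: "0 \<le> x i" for i using L by (simp add: x_def)
  define e :: "nat \<Rightarrow> 'a l2" where "e i = step_l2 (x i) (x (Suc i)) 1" for i
  define P where "P f = (\<Sum>i<n. s (prim f 0 (x i)) (e i))" for f
  have bP: "bounded_linear_over s s P"
    unfolding P_def
    by (intro bounded_linear_over_sum vector_space_axioms bscale bprim x0) auto
  have P_approx: "norm (J f - P f) \<le> L / sqrt n * norm f" for f
  proof -
    have "step_l2 (x i) (x (Suc i)) c = s c (e i)" for i c
      using step_l2_mult[of "x i" "x (Suc i)" c 1] by (simp add: e_def s_def)
    then have "P f = (\<Sum>i<n. step_l2 (x i) (x (Suc i)) (prim f 0 (x i)))"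
      by (simp add: P_def)
    then show ?thesis using J_l2_step_approx[OF L(1) npos, of f] by (simp add: x_def J_def)
  qed
  define E where "E f = T (J f - P f)" for f
  have bE: "bounded_linear_over s s E"
    unfolding E_def by (intro bounded_linear_over_compose[OF _ bT] bounded_linear_over_diff bJ bP)
  have E_le: "norm (E f) \<le> norm f / 2" for f
  proof -
    have "norm (E f) \<le> KT * norm (J f - P f)" unfolding E_def by (rule KT)
    also have "\<dots> \<le> KT * (L / sqrt n * norm f)" using KT by (intro mult_left_mono P_approx)
    also have "\<dots> = (KT * (L / sqrt n)) * norm f" by simp
    also have "\<dots> \<le> (1 / 2) * norm f" using KTn by (intro mult_right_mono) auto
    finally show ?thesis by simp
  qed
  \<comment> \<open>Inserting \<open>\<Phi> f = f - s (q * lam f) f0\<close> into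
    \<open>T (J (\<Phi> f)) - \<Phi> f\<close> leaves exactly this vector as the coefficient of
    \<open>q * lam f\<close>.\<close>
  define w where "w = f0 - T (J f0)"
  define F where "F f = s (q * lam f) w + s (p * lam f) (T one) + T (P f)" for f
  have bF: "bounded_linear_over s s F"
    unfolding F_def
    by (intro bounded_linear_over_add bscale bmult blam bounded_linear_over_compose[OF bP bT])
  define B where "B = insert w (insert (T one) ((\<lambda>i. T (e i)) ` {..<n}))"
  have FB: "range F \<subseteq> span B"
  proof
    fix y assume "y \<in> range F"
    then obtain f where y: "y = F f" by blast
    have "T (P f) = (\<Sum>i<n. s (prim f 0 (x i)) (T (e i)))" by (simp add: P_def T.sum T.scale)
    also have "\<dots> \<in> span B" by (intro span_sum span_scale span_base) (auto simp: B_def)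
    finally have "T (P f) \<in> span B" .
    moreover have "w \<in> span B" "T one \<in> span B" by (auto simp: B_def intro: span_base)
    ultimately show "y \<in> span B" unfolding y F_def by (intro span_add span_scale)
  qed
  have B: "finite B" "B \<subseteq> X"
    using T_X f0 X_rules by (auto simp: B_def w_def)
  have AS: "A_R N b A1 (S f) = F f - (f - E f)" if "f \<in> X" for f
  proof -
    have "A_R N b A1 (S f) = T (s (p * lam f) one + J (\<Phi> f)) - \<Phi> f"
      unfolding S_def using A_R[OF \<Phi>_X[OF that] I0] T_G[OF I0] by simp
    also have "\<dots> = F f - (f - E f)"
      by (simp add: \<Phi>_def F_def E_def w_def T.add T.scale T.diff J.diff J.scale scale_right_diff_distrib algebra_simps)
    finally show ?thesis .
  qed
  have lin: "Vector_Spaces.linear s s E"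
    using bE by (simp add: bounded_linear_over_def)
  have "S ` X \<subseteq> X" "E ` X \<subseteq> X" using J_X T_X by (auto simp: S_def E_def)
  then have "fredholm s s X X (S ` X) (A_R N b A1) \<and> fredholm_index s s X (S ` X) (A_R N b A1) = 0"
    by (intro fredholm_index_zero_perturbation[where E = E and F = F and B = B]
        vector_space_axioms X lin bS bF inj_S E_le FB B AS) (auto simp: s_def norm_scale_l2)
  then show ?thesis unfolding SX by (simp add: s_def X_def L_def)
qed

end
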